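(* Let $M$ be an $n$-dimensional manifold and let $\Omega\subset M$ be an open precompact domain with smooth boundary $\partial\Omega\neq\emptyset$. Let $\varphi:M\times[0,T_{\rm mc})\to\mathbb{R}^{n+1}$ be an inverse mean curvature flow such that for every $t\in[0,T_{\rm mc})$ the image $\varphi_t(M)$ is a strictly convex hypersurface of $\mathbb{R}^{n+1}$. Then the function $$t\mapsto \mathrm{V}(\Omega_t)^{-3}\,\mathcal{T}(\Omega_t)$$ is non-increasing for $t\in[0,T_{\rm mc})$, and the function $$t\mapsto \mathrm{V}(\Omega_t)^{-1}\,\mathcal{T}(\Omega_t)$$ is non-decreasing for $t\in[0,T_{\rm mc})$.
   Context: An inverse mean curvature flow is a smooth family of immersions $\varphi_t=\varphi(\cdot,t):M\to\mathbb{R}^{n+1}$ with $\frac{\partial}{\partial t}\varphi(p,t)=-\vec H_t(p)/\|\vec H_t(p)\|^2$, where $\vec H_t$ is the mean curvature vector of $\varphi_t$ (the unnormalized trace of the second fundamental form). $M$ carries at time $t$ the induced metric $g_t=\varphi_t^*\langle\cdot,\cdot\rangle_{\mathbb{R}^{n+1}}$. Strictly convex means that, for the appropriate choice of unit normal, the scalar second fundamental form $h$ is positive definite; in particular $H=\mathrm{tr}_{g_t}h>0$. $T_{\rm mc}$ denotes a time up to which the hypersurface stays strictly convex. $\mathrm{V}(\Omega_t)$ is the volume of $\Omega$ with respect to $g_t$. The torsional rigidity is $\mathcal{T}(\Omega_t)=\int_\Omega E_t\,d\mathrm{V}_t$, where $d\mathrm{V}_t$ is the volume element of $g_t$ and $E_t$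 solves $\Delta_{g_t}E_t=-1$ in $\Omega$, $E_t=0$ on $\partial\Omega$. *)

theory Defs
  imports "HOL-Analysis.Analysis"
begin

section \<open>Smooth maps and smooth manifolds\<close>

text \<open>Derivatives are taken within \<open>S\<close>, so that the same notion covers open sets and
  products of an open set with a half-open interval, where it amounts to one-sided
  derivatives at the initial time. On both kinds of set the derivative within \<open>S\<close> is unique.\<close>

primrec C_k_on :: "nat \<Rightarrow> 'a::real_normed_vector set \<Rightarrow> ('a \<Rightarrow> 'b::real_normed_vector) \<Rightarrow> bool" where
  "C_k_on 0 S f \<longleftrightarrow> continuous_on S f"
| "C_k_on (Suc k) S f \<longleftrightarrow> (\<forall>x\<in>S. f differentiable (at x within S)) \<and>
     (\<forall>v. C_k_on k S (\<lambda>x. frechet_derivative f (at x within S) v))"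

definition smooth_on :: "'a::real_normed_vector set \<Rightarrow> ('a \<Rightarrow> 'b::real_normed_vector) \<Rightarrow> bool" where
  "smooth_on S f \<longleftrightarrow> (\<forall>k. C_k_on k S f)"

text \<open>A chart is a pair of its domain and its coordinate map; only the values of the coordinate
  map on the domain matter. The manifold is the whole type \<open>'m\<close>.\<close>

type_synonym ('m, 'n) chart = "'m set \<times> ('m \<Rightarrow> real^'n)"

definition is_chart :: "('m::topological_space, 'n::finite) chart \<Rightarrow> bool" where
  "is_chart c \<longleftrightarrow> open (fst c) \<and> open (snd c ` fst c) \<and>
     homeomorphism (fst c) (snd c ` fst c) (snd c) (inv_into (fst c) (snd c))"

definition local_rep :: "('m, 'n::finite) chart \<Rightarrow> ('m \<Rightarrow> 'b) \<Rightarrow> real^'n \<Rightarrow> 'b" where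
  "local_rep c f x = f (inv_into (fst c) (snd c) x)"

definition smooth_compatible :: "('m, 'n::finite) chart \<Rightarrow> ('m, 'n) chart \<Rightarrow> bool" where
  "smooth_compatible c d \<longleftrightarrow>
     smooth_on (snd c ` (fst c \<inter> fst d)) (local_rep c (snd d)) \<and>
     smooth_on (snd d ` (fst c \<inter> fst d)) (local_rep d (snd c))"

definition smooth_atlas :: "('m::topological_space, 'n::finite) chart set \<Rightarrow> bool" where
  "smooth_atlas A \<longleftrightarrow> (\<forall>c\<in>A. is_chart c) \<and> (\<Union>c\<in>A. fst c) = UNIV \<and>
     (\<forall>c\<in>A. \<forall>d\<in>A. smooth_compatible c d)"

text \<open>Near each boundary point there is a chart of the smooth structure (not necessarily a member
  of the given atlas) in which \<open>\<Omega>\<close> is a half space; in particular \<open>\<Omega>\<close> lies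
  locally on one side of its boundary.\<close>

definition smooth_boundary :: "('m::topological_space, 'n::finite) chart set \<Rightarrow> 'm set \<Rightarrow> bool" where
  "smooth_boundary A \<Omega> \<longleftrightarrow> (\<forall>p\<in>frontier \<Omega>. \<exists>c k.
     is_chart c \<and> (\<forall>d\<in>A. smooth_compatible c d) \<and> p \<in> fst c \<and>
     snd c ` (fst c \<inter> \<Omega>) = {x \<in> snd c ` fst c. x $ k > 0} \<and>
     snd c ` (fst c \<inter> frontier \<Omega>) = {x \<in> snd c ` fst c. x $ k = 0})"


section \<open>Riemannian metrics in coordinates\<close>

definition partial_deriv :: "'n::finite \<Rightarrow> (real^'n \<Rightarrow> 'b::real_normed_vector) \<Rightarrow> real^'n \<Rightarrow> 'b" where
  "partial_deriv i f x = frechet_derivative f (at x) (axis i 1)"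

text \<open>A metric is given by its coefficient matrix \<open>g\<^sub>i\<^sub>j\<close> in every chart.\<close>

type_synonym ('m, 'n) metric_coeffs = "('m, 'n) chart \<Rightarrow> real^'n \<Rightarrow> real^'n^'n"

definition induced_metric :: "('m \<Rightarrow> 'b::real_inner) \<Rightarrow> ('m, 'n::finite) metric_coeffs" where
  "induced_metric f c x =
     (\<chi> i j. partial_deriv i (local_rep c f) x \<bullet> partial_deriv j (local_rep c f) x)"

text \<open>The volume measure is the Borel measure with density \<open>\<surd>(det g)\<close> with respect to Lebesgue
  measure in every chart; by the change of variables formula it exists, and it is unique because
  countably many charts cover a second countable space.\<close>

definition riemannian_volume ::
    "('m::topological_space, 'n::finite) chart set \<Rightarrow> ('m, 'n) metric_coeffs \<Rightarrow> 'm measure" where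
  "riemannian_volume A g = (THE \<mu>. sets \<mu> = sets borel \<and>
     (\<forall>c\<in>A. \<forall>B\<in>sets borel. B \<subseteq> fst c \<longrightarrow>
        emeasure \<mu> B = (\<integral>\<^sup>+x\<in>snd c ` B. ennreal (sqrt (det (g c x))) \<partial>lborel)))"

definition gradient ::
    "('m, 'n::finite) metric_coeffs \<Rightarrow> ('m, 'n) chart \<Rightarrow> ('m \<Rightarrow> real) \<Rightarrow> real^'n \<Rightarrow> real^'n" where
  "gradient g c u x = matrix_inv (g c x) *v (\<chi> j. partial_deriv j (local_rep c u) x)"

definition divergence ::
    "('m, 'n::finite) metric_coeffs \<Rightarrow> ('m, 'n) chart \<Rightarrow> (real^'n \<Rightarrow> real^'n) \<Rightarrow> real^'n \<Rightarrow> real" where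
  "divergence g c X x =
     (\<Sum>i\<in>UNIV. partial_deriv i (\<lambda>y. sqrt (det (g c y)) * X y $ i) x) / sqrt (det (g c x))"

definition laplace_beltrami ::
    "('m, 'n::finite) metric_coeffs \<Rightarrow> ('m, 'n) chart \<Rightarrow> ('m \<Rightarrow> real) \<Rightarrow> real^'n \<Rightarrow> real" where
  "laplace_beltrami g c u = divergence g c (gradient g c u)"

text \<open>Classical solutions of \<open>\<Delta>\<^sub>g u = -1\<close> in \<open>\<Omega>\<close>, \<open>u = 0\<close> on the boundary, of class
  \<open>C\<^sup>2\<close> in \<open>\<Omega>\<close> and continuous up to the boundary.\<close>

definition torsion_function ::
    "('m::topological_space, 'n::finite) chart set \<Rightarrow> ('m, 'n) metric_coeffs \<Rightarrow> 'm set \<Rightarrow> ('m \<Rightarrow> real) \<Rightarrow> bool" where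
  "torsion_function A g \<Omega> u \<longleftrightarrow>
     continuous_on (closure \<Omega>) u \<and>
     (\<forall>c\<in>A. C_k_on 2 (snd c ` (fst c \<inter> \<Omega>)) (local_rep c u)) \<and>
     (\<forall>c\<in>A. \<forall>p\<in>fst c \<inter> \<Omega>. laplace_beltrami g c u (snd c p) = -1) \<and>
     (\<forall>p\<in>frontier \<Omega>. u p = 0)"


section \<open>Immersed hypersurfaces and inverse mean curvature flow\<close>

definition immersion :: "('m, 'n::finite) chart set \<Rightarrow> ('m \<Rightarrow> 'b::real_normed_vector) \<Rightarrow> bool" where
  "immersion A f \<longleftrightarrow> (\<forall>c\<in>A. smooth_on (snd c ` fst c) (local_rep c f) \<and>
     (\<forall>x\<in>snd c ` fst c. inj (frechet_derivative (local_rep c f) (at x))))"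

text \<open>The tangential part of \<open>v\<close> is \<open>\<Sum> g\<^sup>k\<^sup>l \<langle>v, \<partial>\<^sub>k f\<rangle> \<partial>\<^sub>l f\<close>.\<close>

definition normal_part ::
    "('m, 'n::finite) chart \<Rightarrow> ('m \<Rightarrow> 'b::real_inner) \<Rightarrow> real^'n \<Rightarrow> 'b \<Rightarrow> 'b" where
  "normal_part c f x v = v - (\<Sum>k\<in>UNIV. \<Sum>l\<in>UNIV.
     (matrix_inv (induced_metric f c x) $ k $ l * (v \<bullet> partial_deriv k (local_rep c f) x))
       *\<^sub>R partial_deriv l (local_rep c f) x)"

definition second_fundamental_form ::
    "('m, 'n::finite) chart \<Rightarrow> ('m \<Rightarrow> 'b::real_inner) \<Rightarrow> real^'n \<Rightarrow> 'n \<Rightarrow> 'n \<Rightarrow> 'b" where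
  "second_fundamental_form c f x i j =
     normal_part c f x (partial_deriv i (partial_deriv j (local_rep c f)) x)"

definition mean_curvature_vector ::
    "('m, 'n::finite) chart \<Rightarrow> ('m \<Rightarrow> 'b::real_inner) \<Rightarrow> real^'n \<Rightarrow> 'b" where
  "mean_curvature_vector c f x = (\<Sum>i\<in>UNIV. \<Sum>j\<in>UNIV.
     matrix_inv (induced_metric f c x) $ i $ j *\<^sub>R second_fundamental_form c f x i j)"

definition unit_normal_field ::
    "('m::topological_space, 'n::finite) chart set \<Rightarrow> ('m \<Rightarrow> 'b::real_inner) \<Rightarrow> ('m \<Rightarrow> 'b) \<Rightarrow> bool" where
  "unit_normal_field A f \<nu> \<longleftrightarrow> continuous_on UNIV \<nu> \<and> (\<forall>p. norm (\<nu> p) = 1) \<and>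
     (\<forall>c\<in>A. \<forall>p\<in>fst c. \<forall>i. \<nu> p \<bullet> partial_deriv i (local_rep c f) (snd c p) = 0)"

definition scalar_second_fundamental_form ::
    "('m, 'n::finite) chart \<Rightarrow> ('m \<Rightarrow> 'b::real_inner) \<Rightarrow> ('m \<Rightarrow> 'b) \<Rightarrow> real^'n \<Rightarrow> real^'n^'n" where
  "scalar_second_fundamental_form c f \<nu> x =
     (\<chi> i j. second_fundamental_form c f x i j \<bullet> local_rep c \<nu> x)"

definition strictly_convex ::
    "('m::topological_space, 'n::finite) chart set \<Rightarrow> ('m \<Rightarrow> 'b::real_inner) \<Rightarrow> bool" where
  "strictly_convex A f \<longleftrightarrow> (\<exists>\<nu>. unit_normal_field A f \<nu> \<and>
     (\<forall>c\<in>A. \<forall>x\<in>snd c ` fst c. \<forall>v. v \<noteq> 0 \<longrightarrow>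
        v \<bullet> (scalar_second_fundamental_form c f \<nu> x *v v) > 0))"

text \<open>The end time may be infinite.\<close>

definition time_interval :: "ereal \<Rightarrow> real set" where
  "time_interval T = {t. 0 \<le> t \<and> ereal t < T}"

definition inverse_mean_curvature_flow ::
    "('m, 'n::finite) chart set \<Rightarrow> real set \<Rightarrow> (real \<Rightarrow> 'm \<Rightarrow> 'b::real_inner) \<Rightarrow> bool" where
  "inverse_mean_curvature_flow A I \<phi> \<longleftrightarrow>
     (\<forall>c\<in>A. smooth_on ((snd c ` fst c) \<times> I) (\<lambda>(x, t). local_rep c (\<phi> t) x)) \<and>
     (\<forall>t\<in>I. immersion A (\<phi> t)) \<and>
     (\<forall>c\<in>A. \<forall>p\<in>fst c. \<forall>t\<in>I.
        ((\<lambda>s. \<phi> s p) has_vector_derivative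
           - (mean_curvature_vector c (\<phi> t) (snd c p) /\<^sub>R
              (norm (mean_curvature_vector c (\<phi> t) (snd c p)))\<^sup>2))
        (at t within I))"

end

theory Submission
  imports Defs
begin

text \<open>Along the flow \<open>\<partial>\<^sub>tg = 2h/H\<close>, and \<open>0 \<le> h \<le> Hg\<close> by strict convexity, so that
  \<open>g\<^sub>s \<le> g\<^sub>t \<le> e\<^bsup>2(t-s)\<^esup>g\<^sub>s\<close> for \<open>s \<le> t\<close>, while the trace of \<open>\<partial>\<^sub>tg\<close> is \<open>2\<close> and hence
  \<open>dV\<^sub>t = e\<^bsup>t-s\<^esup>dV\<^sub>s\<close>. If two metrics satisfy \<open>g\<^sub>2 \<le> \<kappa>g\<^sub>1\<close> and have proportional volume
  measures, then their torsion functions satisfy \<open>\<integral>u\<^sub>2 \<le> \<kappa>\<integral>u\<^sub>1\<close>: formally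
  \<open>2\<integral>u\<^sub>2 = 2\<integral>\<langle>\<nabla>u\<^sub>1,\<nabla>u\<^sub>2\<rangle>\<^sub>1 \<le> \<kappa>\<integral>|\<nabla>u\<^sub>1|\<^sub>1\<^sup>2 + \<integral>|\<nabla>u\<^sub>2|\<^sub>2\<^sup>2 = \<kappa>\<integral>u\<^sub>1 + \<integral>u\<^sub>2\<close>.
  As the solutions are only continuous up to the boundary, this is tested with cut-offs that are
  compactly supported in \<open>\<Omega>\<close>. Applied to \<open>g\<^sub>s\<close> and \<open>g\<^sub>t\<close> in both orders it gives
  \<open>e\<^bsup>t-s\<^esup>\<T>\<^sub>s \<le> \<T>\<^sub>t \<le> e\<^bsup>3(t-s)\<^esup>\<T>\<^sub>s\<close>.\<close>

section \<open>Continuously differentiable functions\<close>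

text \<open>No regularity of \<open>E t\<close> in \<open>t\<close> is assumed, which is why two
  times are compared directly instead of differentiating the rigidity. The comparison rests on
  duality: a bound g2 \<le> \<kappa> g1 on vectors becomes the reverse bound for the inverse metrics
  on differentials, and this makes the quadratic form behind the formal inequality nonnegative. The
  obstacle is the boundary, up to which the Dirichlet energies are not known to be finite. The two
  cut-offs therefore have to be nested: \<open>u2\<close> is cut off at a level \<delta>, its
  superlevel set is compact in \<Omega>, and \<open>u1\<close> is cut off below its minimum on that
  set. For this minimum to be positive, the torsion functions must first be shown to be strictly
  positive inside. The price is an error of 2\<delta> times the volume. The exponent 3 is 2 from
  \<kappa> plus 1 from the volume factor; in the other order \<kappa> is 1. The volume is given by a
  definite description, so a measure with the prescribed chart values must be constructed and shown
  to be unique before anything can be integrated.\<close>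

definition C1_on :: "'a::real_normed_vector set \<Rightarrow> ('a \<Rightarrow> 'b::real_normed_vector) \<Rightarrow> bool" where
  "C1_on S f \<longleftrightarrow> (\<exists>f'. (\<forall>x\<in>S. (f has_derivative f' x) (at x)) \<and> (\<forall>v. continuous_on S (\<lambda>x. f' x v)))"

lemma C1_onI:
  assumes "\<And>x. x \<in> S \<Longrightarrow> (f has_derivative f' x) (at x)" "\<And>v. continuous_on S (\<lambda>x. f' x v)"
  shows "C1_on S f"
  using assms unfolding C1_on_def by blast

lemma C1_onE:
  assumes "C1_on S f"
  obtains f' where "\<And>x. x \<in> S \<Longrightarrow> (f has_derivative f' x) (at x)" "\<And>v. continuous_on S (\<lambda>x. f' x v)"
  using assms unfolding C1_on_def by blast

lemma C1_on_differentiable: "C1_on S f \<Longrightarrow> x \<in> S \<Longrightarrow> f differentiable (at x)"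
  unfolding C1_on_def differentiable_def by blast

lemma C1_on_has_derivative:
  "C1_on S f \<Longrightarrow> x \<in> S \<Longrightarrow> (f has_derivative frechet_derivative f (at x)) (at x)"
  using C1_on_differentiable frechet_derivative_works by blast

lemma C1_on_continuous_on: "C1_on S f \<Longrightarrow> continuous_on S f"
  by (auto intro!: continuous_at_imp_continuous_on differentiable_imp_continuous_within dest: C1_on_differentiable)

lemma C1_on_continuous_frechet:
  assumes "C1_on S f"
  shows "continuous_on S (\<lambda>x. frechet_derivative f (at x) v)"
proof -
  obtain f' where f': "\<And>x. x \<in> S \<Longrightarrow> (f has_derivative f' x) (at x)"
    "\<And>v. continuous_on S (\<lambda>x. f' x v)" using C1_onE[OF assms] by metis
  show ?thesis
    by (rule continuous_on_eq[OF f'(2)]) (simp add: frechet_derivative_at[OF f'(1), symmetric])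
qed

lemma C1_on_partial_deriv:
  "C1_on S f \<Longrightarrow> continuous_on S (partial_deriv i f)"
  unfolding partial_deriv_def[abs_def] by (rule C1_on_continuous_frechet)

lemma C1_on_subset: "C1_on S f \<Longrightarrow> T \<subseteq> S \<Longrightarrow> C1_on T f"
  unfolding C1_on_def by (meson continuous_on_subset subsetD)

text \<open>A derivative at a point of \<open>S\<close> sees a full neighbourhood, so for
  \<open>S\<close> that need not be open the agreement is asked on an open superset.\<close>

lemma C1_on_cong_superset:
  assumes "C1_on S f" "open T" "S \<subseteq> T" "\<And>x. x \<in> T \<Longrightarrow> f x = g x"
  shows "C1_on S g"
proof -
  obtain f' where f': "\<And>x. x \<in> S \<Longrightarrow> (f has_derivative f' x) (at x)"
    "\<And>v. continuous_on S (\<lambda>x. f' x v)" using C1_onE[OF assms(1)] by metis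
  have "(g has_derivative f' x) (at x)" if "x \<in> S" for x
    using has_derivative_transform_within_open[OF f'(1)[OF that] assms(2) _ assms(4)] assms(3) that by blast
  then show ?thesis using f'(2) by (rule C1_onI)
qed

lemma C1_on_cong: "open S \<Longrightarrow> C1_on S f \<Longrightarrow> (\<And>x. x \<in> S \<Longrightarrow> f x = g x) \<Longrightarrow> C1_on S g"
  using C1_on_cong_superset[of S f S g] by blast

lemma C1_on_local:
  assumes "\<And>x. x \<in> S \<Longrightarrow> \<exists>U. open U \<and> x \<in> U \<and> C1_on U f"
  shows "C1_on S f"
proof (rule C1_onI)
  show "(f has_derivative frechet_derivative f (at x)) (at x)" if "x \<in> S" for x
    using assms[OF that] C1_on_has_derivative by blast
  show "continuous_on S (\<lambda>x. frechet_derivative f (at x) v)" for v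
  proof (rule continuous_at_imp_continuous_on, rule ballI)
    fix x assume "x \<in> S"
    then obtain U where U: "open U" "x \<in> U" "C1_on U f" using assms by blast
    show "isCont (\<lambda>x. frechet_derivative f (at x) v) x"
      using C1_on_continuous_frechet[OF U(3)] U continuous_on_eq_continuous_at by blast
  qed
qed

lemma C1_on_Un: "C1_on S f \<Longrightarrow> C1_on T f \<Longrightarrow> open S \<Longrightarrow> open T \<Longrightarrow> C1_on (S \<union> T) f"
  by (rule C1_on_local) auto

lemma C1_on_const [intro, simp]: "C1_on S (\<lambda>x. c)"
  by (rule C1_onI[where f'="\<lambda>x v. 0"]) auto

lemma C1_on_ident [intro, simp]: "C1_on S (\<lambda>x. x)"
  by (rule C1_onI[where f'="\<lambda>x v. v"]) auto

lemma C1_on_bounded_linear: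
  assumes "bounded_linear L" "C1_on S f"
  shows "C1_on S (\<lambda>x. L (f x))"
proof -
  obtain f' where f': "\<And>x. x \<in> S \<Longrightarrow> (f has_derivative f' x) (at x)"
    "\<And>v. continuous_on S (\<lambda>x. f' x v)" using C1_onE[OF assms(2)] by metis
  show ?thesis
    by (rule C1_onI[where f'="\<lambda>x v. L (f' x v)"])
      (auto intro!: bounded_linear.has_derivative[OF assms(1)] bounded_linear.continuous_on[OF assms(1)] f')
qed

lemma C1_on_bilinear:
  assumes "bounded_bilinear B" "C1_on S f" "C1_on S g"
  shows "C1_on S (\<lambda>x. B (f x) (g x))"
proof -
  obtain f' where f': "\<And>x. x \<in> S \<Longrightarrow> (f has_derivative f' x) (at x)"
    "\<And>v. continuous_on S (\<lambda>x. f' x v)" using C1_onE[OF assms(2)] by metis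
  obtain g' where g': "\<And>x. x \<in> S \<Longrightarrow> (g has_derivative g' x) (at x)"
    "\<And>v. continuous_on S (\<lambda>x. g' x v)" using C1_onE[OF assms(3)] by metis
  show ?thesis
    using assms(2,3)[THEN C1_on_continuous_on]
    by (intro C1_onI[where f'="\<lambda>x v. B (f x) (g' x v) + B (f' x v) (g x)"] bounded_bilinear.FDERIV[OF assms(1)]
        f' g' continuous_on_add bounded_bilinear.continuous_on[OF assms(1)])
qed

lemmas C1_on_mult = C1_on_bilinear[OF bounded_bilinear_mult]
lemmas C1_on_inner = C1_on_bilinear[OF bounded_bilinear_inner]

lemma C1_on_add:
  assumes "C1_on S f" "C1_on S g"
  shows "C1_on S (\<lambda>x. f x + g x)"
proof -
  obtain f' where f': "\<And>x. x \<in> S \<Longrightarrow> (f has_derivative f' x) (at x)"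
    "\<And>v. continuous_on S (\<lambda>x. f' x v)" using C1_onE[OF assms(1)] by metis
  obtain g' where g': "\<And>x. x \<in> S \<Longrightarrow> (g has_derivative g' x) (at x)"
    "\<And>v. continuous_on S (\<lambda>x. g' x v)" using C1_onE[OF assms(2)] by metis
  show ?thesis
    by (rule C1_onI[where f'="\<lambda>x v. f' x v + g' x v"]) (auto intro!: derivative_eq_intros f' g' continuous_on_add)
qed

lemma C1_on_uminus: "C1_on S f \<Longrightarrow> C1_on S (\<lambda>x. - f x)"
  by (rule C1_on_bounded_linear[OF bounded_linear_minus[OF bounded_linear_ident]])

lemma C1_on_diff: "C1_on S f \<Longrightarrow> C1_on S g \<Longrightarrow> C1_on S (\<lambda>x. f x - g x)"
  using C1_on_add[OF _ C1_on_uminus] by force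

lemma C1_on_sum: "(\<And>i. i \<in> I \<Longrightarrow> C1_on S (f i)) \<Longrightarrow> C1_on S (\<lambda>x. \<Sum>i\<in>I. f i x)"
  by (induction I rule: infinite_finite_induct) (auto intro: C1_on_add)

lemma C1_on_prod:
  fixes f :: "'i \<Rightarrow> 'a::real_normed_vector \<Rightarrow> real"
  shows "(\<And>i. i \<in> I \<Longrightarrow> C1_on S (f i)) \<Longrightarrow> C1_on S (\<lambda>x. \<Prod>i\<in>I. f i x)"
  by (induction I rule: infinite_finite_induct) (auto intro: C1_on_mult)

lemma C1_on_compose:
  fixes g :: "'a::real_normed_vector \<Rightarrow> 'b::euclidean_space"
  assumes "C1_on T f" "C1_on S g" "g ` S \<subseteq> T"
  shows "C1_on S (\<lambda>x. f (g x))"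
proof -
  obtain f' where f': "\<And>x. x \<in> T \<Longrightarrow> (f has_derivative f' x) (at x)"
    "\<And>v. continuous_on T (\<lambda>x. f' x v)" using C1_onE[OF assms(1)] by metis
  obtain g' where g': "\<And>x. x \<in> S \<Longrightarrow> (g has_derivative g' x) (at x)"
    "\<And>v. continuous_on S (\<lambda>x. g' x v)" using C1_onE[OF assms(2)] by metis
  have lin: "linear (f' (g x))" if "x \<in> S" for x
    using f'(1) that assms(3) by (auto intro: has_derivative_linear)
  \<comment> \<open>\<open>f'\<close> is continuous only for a fixed direction, while
    \<open>g' x v\<close> moves with \<open>x\<close>. Expanding in a basis leaves fixed directions
    with continuous coefficients.\<close>
  have eq: "f' (g x) (g' x v) = (\<Sum>b\<in>Basis. (g' x v \<bullet> b) *\<^sub>R f' (g x) b)" if "x \<in> S" for x v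
  proof -
    have "f' (g x) (g' x v) = f' (g x) (\<Sum>b\<in>Basis. (g' x v \<bullet> b) *\<^sub>R b)"
      by (simp add: euclidean_representation)
    also have "\<dots> = (\<Sum>b\<in>Basis. (g' x v \<bullet> b) *\<^sub>R f' (g x) b)"
      by (simp add: linear_sum[OF lin[OF that]] linear_scale[OF lin[OF that]])
    finally show ?thesis .
  qed
  show ?thesis
  proof (rule C1_onI[where f'="\<lambda>x v. f' (g x) (g' x v)"])
    show "((\<lambda>x. f (g x)) has_derivative (\<lambda>v. f' (g x) (g' x v))) (at x)" if "x \<in> S" for x
      using diff_chain_at[OF g'(1)[OF that] f'(1)] that assms(3) by (auto simp: o_def)
    show "continuous_on S (\<lambda>x. f' (g x) (g' x v))" for v
    proof (rule continuous_on_eq)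
      have "continuous_on S g" by (rule C1_on_continuous_on[OF assms(2)])
      then show "continuous_on S (\<lambda>x. \<Sum>b\<in>Basis. (g' x v \<bullet> b) *\<^sub>R f' (g x) b)"
        by (intro continuous_intros g'(2) continuous_on_compose2[OF f'(2)] assms(3))
    qed (simp add: eq)
  qed
qed

lemma C1_on_real:
  assumes "\<And>x. x \<in> S \<Longrightarrow> (f has_real_derivative f' x) (at x)" "continuous_on S f'"
  shows "C1_on S f"
  by (rule C1_onI[where f'="\<lambda>x v. f' x * v"])
    (use assms in \<open>auto simp: has_field_derivative_def intro!: continuous_intros\<close>)

lemma C1_on_inverse:
  fixes f :: "'a::real_normed_vector \<Rightarrow> real"
  assumes "C1_on S f" "\<And>x. x \<in> S \<Longrightarrow> f x \<noteq> 0"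
  shows "C1_on S (\<lambda>x. inverse (f x))"
proof (rule C1_on_compose[OF _ assms(1)])
  show "C1_on (-{0::real}) inverse"
    by (rule C1_on_real[where f'="\<lambda>x. - (inverse x ^ 2)"])
      (auto intro!: derivative_eq_intros continuous_intros simp: power2_eq_square)
qed (use assms in auto)

lemma C1_on_divide:
  fixes f :: "'a::real_normed_vector \<Rightarrow> real"
  assumes "C1_on S f" "C1_on S g" "\<And>x. x \<in> S \<Longrightarrow> g x \<noteq> 0"
  shows "C1_on S (\<lambda>x. f x / g x)"
  unfolding divide_inverse by (intro C1_on_mult C1_on_inverse assms)

lemma C1_on_sqrt:
  fixes f :: "'a::real_normed_vector \<Rightarrow> real"
  assumes "C1_on S f" "\<And>x. x \<in> S \<Longrightarrow> f x > 0"
  shows "C1_on S (\<lambda>x. sqrt (f x))"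
proof (rule C1_on_compose[OF _ assms(1)])
  show "C1_on {0<..} sqrt"
    by (rule C1_on_real[where f'="\<lambda>x. inverse (sqrt x) / 2"])
      (auto intro!: DERIV_real_sqrt continuous_intros)
qed (use assms in auto)

lemma C1_on_det:
  fixes M :: "'a::real_normed_vector \<Rightarrow> real^'n^'n"
  assumes "\<And>i j. C1_on S (\<lambda>x. M x $ i $ j)"
  shows "C1_on S (\<lambda>x. det (M x))"
  unfolding det_def by (intro C1_on_sum C1_on_mult C1_on_prod C1_on_const assms)

section \<open>Functions of class C^k on open sets\<close>

lemma C_k_on_Suc_open:
  assumes "open S"
  shows "C_k_on (Suc k) S f \<longleftrightarrow> (\<forall>x\<in>S. f differentiable (at x)) \<and>
     (\<forall>v. C_k_on k S (\<lambda>x. frechet_derivative f (at x) v))"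
proof -
  \<comment> \<open>The derivatives within \<open>S\<close> and at \<open>x\<close> coincide only
    for \<open>x\<close> in \<open>S\<close>, so the recursion compares functions that agree on
    \<open>S\<close> alone; \<open>C_k_on\<close> has to be blind to values off
    \<open>S\<close>.\<close>
  have cong: "C_k_on k S f \<longleftrightarrow> C_k_on k S g" if "\<And>x. x \<in> S \<Longrightarrow> f x = g x" for k and f g :: "'a \<Rightarrow> 'b"
    using that
  proof (induction k arbitrary: f g)
    case 0
    then show ?case by (simp cong: continuous_on_cong)
  next
    case (Suc k)
    have d: "(f has_derivative D) (at x within S) \<longleftrightarrow> (g has_derivative D) (at x within S)" if "x \<in> S" for x D
      using Suc.prems that has_derivative_transform[OF that] by metis
    have fr: "frechet_derivative f (at x within S) = frechet_derivative g (at x within S)" if "x \<in> S" for x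
      unfolding frechet_derivative_def d[OF that] ..
    show ?case
      unfolding C_k_on.simps differentiable_def
      using d Suc.IH[of "\<lambda>x. frechet_derivative f (at x within S) v" "\<lambda>x. frechet_derivative g (at x within S) v" for v] fr
      by auto
  qed
  have at: "at x within S = at x" if "x \<in> S" for x using at_within_open[OF that assms] .
  show ?thesis
    unfolding C_k_on.simps
    using at cong[of "\<lambda>x. frechet_derivative f (at x within S) v" "\<lambda>x. frechet_derivative f (at x) v" k for v]
    by auto
qed

lemma C_k_on_Suc_continuous:
  assumes "C_k_on (Suc k) S f" shows "continuous_on S f"
  using assms by (auto intro: differentiable_imp_continuous_on simp: differentiable_on_def)

lemma C_k_on_Suc_imp: "C_k_on (Suc k) S f \<Longrightarrow> C_k_on k S f"
proof (induction k arbitrary: f)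
  case 0
  then show ?case using C_k_on_Suc_continuous by (simp only: C_k_on.simps(1))
next
  case (Suc k)
  then show ?case by (subst C_k_on.simps(2)) (subst (asm) (2) C_k_on.simps(2), blast)
qed

lemma C_k_on_1_iff: "open S \<Longrightarrow> C_k_on (Suc 0) S f \<longleftrightarrow> C1_on S f"
  unfolding C_k_on_Suc_open C_k_on.simps(1)
  by (auto intro: C1_on_continuous_frechet C1_on_differentiable
      intro!: C1_onI[of S f "\<lambda>x. frechet_derivative f (at x)"] simp: frechet_derivative_works[symmetric])

lemma C_k_on_2_C1: "open S \<Longrightarrow> C_k_on 2 S f \<Longrightarrow> C1_on S f"
  using C_k_on_1_iff[of S f] C_k_on_Suc_imp[of "Suc 0" S f] by (simp only: numeral_2_eq_2)

lemma C_k_on_2_partial: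
  assumes "open S" "C_k_on 2 S f" shows "C1_on S (partial_deriv i f)"
proof -
  have "C_k_on (Suc 0) S (\<lambda>x. frechet_derivative f (at x) (axis i 1))"
    using assms(2) C_k_on_Suc_open[OF assms(1), of "Suc 0" f] by (simp only: numeral_2_eq_2)
  then show ?thesis unfolding partial_deriv_def[abs_def] using C_k_on_1_iff[OF assms(1)] by blast
qed

lemma smooth_on_C1: "open S \<Longrightarrow> smooth_on S f \<Longrightarrow> C1_on S f"
  using C_k_on_1_iff unfolding smooth_on_def by blast

lemma smooth_on_partial:
  assumes "open S" "smooth_on S f" shows "smooth_on S (partial_deriv i f)"
  using assms unfolding smooth_on_def partial_deriv_def[abs_def] by (metis C_k_on_Suc_open)

section \<open>Rules for partial derivatives\<close>

lemma partial_deriv_cong: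
  assumes "open S" "x \<in> S" "\<And>y. y \<in> S \<Longrightarrow> f y = g y"
  shows "partial_deriv i f x = partial_deriv i g x"
proof -
  have "(f has_derivative D) (at x) \<longleftrightarrow> (g has_derivative D) (at x)" for D
    using assms has_derivative_transform_within_open[of _ D x UNIV S] by (metis (no_types, lifting))
  then show ?thesis unfolding partial_deriv_def frechet_derivative_def by simp
qed

lemma partial_derivI: "(f has_derivative D) (at x) \<Longrightarrow> partial_deriv i f x = D (axis i 1)"
  unfolding partial_deriv_def using frechet_derivative_at by metis

lemma frechet_partial:
  fixes f :: "real^'n \<Rightarrow> 'b::real_normed_vector"
  assumes "f differentiable (at x)"
  shows "frechet_derivative f (at x) v = (\<Sum>i\<in>UNIV. v $ i *\<^sub>R partial_deriv i f x)"
proof -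
  have l: "linear (frechet_derivative f (at x))"
    by (rule linear_frechet_derivative[OF assms])
  have "frechet_derivative f (at x) v = frechet_derivative f (at x) (\<Sum>i\<in>UNIV. v $ i *\<^sub>R axis i 1)"
    using basis_expansion[of v] by (simp add: scalar_mult_eq_scaleR)
  then show ?thesis
    by (simp add: linear_sum[OF l] linear_scale[OF l] partial_deriv_def)
qed

lemma partial_deriv_mult:
  fixes f g :: "real^'n \<Rightarrow> real"
  assumes "f differentiable (at x)" "g differentiable (at x)"
  shows "partial_deriv i (\<lambda>y. f y * g y) x = f x * partial_deriv i g x + partial_deriv i f x * g x"
  by (rule partial_derivI[THEN trans, OF has_derivative_mult[OF assms[unfolded frechet_derivative_works]]])
    (simp add: partial_deriv_def)

lemma partial_deriv_sum:
  assumes "\<And>j. j \<in> J \<Longrightarrow> f j differentiable (at x)"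
  shows "partial_deriv i (\<lambda>y. \<Sum>j\<in>J. f j y) x = (\<Sum>j\<in>J. partial_deriv i (f j) x)"
proof -
  have "((\<lambda>y. \<Sum>j\<in>J. f j y) has_derivative (\<lambda>v. \<Sum>j\<in>J. frechet_derivative (f j) (at x) v)) (at x)"
    using assms frechet_derivative_works by (intro has_derivative_sum) blast
  from partial_derivI[OF this] show ?thesis by (simp add: partial_deriv_def)
qed

lemma partial_deriv_compose_real:
  fixes f :: "real^'n \<Rightarrow> real" and h :: "real \<Rightarrow> real"
  assumes "f differentiable (at x)" "(h has_real_derivative d) (at (f x))"
  shows "partial_deriv i (\<lambda>y. h (f y)) x = d * partial_deriv i f x"
proof -
  have "((\<lambda>y. h (f y)) has_derivative (\<lambda>v. d * frechet_derivative f (at x) v)) (at x)"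
    using diff_chain_at[OF assms(1)[unfolded frechet_derivative_works] assms(2)[unfolded has_field_derivative_def]]
    by (simp add: o_def)
  from partial_derivI[OF this] show ?thesis by (simp add: partial_deriv_def)
qed

section \<open>Cut-off functions\<close>

text \<open>A quadratic branch glued to zero is C^1; both the cut-off and the bump functions are
  built from it.\<close>

definition pos_sq :: "real \<Rightarrow> real" where "pos_sq s = (max 0 s)\<^sup>2"

lemma pos_sq_deriv: "(pos_sq has_real_derivative 2 * max 0 s) (at s)"
proof -
  consider "s > 0" | "s < 0" | "s = 0" by linarith
  then show ?thesis
  proof cases
    case 1
    have "((\<lambda>s. s\<^sup>2) has_real_derivative 2 * s) (at s)" by (auto intro!: derivative_eq_intros)
    from has_field_derivative_transform_within_open[OF this open_greaterThan[of 0]] 1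
    show ?thesis by (auto simp: pos_sq_def)
  next
    case 2
    have "((\<lambda>s. 0) has_real_derivative 0) (at s)" by (auto intro!: derivative_eq_intros)
    from has_field_derivative_transform_within_open[OF this open_lessThan[of 0]] 2
    show ?thesis by (auto simp: pos_sq_def)
  next
    case 3
    have "((\<lambda>h. max 0 h) \<longlongrightarrow> max 0 0) (at (0::real))" by (intro tendsto_intros)
    moreover have "\<forall>\<^sub>F h in at (0::real). max 0 h = (pos_sq (0 + h) - pos_sq 0) / h"
      by (auto simp: eventually_at_filter pos_sq_def max_def power2_eq_square)
    ultimately have "((\<lambda>h. (pos_sq (0 + h) - pos_sq 0) / h) \<longlongrightarrow> 0) (at 0)"
      using Lim_transform_eventually by fastforce
    with 3 show ?thesis by (simp add: DERIV_def)
  qed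
qed

lemma pos_sq_C1: "C1_on UNIV pos_sq"
  by (rule C1_on_real[OF pos_sq_deriv]) (auto intro!: continuous_intros)

text \<open>A \<open>C\<^sup>1\<close> approximation of the identity on \<open>[0,\<infinity>)\<close> that vanishes near \<open>0\<close>: its derivative
  increases linearly from \<open>0\<close> to \<open>1\<close> on \<open>[e, 2e]\<close>.\<close>

definition cutoff :: "real \<Rightarrow> real \<Rightarrow> real" where
  "cutoff e s = (pos_sq (s - e) - pos_sq (s - 2 * e)) / (2 * e)"

definition cutoff_deriv :: "real \<Rightarrow> real \<Rightarrow> real" where
  "cutoff_deriv e s = (max 0 (s - e) - max 0 (s - 2 * e)) / e"

lemma cutoff_has_derivative: "e > 0 \<Longrightarrow> (cutoff e has_real_derivative cutoff_deriv e s) (at s)"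
proof -
  assume "e > 0"
  have 1: "((\<lambda>s. pos_sq (s - a)) has_real_derivative 2 * max 0 (s - a)) (at s)" for a
    using DERIV_chain2[where g="\<lambda>s. s - a" and f=pos_sq and x=s and s=UNIV and Db=1, OF pos_sq_deriv] DERIV_diff[OF DERIV_ident DERIV_const]
    by fastforce
  show ?thesis unfolding cutoff_def[abs_def]
    by (rule DERIV_cong[OF DERIV_cdivide[OF DERIV_diff[OF 1 1]]])
      (use \<open>e > 0\<close> in \<open>simp add: cutoff_deriv_def field_simps\<close>)
qed

lemma cutoff_C1: "e > 0 \<Longrightarrow> C1_on UNIV (cutoff e)"
  by (rule C1_on_real[OF cutoff_has_derivative]) (auto intro!: continuous_intros simp: cutoff_deriv_def)

lemma cutoff_zero: "e > 0 \<Longrightarrow> s \<le> e \<Longrightarrow> cutoff e s = 0"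
  by (simp add: cutoff_def pos_sq_def)

lemma cutoff_deriv_zero: "e > 0 \<Longrightarrow> s \<le> e \<Longrightarrow> cutoff_deriv e s = 0"
  by (simp add: cutoff_deriv_def)

lemma cutoff_deriv_one: "e > 0 \<Longrightarrow> 2 * e \<le> s \<Longrightarrow> cutoff_deriv e s = 1"
  by (simp add: cutoff_deriv_def max_def)

lemma cutoff_deriv_bounds: "e > 0 \<Longrightarrow> 0 \<le> cutoff_deriv e s \<and> cutoff_deriv e s \<le> 1"
  by (simp add: cutoff_deriv_def max_def)

text \<open>The loss is at most \<open>2 * e\<close> uniformly in \<open>s\<close>, so that
  integrals over a set of finite volume change by at most \<open>2 * e\<close> times that volume. In
  the middle range the upper bound comes from (s - e)^2 \<le> e^2 \<le> 2 s e.\<close>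

lemma cutoff_bounds:
  assumes "e > 0" "s \<ge> 0" shows "s - 2 * e \<le> cutoff e s" "cutoff e s \<le> s" "0 \<le> cutoff e s"
proof -
  consider "s \<le> e" | "e \<le> s" "s \<le> 2 * e" | "2 * e \<le> s" by linarith
  then have "s - 2 * e \<le> cutoff e s \<and> cutoff e s \<le> s \<and> 0 \<le> cutoff e s"
  proof cases
    case 1
    then show ?thesis using assms by (simp add: cutoff_zero)
  next
    case 2
    then have cutoff: "cutoff e s = (s - e)\<^sup>2 / (2 * e)" by (simp add: cutoff_def pos_sq_def)
    have "(s - e)\<^sup>2 \<le> e * e"
      unfolding power2_eq_square using 2 by (intro mult_mono) auto
    moreover have "e * e \<le> s * (2 * e)"
      using 2 assms by (intro mult_mono) auto
    ultimately have "(s - e)\<^sup>2 \<le> s * (2 * e)" by linarith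
    then have "(s - e)\<^sup>2 / (2 * e) \<le> s" "0 \<le> (s - e)\<^sup>2 / (2 * e)"
      using assms(1) by (simp_all add: pos_divide_le_eq)
    with cutoff have "cutoff e s \<le> s" "0 \<le> cutoff e s"
      by auto
    then show ?thesis using 2 by simp
  next
    case 3
    then have "cutoff e s = s - 3 / 2 * e"
      using assms by (simp add: cutoff_def pos_sq_def power2_eq_square field_simps)
    then show ?thesis using 3 assms by simp
  qed
  then show "s - 2 * e \<le> cutoff e s" "cutoff e s \<le> s" "0 \<le> cutoff e s" by auto
qed

section \<open>Integration of partial derivatives\<close>

lemma integrable_continuous_supp:
  fixes f :: "'a::euclidean_space \<Rightarrow> real"
  assumes "continuous_on UNIV f" "compact K" "\<And>x. x \<notin> K \<Longrightarrow> f x = 0"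
  shows "integrable lborel f"
proof -
  have "indicator K x *\<^sub>R f x = f x" for x using assms(3) by (auto simp: indicator_def)
  with borel_integrable_compact[OF assms(2) continuous_on_subset[OF assms(1) subset_UNIV]] show ?thesis
    by (simp only:)
qed

lemma integral_translate:
  fixes f :: "'a::euclidean_space \<Rightarrow> real"
  assumes "f \<in> borel_measurable borel"
  shows "(\<integral>x. f (v + x) \<partial>lborel) = (\<integral>x. f x \<partial>lborel)"
  by (subst (2) lborel_distr_plus[symmetric, of v], subst integral_distr) (use assms in auto)

text \<open>Difference quotients of a compactly supported function integrate to \<open>0\<close> by translation
  invariance; dominated convergence passes to the derivative.\<close>

lemma integral_derivative_zero:
  fixes F :: "'a::euclidean_space \<Rightarrow> real"
  assumes F: "C1_on UNIV F" and K: "compact K" "\<And>x. x \<notin> K \<Longrightarrow> F x = 0"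
  shows "integrable lborel (\<lambda>x. frechet_derivative F (at x) v)"
    and "(\<integral>x. frechet_derivative F (at x) v \<partial>lborel) = 0"
proof -
  let ?D = "\<lambda>x. frechet_derivative F (at x) v"
  have cF: "continuous_on UNIV F" by (rule C1_on_continuous_on[OF F])
  have cD: "continuous_on UNIV ?D" by (rule C1_on_continuous_frechet[OF F])
  have D0: "?D x = 0" if "x \<notin> K" for x
  proof -
    have "(F has_derivative (\<lambda>_. 0)) (at x)"
      by (rule has_derivative_transform_within_open[of "\<lambda>_. 0" _ x UNIV "-K"])
        (use K that in \<open>auto simp: compact_imp_closed\<close>)
    then show ?thesis using frechet_derivative_at by metis
  qed
  show int: "integrable lborel ?D" by (rule integrable_continuous_supp[OF cD K(1) D0])
  have iF: "integrable lborel F" by (rule integrable_continuous_supp[OF cF K])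
  have mF: "F \<in> borel_measurable borel" using cF by (rule borel_measurable_continuous_onI)
  obtain C where C: "\<And>x. \<bar>?D x\<bar> \<le> C" "C \<ge> 0"
  proof -
    have "bounded (?D ` K)" using compact_continuous_image[OF continuous_on_subset[OF cD] K(1)] compact_imp_bounded by auto
    then obtain C where "C > 0" "\<And>x. x \<in> K \<Longrightarrow> \<bar>?D x\<bar> \<le> C" unfolding bounded_pos by auto
    then show ?thesis using that[of C] D0 by (metis abs_zero less_eq_real_def)
  qed
  obtain R where R: "K \<subseteq> ball 0 R" "R > 0" using K(1) bounded_subset_ballD compact_imp_bounded by blast
  define q where "q n x = real (Suc n) * (F ((1 / real (Suc n)) *\<^sub>R v + x) - F x)" for n x
  \<comment> \<open>The shifts have length at most \<open>norm v\<close>, so all quotients vanish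
    outside one ball that does not depend on \<open>n\<close>.\<close>
  define B where "B = cball (0::'a) (R + norm v)"
  have q0: "q n x = 0" if "x \<notin> B" for n x
  proof -
    have "norm x > R + norm v" using that by (auto simp: B_def)
    moreover have "norm ((1 / real (Suc n)) *\<^sub>R v) \<le> norm v"
      by (simp add: divide_simps mult_le_cancel_left1)
    moreover have "norm ((1 / real (Suc n)) *\<^sub>R v + x) \<ge> norm x - norm ((1 / real (Suc n)) *\<^sub>R v)"
      by (metis add.commute norm_diff_ineq)
    ultimately have "norm ((1 / real (Suc n)) *\<^sub>R v + x) > R" "norm x > R" by (linarith, smt (verit) norm_ge_zero)
    then have "(1 / real (Suc n)) *\<^sub>R v + x \<notin> K" "x \<notin> K" using R(1) by auto
    then show ?thesis using K(2) by (simp add: q_def)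
  qed
  \<comment> \<open>By the mean value theorem each quotient is a value of the directional
    derivative, hence bounded by the same \<open>C\<close>; together with \<open>B\<close> this
    gives the integrable majorant.\<close>
  have qC: "\<bar>q n x\<bar> \<le> C" for n x
  proof -
    define h where "h = 1 / real (Suc n)"
    have h: "h > 0" by (simp add: h_def)
    define p where "p s = F (s *\<^sub>R v + x)" for s
    have "(p has_real_derivative frechet_derivative F (at (s *\<^sub>R v + x)) v) (at s)" for s
    proof -
      let ?L = "frechet_derivative F (at (s *\<^sub>R v + x))"
      have "(F has_derivative ?L) (at (s *\<^sub>R v + x))" using C1_on_has_derivative[OF F] by blast
      moreover have "((\<lambda>s. s *\<^sub>R v + x) has_derivative (\<lambda>r. r *\<^sub>R v)) (at s)"
        by (auto intro!: derivative_eq_intros)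
      ultimately have "(p has_derivative (\<lambda>r. ?L (r *\<^sub>R v))) (at s)"
        unfolding p_def using diff_chain_at[of "\<lambda>s. s *\<^sub>R v + x" "\<lambda>r. r *\<^sub>R v" s F ?L] by (simp add: o_def)
      moreover have "linear ?L" using C1_on_differentiable[OF F] linear_frechet_derivative by blast
      ultimately show ?thesis unfolding has_field_derivative_def
        by (simp add: linear_scale mult_commute_abs)
    qed
    from MVT2[OF h this] obtain z where "p h - p 0 = h * frechet_derivative F (at (z *\<^sub>R v + x)) v" by auto
    then have "q n x = frechet_derivative F (at (z *\<^sub>R v + x)) v"
      by (simp add: q_def p_def h_def field_simps)
    then show ?thesis using C(1) by simp
  qed
  have lim: "(\<lambda>n. q n x) \<longlonglongrightarrow> ?D x" for x
  proof -
    let ?L = "frechet_derivative F (at x)"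
    have "(F has_derivative ?L) (at (0 *\<^sub>R v + x))" using C1_on_has_derivative[OF F] by simp
    moreover have "((\<lambda>s. s *\<^sub>R v + x) has_derivative (\<lambda>r. r *\<^sub>R v)) (at 0)"
      by (auto intro!: derivative_eq_intros)
    ultimately have "((\<lambda>s. F (s *\<^sub>R v + x)) has_derivative (\<lambda>r. ?L (r *\<^sub>R v))) (at 0)"
      using diff_chain_at[of "\<lambda>s. s *\<^sub>R v + x" "\<lambda>r. r *\<^sub>R v" 0 F ?L] by (simp add: o_def)
    moreover have "linear ?L" using C1_on_differentiable[OF F] linear_frechet_derivative by blast
    ultimately have "((\<lambda>s. F (s *\<^sub>R v + x)) has_real_derivative ?D x) (at 0)"
      unfolding has_field_derivative_def
      by (simp add: linear_scale mult_commute_abs)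
    then have *: "((\<lambda>h. (F (h *\<^sub>R v + x) - F x) / h) \<longlongrightarrow> ?D x) (at 0)"
      by (simp add: DERIV_def)
    have "(\<lambda>n. 1 / real (Suc n)) \<longlonglongrightarrow> 0" using LIMSEQ_Suc[OF lim_1_over_n] .
    then have "filterlim (\<lambda>n. 1 / real (Suc n)) (at 0) sequentially"
      by (auto simp: filterlim_at)
    from filterlim_compose[OF * this] show ?thesis
      by (simp add: q_def mult.commute)
  qed
  have mq: "q n \<in> borel_measurable lborel" for n
    unfolding q_def using mF by measurable
  have "(\<lambda>n. \<integral>x. q n x \<partial>lborel) \<longlonglongrightarrow> (\<integral>x. ?D x \<partial>lborel)"
  proof (rule integral_dominated_convergence[where w="\<lambda>x. C * indicator B x"])
    show "integrable lborel (\<lambda>x. C * indicator B x)"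
      unfolding B_def by (intro integrable_mult_right integrable_real_indicator emeasure_lborel_cball_finite) auto
    show "AE x in lborel. norm (q n x) \<le> C * indicator B x" for n
      using q0 qC by (auto simp: indicator_def)
    show "?D \<in> borel_measurable lborel" using int by blast
  qed (use lim mq in auto)
  moreover have "(\<integral>x. q n x \<partial>lborel) = 0" for n
  proof -
    have i: "integrable lborel (\<lambda>x. F ((1 / real (Suc n)) *\<^sub>R v + x))"
    proof -
      have "integrable (distr lborel borel ((+) ((1 / real (Suc n)) *\<^sub>R v))) F"
        using iF by (simp only: lborel_distr_plus)
      then show ?thesis by (subst (asm) integrable_distr_eq) (use mF in auto)
    qed
    show ?thesis
      unfolding q_def integral_mult_right_zero Bochner_Integration.integral_diff[OF i iF] integral_translate[OF mF]
      by simp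
  qed
  ultimately show "(\<integral>x. ?D x \<partial>lborel) = 0" by (simp add: LIMSEQ_const_iff)
qed

section \<open>Change of variables\<close>

text \<open>The library's change of variables formula requires a well-ordered index type. Every finite
  type is isomorphic to one, along which the formula is transported.\<close>

typedef 'n ordered_copy = "UNIV :: 'n set" ..

instance ordered_copy :: (finite) finite
proof
  have "(UNIV :: 'a ordered_copy set) = range Abs_ordered_copy"
    by (metis Rep_ordered_copy_inverse surjI)
  then show "finite (UNIV :: 'a ordered_copy set)" by (metis finite finite_imageI)
qed

instantiation ordered_copy :: (finite) wellorder
begin

text \<open>Any injection will do: the order only has to make the type an instance of the
  class.\<close>

definition index_copy :: "'a ordered_copy \<Rightarrow> nat" where
  "index_copy = (SOME f. inj f)"

definition "(i :: 'a ordered_copy) \<le> j \<longleftrightarrow> index_copy i \<le> index_copy j"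
definition "(i :: 'a ordered_copy) < j \<longleftrightarrow> index_copy i < index_copy j"

lemma inj_index_copy: "inj (index_copy :: 'a ordered_copy \<Rightarrow> nat)"
proof -
  have "\<exists>f :: 'a ordered_copy \<Rightarrow> nat. inj f"
    using finite_imp_inj_to_nat_seg[of "UNIV :: 'a ordered_copy set"] by auto
  then show ?thesis unfolding index_copy_def by (rule someI_ex)
qed

instance
proof
  fix x y z :: "'a ordered_copy" and P
  show "x < y \<longleftrightarrow> x \<le> y \<and> \<not> y \<le> x" "x \<le> x" "x \<le> y \<Longrightarrow> y \<le> z \<Longrightarrow> x \<le> z" "x \<le> y \<or> y \<le> x"
    by (auto simp: less_eq_ordered_copy_def less_ordered_copy_def)
  show "x \<le> y \<Longrightarrow> y \<le> x \<Longrightarrow> x = y"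
    using inj_index_copy by (auto simp: less_eq_ordered_copy_def inj_def)
  show "P x" if *: "\<And>x. (\<And>y. y < x \<Longrightarrow> P y) \<Longrightarrow> P x"
  proof (induction "index_copy x" arbitrary: x rule: less_induct)
    case less
    show ?case by (rule *, rule less) (simp add: less_ordered_copy_def)
  qed
qed

end

text \<open>Conjugation by \<open>h\<close> is a sign-preserving bijection between the permutations
  of the two index types, so the Leibniz sums agree term by term.\<close>

lemma det_reindex:
  fixes A :: "'a::comm_ring_1^'n^'n" and h :: "'m::finite \<Rightarrow> 'n"
  assumes "bij h"
  shows "det (\<chi> i j. A $ h i $ h j) = det A"
proof -
  have inj: "inj_on h UNIV" using assms bij_def by blast
  let ?M = "map_permutation UNIV h"
  have bij: "bij_betw ?M {p. p permutes UNIV} {p. p permutes UNIV}"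
  proof (rule bij_betwI[where g="map_permutation UNIV (inv h)"])
    show "?M \<in> {p. p permutes UNIV} \<rightarrow> {p. p permutes UNIV}"
      using map_permutation_permutes[OF assms] by blast
    show "map_permutation UNIV (inv h) \<in> {p. p permutes UNIV} \<rightarrow> {p. p permutes UNIV}"
      using map_permutation_permutes[OF bij_imp_bij_inv[OF assms]] by blast
  qed (use assms in \<open>auto simp: map_permutation_def fun_eq_iff restrict_id_def bij_is_surj bij_is_inj surj_f_inv_f
        bij_imp_bij_inv inv_inv_eq\<close>)
  have "det A = (\<Sum>p\<in>{p. p permutes UNIV}. of_int (sign (?M p)) * (\<Prod>i\<in>UNIV. A $ i $ ?M p i))"
    unfolding det_def by (rule sum.reindex_bij_betw[OF bij, symmetric])
  also have "\<dots> = (\<Sum>p\<in>{p. p permutes UNIV}. of_int (sign p) * (\<Prod>i\<in>UNIV. A $ h i $ h (p i)))"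
  proof (rule sum.cong[OF refl])
    fix p :: "'m \<Rightarrow> 'm" assume p: "p \<in> {p. p permutes UNIV}"
    have "(\<Prod>i\<in>UNIV. A $ i $ ?M p i) = (\<Prod>i\<in>UNIV. A $ h i $ ?M p (h i))"
      by (rule prod.reindex_bij_betw[OF assms, symmetric])
    then show "of_int (sign (?M p)) * (\<Prod>i\<in>UNIV. A $ i $ ?M p i) = of_int (sign p) * (\<Prod>i\<in>UNIV. A $ h i $ h (p i))"
      using p by (simp add: sign_map_permutation[OF inj] map_permutation_apply[OF inj])
  qed
  finally show ?thesis by (simp add: det_def)
qed

definition from_copy :: "real^('n::finite ordered_copy) \<Rightarrow> real^'n" where
  "from_copy v = (\<chi> i. v $ Abs_ordered_copy i)"

definition to_copy :: "real^'n \<Rightarrow> real^('n::finite ordered_copy)" where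
  "to_copy v = (\<chi> i. v $ Rep_ordered_copy i)"

lemma from_to_copy [simp]: "from_copy (to_copy v) = v" "to_copy (from_copy w) = w"
  by (simp_all add: from_copy_def to_copy_def vec_eq_iff Abs_ordered_copy_inverse Rep_ordered_copy_inverse)

lemma bij_Rep_ordered_copy: "bij (Rep_ordered_copy :: 'n ordered_copy \<Rightarrow> 'n)"
  by (metis Abs_ordered_copy_inverse Rep_ordered_copy_inverse UNIV_I bijI')

lemma linear_copy: "linear from_copy" "linear to_copy"
  by (auto intro!: linearI simp: from_copy_def to_copy_def vec_eq_iff)

lemma borel_measurable_copy [measurable]: "from_copy \<in> borel_measurable borel" "to_copy \<in> borel_measurable borel"
  by (intro borel_measurable_continuous_onI linear_continuous_on linear_conv_bounded_linear[THEN iffD1] linear_copy)+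

lemma prod_inner_Basis_cart:
  fixes v :: "real^'n"
  shows "(\<Prod>b\<in>Basis. v \<bullet> b) = (\<Prod>j\<in>UNIV. v $ j)"
proof -
  have "bij_betw (\<lambda>j. axis j 1) UNIV (Basis :: (real^'n) set)"
    by (auto simp: bij_betw_def Basis_vec_def inj_on_def axis_eq_axis)
  from prod.reindex_bij_betw[OF this, of "\<lambda>b. v \<bullet> b"] show ?thesis by (simp add: inner_axis)
qed

text \<open>Lebesgue measure is determined by its values on boxes. Relabelling coordinates turns a
  box into a box with the same side lengths, and their product is merely reindexed.\<close>

lemma distr_from_copy: "distr lborel borel (from_copy :: _ \<Rightarrow> real^'n::finite) = lborel"
proof (rule lborel_eqI[symmetric])
  fix l u :: "real^'n"
  assume le: "\<And>b. b \<in> Basis \<Longrightarrow> l \<bullet> b \<le> u \<bullet> b"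
  then have le': "l $ i \<le> u $ i" for i
    using le[of "axis i 1"] by (simp add: inner_axis axis_in_Basis_iff)
  have vim: "from_copy -` box l u = box (to_copy l) (to_copy u)"
  proof -
    have "(\<forall>i. l $ i < v $ Abs_ordered_copy i \<and> v $ Abs_ordered_copy i < u $ i) \<longleftrightarrow>
      (\<forall>j. l $ Rep_ordered_copy j < v $ j \<and> v $ j < u $ Rep_ordered_copy j)" for v
      by (metis Abs_ordered_copy_inverse Rep_ordered_copy_inverse UNIV_I)
    then show ?thesis by (auto simp: mem_box_cart from_copy_def to_copy_def)
  qed
  have "emeasure (distr lborel borel from_copy) (box l u) = emeasure lborel (box (to_copy l) (to_copy u))"
    by (subst emeasure_distr) (auto simp: vim)
  also have "\<dots> = (\<Prod>b\<in>Basis. (to_copy u - to_copy l) \<bullet> b)"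
    by (rule emeasure_lborel_box) (auto simp: Basis_vec_def inner_axis to_copy_def le')
  also have "\<dots> = (\<Prod>j\<in>UNIV. (to_copy u - to_copy l) $ j)" by (simp only: prod_inner_Basis_cart)
  also have "\<dots> = (\<Prod>j\<in>UNIV. (u - l) $ Rep_ordered_copy j)" by (simp add: to_copy_def)
  also have "\<dots> = (\<Prod>i\<in>UNIV. (u - l) $ i)" by (subst prod.reindex_bij_betw[OF bij_Rep_ordered_copy]) (rule refl)
  also have "\<dots> = (\<Prod>b\<in>Basis. (u - l) \<bullet> b)" by (simp only: prod_inner_Basis_cart)
  finally show "emeasure (distr lborel borel from_copy) (box l u) = (\<Prod>b\<in>Basis. (u - l) \<bullet> b)" .
qed simp

text \<open>\<open>has_absolute_integral_change_of_variables\<close> speaks of absolutely integrable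
  vector-valued functions, so \<open>f\<close> is wrapped into \<open>real^1\<close>. It says that
  one side is integrable exactly if the other is, with the same value; for nonnegative integrands
  failure means the value infinity, on both sides at once.\<close>

lemma nn_integral_change_of_variables_wellorder:
  fixes g :: "real^'m::{finite,wellorder} \<Rightarrow> real^'m::_" and f :: "real^'m::_ \<Rightarrow> real"
  assumes S: "S \<in> sets borel" and gS: "g ` S \<in> sets borel"
    and der: "\<And>x. x \<in> S \<Longrightarrow> (g has_derivative g' x) (at x within S)" and inj: "inj_on g S"
    and nn: "\<And>y. y \<in> g ` S \<Longrightarrow> f y \<ge> 0"
    and m1: "(\<lambda>x. indicator S x * (\<bar>det (matrix (g' x))\<bar> * f (g x))) \<in> borel_measurable borel"
    and m2: "(\<lambda>y. indicator (g ` S) y * f y) \<in> borel_measurable borel"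
  shows "(\<integral>\<^sup>+x. ennreal (indicator S x * (\<bar>det (matrix (g' x))\<bar> * f (g x))) \<partial>lborel) =
    (\<integral>\<^sup>+y. ennreal (indicator (g ` S) y * f y) \<partial>lborel)"
proof -
  let ?h1 = "\<lambda>x. indicator S x * (\<bar>det (matrix (g' x))\<bar> * f (g x))"
  let ?h2 = "\<lambda>y. indicator (g ` S) y * f y"
  have n1: "?h1 x \<ge> 0" for x using nn by (auto simp: indicator_def)
  have n2: "?h2 x \<ge> 0" for x using nn by (auto simp: indicator_def)
  have ab: "(set_integrable lebesgue T k \<longleftrightarrow> integrable lborel (\<lambda>x. indicator T x * k x)) \<and>
    set_lebesgue_integral lebesgue T k = (\<integral>x. indicator T x * k x \<partial>lborel)"
    if "(\<lambda>x. indicator T x * k x) \<in> borel_measurable borel" for T and k :: "real^'m::_ \<Rightarrow> real"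
    using that by (simp add: set_integrable_def set_lebesgue_integral_def integrable_completion integral_completion)
  have SL: "S \<in> sets lebesgue" using S by simp
  have "((\<lambda>x. \<bar>det (matrix (g' x))\<bar> * f (g x)) absolutely_integrable_on S \<and>
      integral S (\<lambda>x. \<bar>det (matrix (g' x))\<bar> * f (g x)) = b) \<longleftrightarrow>
    (f absolutely_integrable_on (g ` S) \<and> integral (g ` S) f = b)" for b
    using has_absolute_integral_change_of_variables[OF SL der inj, of "\<lambda>y. vec (f y) :: real^1" "vec b"]
    by (simp add: absolutely_integrable_on_1_iff integral_on_1_eq)
  then have eq: "((\<lambda>x. \<bar>det (matrix (g' x))\<bar> * f (g x)) absolutely_integrable_on S) =
      (f absolutely_integrable_on (g ` S))"
    "f absolutely_integrable_on (g ` S) \<Longrightarrow>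
      integral S (\<lambda>x. \<bar>det (matrix (g' x))\<bar> * f (g x)) = integral (g ` S) f" by metis+
  have key: "(integrable lborel ?h1 \<and> (\<integral>x. ?h1 x \<partial>lborel) = b) \<longleftrightarrow>
      (integrable lborel ?h2 \<and> (\<integral>x. ?h2 x \<partial>lborel) = b)" for b
    using eq ab[OF m1] ab[OF m2] set_lebesgue_integral_eq_integral(2)[of S "\<lambda>x. \<bar>det (matrix (g' x))\<bar> * f (g x)"]
      set_lebesgue_integral_eq_integral(2)[of "g ` S" f] by auto
  have iff: "integrable lborel h \<longleftrightarrow> (\<integral>\<^sup>+x. ennreal (h x) \<partial>lborel) < \<infinity>"
    if "h \<in> borel_measurable borel" "\<And>x. h x \<ge> 0" for h :: "real^'m::_ \<Rightarrow> real"
    using that by (auto simp: integrable_iff_bounded)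
  show ?thesis
  proof (cases "integrable lborel ?h1")
    case True
    then have "integrable lborel ?h2" "(\<integral>x. ?h1 x \<partial>lborel) = (\<integral>x. ?h2 x \<partial>lborel)" using key by auto
    then show ?thesis using True n1 n2 by (simp add: nn_integral_eq_integral)
  next
    case False
    then have "\<not> integrable lborel ?h2" using key by auto
    then show ?thesis using False iff[OF m1 n1] iff[OF m2 n2] by (simp add: less_top[symmetric])
  qed
qed

text \<open>Conjugating \<open>g\<close> by the relabelling \<open>to_copy\<close> changes neither
  the Jacobian determinant (\<open>det_reindex\<close>) nor Lebesgue measure
  (\<open>distr_from_copy\<close>).\<close>

lemma nn_integral_change_of_variables:
  fixes g :: "real^'n \<Rightarrow> real^'n" and f :: "real^'n \<Rightarrow> real"
  assumes S: "S \<in> sets borel" and gS: "g ` S \<in> sets borel"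
    and der: "\<And>x. x \<in> S \<Longrightarrow> (g has_derivative g' x) (at x within S)" and inj: "inj_on g S"
    and nn: "\<And>y. y \<in> g ` S \<Longrightarrow> f y \<ge> 0"
    and m1: "(\<lambda>x. indicator S x * (\<bar>det (matrix (g' x))\<bar> * f (g x))) \<in> borel_measurable borel"
    and m2: "(\<lambda>y. indicator (g ` S) y * f y) \<in> borel_measurable borel"
  shows "(\<integral>\<^sup>+x. ennreal (indicator S x * (\<bar>det (matrix (g' x))\<bar> * f (g x))) \<partial>lborel) =
    (\<integral>\<^sup>+y. ennreal (indicator (g ` S) y * f y) \<partial>lborel)"
proof -
  define S' where "S' = to_copy ` S"
  define k where "k = to_copy \<circ> g \<circ> from_copy"
  define k' where "k' = (\<lambda>x. to_copy \<circ> g' (from_copy x) \<circ> from_copy)"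
  have mem: "x \<in> to_copy ` T \<longleftrightarrow> from_copy x \<in> T" for x and T :: "(real^'n) set"
    by (metis from_to_copy image_iff)
  have S'v: "to_copy ` T = from_copy -` T" for T :: "(real^'n) set" using mem by auto
  have meas: "to_copy ` T \<in> sets borel" if "T \<in> sets borel" for T :: "(real^'n) set"
    using measurable_sets_borel[OF borel_measurable_copy(1) that] by (simp add: S'v)
  have kS: "k ` S' = to_copy ` g ` S" by (simp add: k_def S'_def image_image)
  have det: "det (matrix (k' x)) = det (matrix (g' (from_copy x)))" for x
  proof -
    have "from_copy (axis j 1) = axis (Rep_ordered_copy j) 1" for j :: "'n ordered_copy"
      by (auto simp: from_copy_def axis_def vec_eq_iff Abs_ordered_copy_inverse Rep_ordered_copy_inverse)
    then have "matrix (k' x) = (\<chi> i j. matrix (g' (from_copy x)) $ Rep_ordered_copy i $ Rep_ordered_copy j)"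
      by (simp add: matrix_def k'_def to_copy_def)
    then show ?thesis using det_reindex[OF bij_Rep_ordered_copy] by metis
  qed
  have bl: "bounded_linear (to_copy :: real^'n \<Rightarrow> _)" "bounded_linear (from_copy :: _ \<Rightarrow> real^'n)"
    using linear_copy linear_conv_bounded_linear by blast+
  have d: "(k has_derivative k' x) (at x within S')" if "x \<in> S'" for x
  proof -
    have *: "from_copy ` S' = S" by (simp add: S'_def image_image)
    have "(g has_derivative g' (from_copy x)) (at (from_copy x) within from_copy ` S')"
      unfolding * using that by (intro der) (auto simp: S'_def)
    from diff_chain_within[OF bounded_linear_imp_has_derivative[OF bl(2)] this]
    have "(g \<circ> from_copy has_derivative g' (from_copy x) \<circ> from_copy) (at x within S')" .
    from bounded_linear.has_derivative[OF bl(1) this] show ?thesis by (simp add: k_def k'_def o_def)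
  qed
  have injk: "inj_on k S'"
    using inj unfolding inj_on_def k_def S'_def by (auto) (metis from_to_copy(1))
  have fk: "f (from_copy (k x)) = f (g (from_copy x))" for x by (simp add: k_def)
  have e1: "indicator S' x = indicator S (from_copy x)" for x by (simp add: S'_def S'v indicator_def)
  have e2: "indicator (k ` S') x = indicator (g ` S) (from_copy x)" for x unfolding kS by (simp add: S'v indicator_def)
  have "(\<integral>\<^sup>+x. ennreal (indicator S' x * (\<bar>det (matrix (k' x))\<bar> * f (from_copy (k x)))) \<partial>lborel) =
    (\<integral>\<^sup>+y. ennreal (indicator (k ` S') y * f (from_copy y)) \<partial>lborel)"
  proof (rule nn_integral_change_of_variables_wellorder[OF _ _ d injk])
    show "S' \<in> sets borel" "k ` S' \<in> sets borel" unfolding kS using meas S gS by (auto simp: S'_def)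
    show "f (from_copy y) \<ge> 0" if "y \<in> k ` S'" for y using that nn unfolding kS by auto
    show "(\<lambda>x. indicator S' x * (\<bar>det (matrix (k' x))\<bar> * f (from_copy (k x)))) \<in> borel_measurable borel"
      unfolding e1 det fk by (rule measurable_compose[OF borel_measurable_copy(1) m1])
    show "(\<lambda>y. indicator (k ` S') y * f (from_copy y)) \<in> borel_measurable borel"
      unfolding e2 by (rule measurable_compose[OF borel_measurable_copy(1) m2])
  qed
  then show ?thesis
    unfolding e1 e2 det fk
    by (subst (1 2) distr_from_copy[symmetric]) (use m1 m2 in \<open>simp add: nn_integral_distr\<close>)
qed

section \<open>Charts and transition maps\<close>

abbreviation chart_inv :: "('m, 'n::finite) chart \<Rightarrow> real^'n \<Rightarrow> 'm" where
  "chart_inv c \<equiv> inv_into (fst c) (snd c)"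

abbreviation chart_range :: "('m, 'n::finite) chart \<Rightarrow> (real^'n) set" where
  "chart_range c \<equiv> snd c ` fst c"

context
  fixes c :: "('m::t2_space, 'n::finite) chart"
  assumes c: "is_chart c"
begin

lemma chart_open: "open (fst c)" and chart_range_open: "open (chart_range c)"
  and chart_continuous: "continuous_on (fst c) (snd c)"
  and chart_inv_continuous: "continuous_on (chart_range c) (chart_inv c)"
  using c by (auto simp: is_chart_def homeomorphism_def)

lemma chart_inv_chart: "p \<in> fst c \<Longrightarrow> chart_inv c (snd c p) = p"
  using c by (auto simp: is_chart_def homeomorphism_def)

lemma chart_inv_in: "x \<in> chart_range c \<Longrightarrow> chart_inv c x \<in> fst c"
  by (rule inv_into_into)

lemma chart_chart_inv: "x \<in> chart_range c \<Longrightarrow> snd c (chart_inv c x) = x"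
  by (rule f_inv_into_f)

lemma inj_on_chart: "inj_on (snd c) (fst c)"
  by (metis chart_inv_chart inj_onI)

lemma chart_image_eq: "W \<subseteq> fst c \<Longrightarrow> snd c ` W = {x \<in> chart_range c. chart_inv c x \<in> W}"
  using chart_inv_chart chart_chart_inv by (auto simp: subset_iff image_iff)

lemma chart_image_open:
  assumes "open W" shows "open (snd c ` (fst c \<inter> W))"
proof -
  have "snd c ` (fst c \<inter> W) = chart_inv c -` W \<inter> chart_range c"
    using chart_inv_in by (subst chart_image_eq) auto
  then show ?thesis
    using continuous_open_preimage[OF chart_inv_continuous chart_range_open assms] by (simp add: Int_commute)
qed

lemma chart_image_compact:
  assumes "compact K" "K \<subseteq> fst c" shows "compact (snd c ` K)"
  using assms by (metis chart_continuous compact_continuous_image continuous_on_subset)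

lemma chart_inv_image_compact:
  assumes "compact K" "K \<subseteq> chart_range c" shows "compact (chart_inv c ` K)"
  using assms by (metis chart_inv_continuous compact_continuous_image continuous_on_subset)

text \<open>A forward image under a chart is a preimage under its continuous inverse.\<close>

lemma chart_image_borel:
  assumes "B \<in> sets borel" "B \<subseteq> fst c" shows "snd c ` B \<in> sets borel"
proof -
  have "chart_inv c \<in> measurable (restrict_space borel (chart_range c)) borel"
    by (rule borel_measurable_continuous_on_restrict[OF chart_inv_continuous])
  from measurable_sets[OF this assms(1)]
  have "chart_inv c -` B \<inter> chart_range c \<in> sets (restrict_space borel (chart_range c))"
    by (simp add: space_restrict_space)
  moreover have "snd c ` B = chart_inv c -` B \<inter> chart_range c"
    using chart_image_eq[OF assms(2)] by auto
  ultimately show ?thesis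
    using chart_range_open by (simp add: sets_restrict_space_iff)
qed

lemma chart_local_rep: "p \<in> fst c \<Longrightarrow> local_rep c u (snd c p) = u p"
  by (simp add: local_rep_def chart_inv_chart)

end

definition transition :: "('m, 'n::finite) chart \<Rightarrow> ('m, 'n) chart \<Rightarrow> real^'n \<Rightarrow> real^'n" where
  "transition c d = local_rep c (snd d)"

definition transition_matrix :: "('m, 'n::finite) chart \<Rightarrow> ('m, 'n) chart \<Rightarrow> real^'n \<Rightarrow> real^'n^'n" where
  "transition_matrix c d x = matrix (frechet_derivative (transition c d) (at x))"

section \<open>Invertible and positive definite matrices\<close>

lemma matrix_inv_props:
  fixes M :: "real^'n^'n" assumes "det M \<noteq> 0"
  shows "M ** matrix_inv M = mat 1" "matrix_inv M ** M = mat 1"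
    "M *v (matrix_inv M *v v) = v" "matrix_inv M *v (M *v v) = v"
proof -
  have "\<exists>M'. M ** M' = mat 1 \<and> M' ** M = mat 1"
    using assms by (simp add: invertible_det_nz[symmetric] invertible_def)
  from someI_ex[OF this] show *: "M ** matrix_inv M = mat 1" "matrix_inv M ** M = mat 1"
    by (auto simp: matrix_inv_def)
  from * show "M *v (matrix_inv M *v v) = v" "matrix_inv M *v (M *v v) = v"
    by (simp_all add: matrix_vector_mul_assoc)
qed

lemma inner_matrix_vector: "x \<bullet> (M *v y) = (\<Sum>i\<in>UNIV. \<Sum>j\<in>UNIV. M $ i $ j * (x $ i * (y $ j)))"
  for x :: "real^'n" and M :: "real^'m^'n"
  by (simp add: inner_vec_def matrix_vector_mult_def sum_distrib_left mult_ac)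

lemma inner_transpose: "(transpose M *v x) \<bullet> y = x \<bullet> (M *v y)" for M :: "real^'m^'n"
  by (simp add: dot_lmul_matrix[symmetric] transpose_matrix_vector)

text \<open>On the segment from the identity to \<open>M\<close> all matrices before the end are
  positive definite, and so is \<open>M\<close>; none has a kernel, so the determinant starts at 1
  and cannot reach 0.\<close>

lemma det_pos_if_positive_definite:
  fixes M :: "real^'n^'n"
  assumes "\<And>v. v \<noteq> 0 \<Longrightarrow> v \<bullet> (M *v v) > 0"
  shows "det M > 0"
proof (rule ccontr)
  assume neg: "\<not> det M > 0"
  define P where "P t = (1 - t) *\<^sub>R mat 1 + t *\<^sub>R M" for t :: real
  have "C1_on UNIV (\<lambda>t. det (P t))"
    unfolding P_def by (intro C1_on_det) (simp, intro C1_on_add C1_on_mult C1_on_diff C1_on_const C1_on_ident)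
  then have "continuous_on {0..1} (\<lambda>t. det (P t))"
    using C1_on_continuous_on continuous_on_subset by blast
  moreover have "det (P 0) = 1" "det (P 1) = det M" by (simp_all add: P_def)
  ultimately obtain t where t: "0 \<le> t" "t \<le> 1" "det (P t) = 0"
    using IVT2'[of "\<lambda>t. det (P t)" 1 0 0] neg by auto
  have "\<not> invertible (P t)" using t(3) by (simp add: invertible_det_nz)
  then obtain v where v: "v \<noteq> 0" "P t *v v = 0"
    using matrix_left_invertible_ker[of "P t"] invertible_left_inverse by blast
  have "0 = v \<bullet> (P t *v v)" using v by simp
  also have "\<dots> = (1 - t) * (v \<bullet> v) + t * (v \<bullet> (M *v v))"
    by (simp add: P_def matrix_vector_mult_add_rdistrib scaleR_matrix_vector_assoc[symmetric] inner_add_right)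
  also have "\<dots> > 0"
  proof (cases "t = 0")
    case True
    then show ?thesis using v by simp
  next
    case False
    then show ?thesis using v(1) t assms[OF v(1)] by (intro add_nonneg_pos) auto
  qed
  finally show False by simp
qed

section \<open>Immersions and the induced metric\<close>

text \<open>The metric is tied to a single immersion, so that two times of the flow become two
  interpretations over the same atlas.\<close>

locale immersed_manifold =
  fixes A :: "('m::{t2_space, second_countable_topology}, 'n::finite) chart set"
    and f :: "'m \<Rightarrow> real^'k::finite"
  assumes atlas: "smooth_atlas A" and imm: "immersion A f"
begin

lemma chart: "c \<in> A \<Longrightarrow> is_chart c"
  using atlas by (simp add: smooth_atlas_def)

lemma chart_at: "\<exists>c\<in>A. p \<in> fst c"
  using atlas unfolding smooth_atlas_def by blast

lemma transition_C1:
  assumes "c \<in> A" "d \<in> A"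
  shows "C1_on (snd c ` (fst c \<inter> fst d)) (transition c d)"
proof -
  have "smooth_compatible c d" using atlas assms by (simp add: smooth_atlas_def)
  moreover have "open (snd c ` (fst c \<inter> fst d))"
    using chart_image_open chart_open chart assms by blast
  ultimately show ?thesis unfolding transition_def smooth_compatible_def using smooth_on_C1 by blast
qed

lemma transition_chart: "c \<in> A \<Longrightarrow> p \<in> fst c \<Longrightarrow> transition c d (snd c p) = snd d p"
  by (simp add: transition_def chart_local_rep[OF chart])

lemma local_rep_transition:
  assumes "c \<in> A" "d \<in> A" "x \<in> snd c ` (fst c \<inter> fst d)"
  shows "local_rep c u x = local_rep d u (transition c d x)"
  using assms by (auto simp: transition_chart chart_local_rep[OF chart])

lemma has_derivative_transition:
  fixes u :: "'m \<Rightarrow> 'b::real_normed_vector"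
  assumes "c \<in> A" "d \<in> A" "p \<in> fst c" "p \<in> fst d"
    and "(local_rep d u has_derivative D) (at (snd d p))"
  shows "(local_rep c u has_derivative (\<lambda>v. D (transition_matrix c d (snd c p) *v v))) (at (snd c p))"
proof -
  let ?S = "snd c ` (fst c \<inter> fst d)"
  have S: "open ?S" using chart_image_open chart_open chart assms(1,2) by blast
  have x: "snd c p \<in> ?S" using assms by blast
  have dt: "transition c d differentiable (at (snd c p))"
    using C1_on_differentiable[OF transition_C1 x] assms by blast
  have "(transition c d has_derivative frechet_derivative (transition c d) (at (snd c p))) (at (snd c p))"
    using dt frechet_derivative_works by blast
  moreover have "linear (frechet_derivative (transition c d) (at (snd c p)))"
    by (rule linear_frechet_derivative[OF dt])
  then have "frechet_derivative (transition c d) (at (snd c p)) = (*v) (transition_matrix c d (snd c p))"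
    unfolding transition_matrix_def by (simp add: fun_eq_iff matrix_works)
  ultimately have "(transition c d has_derivative (*v) (transition_matrix c d (snd c p))) (at (snd c p))" by simp
  moreover have "(local_rep d u has_derivative D) (at (transition c d (snd c p)))"
    using assms transition_chart by simp
  ultimately have "((\<lambda>x. local_rep d u (transition c d x)) has_derivative
      (\<lambda>v. D (transition_matrix c d (snd c p) *v v))) (at (snd c p))"
    using diff_chain_at unfolding o_def by blast
  then show ?thesis
    by (rule has_derivative_transform_within_open[OF _ S x]) (simp add: local_rep_transition[OF assms(1,2)])
qed

lemma partial_transition:
  fixes u :: "'m \<Rightarrow> 'b::real_normed_vector"
  assumes "c \<in> A" "d \<in> A" "p \<in> fst c" "p \<in> fst d" "local_rep d u differentiable (at (snd d p))"
  shows "partial_deriv i (local_rep c u) (snd c p) =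
    (\<Sum>j\<in>UNIV. transition_matrix c d (snd c p) $ j $ i *\<^sub>R partial_deriv j (local_rep d u) (snd d p))"
proof -
  have "(local_rep d u has_derivative frechet_derivative (local_rep d u) (at (snd d p))) (at (snd d p))"
    using assms(5) frechet_derivative_works by blast
  from partial_derivI[OF has_derivative_transition[OF assms(1-4) this]]
  show ?thesis
    by (simp add: frechet_partial[OF assms(5)] matrix_vector_mul_component column_def
        matrix_vector_mult_basis)
qed

lemma C1_on_change_chart:
  fixes u :: "'m \<Rightarrow> real"
  assumes "c \<in> A" "d \<in> A" "C1_on (snd d ` (fst d \<inter> W)) (local_rep d u)" "open W"
  shows "C1_on (snd c ` (fst c \<inter> fst d \<inter> W)) (local_rep c u)"
proof -
  let ?S = "snd c ` (fst c \<inter> fst d \<inter> W)"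
  have "open (snd c ` (fst c \<inter> (fst d \<inter> W)))"
    by (rule chart_image_open[OF chart[OF assms(1)] open_Int[OF chart_open[OF chart[OF assms(2)]] assms(4)]])
  then have S: "open ?S" by (simp add: Int_assoc)
  have "C1_on ?S (\<lambda>x. local_rep d u (transition c d x))"
    by (rule C1_on_compose[OF assms(3) C1_on_subset[OF transition_C1[OF assms(1,2)]]])
      (auto simp: transition_chart[OF assms(1)])
  then show ?thesis
    by (rule C1_on_cong[OF S]) (rule local_rep_transition[OF assms(1,2), symmetric], auto)
qed

text \<open>The metric is this matrix multiplied from the left by its transpose
  (\<open>g_jac\<close>); symmetry, definiteness and the transformation law of the metric are all
  read off from it.\<close>

definition jac :: "('m, 'n) chart \<Rightarrow> real^'n \<Rightarrow> real^'n^'k" where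
  "jac c x = (\<chi> a i. partial_deriv i (local_rep c f) x $ a)"

abbreviation g :: "('m, 'n) metric_coeffs" where "g \<equiv> induced_metric f"

lemma g_jac: "g c x = transpose (jac c x) ** jac c x"
  by (simp add: induced_metric_def jac_def matrix_matrix_mult_def transpose_def vec_eq_iff inner_vec_def)

lemma f_smooth: "c \<in> A \<Longrightarrow> smooth_on (chart_range c) (local_rep c f)"
  using imm by (simp add: immersion_def)

lemma f_partial_C1: "c \<in> A \<Longrightarrow> C1_on (chart_range c) (partial_deriv i (local_rep c f))"
  using f_smooth smooth_on_partial smooth_on_C1 chart_range_open chart by metis

lemma f_differentiable: "c \<in> A \<Longrightarrow> x \<in> chart_range c \<Longrightarrow> local_rep c f differentiable (at x)"
  using f_smooth smooth_on_C1 C1_on_differentiable chart_range_open chart by metis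

lemma jac_mult: "c \<in> A \<Longrightarrow> x \<in> chart_range c \<Longrightarrow> jac c x *v v = frechet_derivative (local_rep c f) (at x) v"
  using frechet_partial[OF f_differentiable, of c x v]
  by (simp add: jac_def matrix_vector_mult_def vec_eq_iff mult.commute)

lemma jac_inj: "c \<in> A \<Longrightarrow> x \<in> chart_range c \<Longrightarrow> jac c x *v v = 0 \<Longrightarrow> v = 0"
proof -
  assume *: "c \<in> A" "x \<in> chart_range c" "jac c x *v v = 0"
  have "inj (frechet_derivative (local_rep c f) (at x))" using imm * by (auto simp: immersion_def)
  moreover have "frechet_derivative (local_rep c f) (at x) v = frechet_derivative (local_rep c f) (at x) 0"
    using * jac_mult[OF *(1,2), of v] jac_mult[OF *(1,2), of 0] by simp
  ultimately show "v = 0" by (rule injD)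
qed

lemma inner_g: "v \<bullet> (g c x *v w) = (jac c x *v v) \<bullet> (jac c x *v w)"
  unfolding g_jac matrix_vector_mul_assoc[symmetric] by (metis inner_transpose inner_commute)

lemma g_pos: "c \<in> A \<Longrightarrow> x \<in> chart_range c \<Longrightarrow> v \<noteq> 0 \<Longrightarrow> v \<bullet> (g c x *v v) > 0"
  using jac_inj[of c x v] by (auto simp only: inner_g inner_gt_zero_iff)

lemma g_nonneg: "v \<bullet> (g c x *v v) \<ge> 0"
  by (simp add: inner_g)

lemma g_sym: "v \<bullet> (g c x *v w) = w \<bullet> (g c x *v v)"
  by (simp add: inner_g inner_commute)

lemma det_g_pos: "c \<in> A \<Longrightarrow> x \<in> chart_range c \<Longrightarrow> det (g c x) > 0"
  using det_pos_if_positive_definite g_pos by blast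

lemma g_inv: "c \<in> A \<Longrightarrow> x \<in> chart_range c \<Longrightarrow> g c x *v (matrix_inv (g c x) *v v) = v"
  "c \<in> A \<Longrightarrow> x \<in> chart_range c \<Longrightarrow> matrix_inv (g c x) *v (g c x *v v) = v"
  using matrix_inv_props det_g_pos less_irrefl by metis+

lemma g_C1: "c \<in> A \<Longrightarrow> C1_on (chart_range c) (\<lambda>x. g c x $ i $ j)"
  unfolding induced_metric_def by (simp add: C1_on_inner f_partial_C1)

abbreviation dens :: "('m, 'n) chart \<Rightarrow> real^'n \<Rightarrow> real" where
  "dens c x \<equiv> sqrt (det (g c x))"

lemma dens_pos: "c \<in> A \<Longrightarrow> x \<in> chart_range c \<Longrightarrow> dens c x > 0"
  by (simp add: det_g_pos)

lemma dens_C1: "c \<in> A \<Longrightarrow> C1_on (chart_range c) (dens c)"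
  by (intro C1_on_sqrt C1_on_det g_C1 det_g_pos)

lemma jac_transition:
  assumes "c \<in> A" "d \<in> A" "p \<in> fst c" "p \<in> fst d"
  shows "jac c (snd c p) = jac d (snd d p) ** transition_matrix c d (snd c p)"
proof -
  have "local_rep d f differentiable (at (snd d p))" using f_differentiable assms by blast
  from partial_transition[OF assms this] show ?thesis
    by (simp add: jac_def matrix_matrix_mult_def vec_eq_iff mult.commute)
qed

lemma g_transition:
  assumes "c \<in> A" "d \<in> A" "p \<in> fst c" "p \<in> fst d"
  shows "g c (snd c p) = transpose (transition_matrix c d (snd c p)) ** (g d (snd d p) ** transition_matrix c d (snd c p))"
  unfolding g_jac jac_transition[OF assms] matrix_transpose_mul by (simp add: matrix_mul_assoc)

text \<open>The determinant of the metric picks up the square of the determinant of the transition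
  matrix. Its root is the Jacobian factor of the change of variables formula.\<close>

lemma dens_transition:
  assumes "c \<in> A" "d \<in> A" "p \<in> fst c" "p \<in> fst d"
  shows "dens c (snd c p) = \<bar>det (transition_matrix c d (snd c p))\<bar> * dens d (snd d p)"
  unfolding g_transition[OF assms]
  by (simp add: det_mul det_transpose real_sqrt_mult mult.left_commute[of _ "sqrt (det (g d (snd d p)))"]
      real_sqrt_mult_self mult.commute)

section \<open>Inner products of differentials\<close>

definition dvec :: "('m, 'n) chart \<Rightarrow> ('m \<Rightarrow> real) \<Rightarrow> real^'n \<Rightarrow> real^'n" where
  "dvec c u x = (\<chi> j. partial_deriv j (local_rep c u) x)"

text \<open>The inverse metric applied to the differentials of \<open>u\<close> and
  \<open>v\<close>, which is the metric applied to their gradients.\<close>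

definition gpair_chart :: "('m, 'n) chart \<Rightarrow> ('m \<Rightarrow> real) \<Rightarrow> ('m \<Rightarrow> real) \<Rightarrow> real^'n \<Rightarrow> real" where
  "gpair_chart c u v x = dvec c u x \<bullet> (matrix_inv (g c x) *v dvec c v x)"

text \<open>The inner product of two gradients, read off in a chosen chart; by \<open>gpair_eq\<close> below every
  chart gives the same value.\<close>

definition gpair :: "('m \<Rightarrow> real) \<Rightarrow> ('m \<Rightarrow> real) \<Rightarrow> 'm \<Rightarrow> real" where
  "gpair u v p = (let c = SOME c. c \<in> A \<and> p \<in> fst c in gpair_chart c u v (snd c p))"

lemma dvec_transition:
  assumes "c \<in> A" "d \<in> A" "p \<in> fst c" "p \<in> fst d" "local_rep d u differentiable (at (snd d p))"
  shows "dvec c u (snd c p) = transpose (transition_matrix c d (snd c p)) *v dvec d u (snd d p)"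
  using partial_transition[OF assms]
  by (simp add: dvec_def matrix_vector_mult_def transpose_def)

text \<open>The transition matrix maps the gradient \<open>y\<close> of \<open>v\<close> in the
  chart \<open>c\<close> to the gradient in \<open>d\<close>: each is the solution of a linear
  system with the metric as matrix, and between the two systems the transposed transition matrix
  cancels.\<close>

lemma gpair_chart_transition:
  assumes "c \<in> A" "d \<in> A" "p \<in> fst c" "p \<in> fst d"
    "local_rep d u differentiable (at (snd d p))" "local_rep d v differentiable (at (snd d p))"
  shows "gpair_chart c u v (snd c p) = gpair_chart d u v (snd d p)"
proof -
  let ?J = "transition_matrix c d (snd c p)"
  define y where "y = matrix_inv (g c (snd c p)) *v dvec c v (snd c p)"
  have cr: "snd c p \<in> chart_range c" "snd d p \<in> chart_range d" using assms by auto
  have "g c (snd c p) *v y = dvec c v (snd c p)"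
    unfolding y_def using g_inv(1)[OF assms(1) cr(1)] .
  then have "transpose ?J *v (g d (snd d p) *v (?J *v y)) = transpose ?J *v dvec d v (snd d p)"
    unfolding g_transition[OF assms(1-4)] dvec_transition[OF assms(1-4,6)] by (simp add: matrix_vector_mul_assoc)
  \<comment> \<open>A singular transition matrix would force the positive density in
    \<open>c\<close> to vanish.\<close>
  moreover have "det ?J \<noteq> 0"
    using dens_transition[OF assms(1-4)] dens_pos[OF assms(1) cr(1)] by auto
  then have "det (transpose ?J) \<noteq> 0" by (simp add: det_transpose)
  ultimately have "g d (snd d p) *v (?J *v y) = dvec d v (snd d p)"
    using matrix_inv_props(4) by metis
  then have "?J *v y = matrix_inv (g d (snd d p)) *v dvec d v (snd d p)"
    using g_inv(2)[OF assms(2) cr(2)] by metis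
  then show ?thesis
    unfolding gpair_chart_def y_def[symmetric] dvec_transition[OF assms(1-5)] inner_transpose by simp
qed

lemma gpair_eq:
  assumes "c \<in> A" "p \<in> fst c"
    "local_rep c u differentiable (at (snd c p))" "local_rep c v differentiable (at (snd c p))"
  shows "gpair u v p = gpair_chart c u v (snd c p)"
proof -
  have "\<exists>c. c \<in> A \<and> p \<in> fst c" using assms by blast
  from someI_ex[OF this] show ?thesis
    unfolding gpair_def Let_def using gpair_chart_transition assms by blast
qed

end

section \<open>The Riemannian volume measure\<close>

context immersed_manifold
begin

definition chart_mass :: "('m, 'n) chart \<Rightarrow> 'm set \<Rightarrow> ennreal" where
  "chart_mass c B = (\<integral>\<^sup>+x\<in>snd c ` B. ennreal (dens c x) \<partial>lborel)"

definition is_volume :: "'m measure \<Rightarrow> bool" where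
  "is_volume \<mu> \<longleftrightarrow> sets \<mu> = sets borel \<and>
     (\<forall>c\<in>A. \<forall>B\<in>sets borel. B \<subseteq> fst c \<longrightarrow> emeasure \<mu> B = chart_mass c B)"

lemma borel_measurable_dens [measurable]:
  assumes "c \<in> A" "X \<in> sets borel" "X \<subseteq> chart_range c"
  shows "(\<lambda>x. indicator X x * dens c x) \<in> borel_measurable borel"
proof -
  have "open (chart_range c)" using chart_range_open chart assms(1) by blast
  then have "(\<lambda>x. indicator (chart_range c) x *\<^sub>R dens c x) \<in> borel_measurable borel"
    using C1_on_continuous_on[OF dens_C1[OF assms(1)]]
    by (intro borel_measurable_continuous_on_indicator) auto
  then have "(\<lambda>x. indicator X x * (indicator (chart_range c) x *\<^sub>R dens c x)) \<in> borel_measurable borel"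
    using assms(2) by measurable
  moreover have "indicator X x * (indicator (chart_range c) x *\<^sub>R dens c x) = indicator X x * dens c x" for x
    using assms(3) by (auto simp: indicator_def)
  ultimately show ?thesis by (simp only:)
qed

lemma chart_mass_eq: "chart_mass c B = (\<integral>\<^sup>+x. ennreal (indicator (snd c ` B) x * dens c x) \<partial>lborel)"
  unfolding chart_mass_def by (intro nn_integral_cong) (auto simp: indicator_def)

text \<open>Consistency on overlaps: without it no measure could have the prescribed values in all
  charts at once.\<close>

lemma chart_mass_change:
  assumes "c \<in> A" "d \<in> A" "B \<in> sets borel" "B \<subseteq> fst c" "B \<subseteq> fst d"
  shows "chart_mass c B = chart_mass d B"
proof -
  let ?S = "snd c ` B" and ?t = "transition c d"
  have tS: "?t ` ?S = snd d ` B"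
    unfolding image_image by (rule image_cong[OF refl], rule transition_chart[OF assms(1)]) (use assms(4) in blast)
  have Sb: "?S \<in> sets borel" "snd d ` B \<in> sets borel"
    using chart_image_borel chart assms by blast+
  have dt: "(?t has_derivative frechet_derivative ?t (at x)) (at x within ?S)" if "x \<in> ?S" for x
  proof -
    have "x \<in> snd c ` (fst c \<inter> fst d)" using that assms by blast
    then show ?thesis
      using C1_on_has_derivative[OF transition_C1[OF assms(1,2)]] has_derivative_at_withinI by blast
  qed
  have inj: "inj_on ?t ?S"
  proof (rule inj_onI)
    fix x y assume "x \<in> ?S" "y \<in> ?S" "?t x = ?t y"
    then obtain p q where pq: "p \<in> B" "q \<in> B" "x = snd c p" "y = snd c q" by blast
    with \<open>?t x = ?t y\<close> have "snd d p = snd d q"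
      using transition_chart[OF assms(1), of p d] transition_chart[OF assms(1), of q d] assms(4)
      by (metis subsetD)
    then have "p = q" using inj_on_chart[OF chart[OF assms(2)]] pq assms(5) by (auto dest: inj_onD)
    then show "x = y" using pq by simp
  qed
  have eq: "indicator ?S x * dens c x =
      indicator ?S x * (\<bar>det (matrix (frechet_derivative ?t (at x)))\<bar> * dens d (?t x))" for x
  proof (cases "x \<in> ?S")
    case True
    then obtain p where p: "p \<in> fst c" "p \<in> fst d" "x = snd c p" using assms(4,5) by blast
    then show ?thesis
      using dens_transition[OF assms(1,2) p(1,2)] transition_chart[OF assms(1) p(1)]
      by (simp add: transition_matrix_def)
  qed simp
  have "chart_mass c B = (\<integral>\<^sup>+x. ennreal (indicator ?S x *
      (\<bar>det (matrix (frechet_derivative ?t (at x)))\<bar> * dens d (?t x))) \<partial>lborel)"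
    unfolding chart_mass_eq by (simp only: eq)
  also have "\<dots> = (\<integral>\<^sup>+y. ennreal (indicator (?t ` ?S) y * dens d y) \<partial>lborel)"
  proof (rule nn_integral_change_of_variables[OF _ _ dt inj])
    show "dens d y \<ge> 0" if "y \<in> ?t ` ?S" for y
      using dens_pos[OF assms(2)] that assms(5) unfolding tS by (auto intro: less_imp_le)
    show "(\<lambda>x. indicator ?S x * (\<bar>det (matrix (frechet_derivative ?t (at x)))\<bar> * dens d (?t x))) \<in> borel_measurable borel"
      unfolding eq[symmetric] by (rule borel_measurable_dens) (use assms Sb in auto)
    show "(\<lambda>y. indicator (?t ` ?S) y * dens d y) \<in> borel_measurable borel"
      unfolding tS by (rule borel_measurable_dens) (use assms Sb in auto)
  qed (use Sb tS in auto)
  also have "\<dots> = chart_mass d B" unfolding chart_mass_eq tS ..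
  finally show ?thesis .
qed

text \<open>The inverse chart as a total Borel function. The default value never contributes,
  because the density used in \<open>chart_measure\<close> vanishes off the chart range.\<close>

definition chart_pt :: "('m, 'n) chart \<Rightarrow> real^'n \<Rightarrow> 'm" where
  "chart_pt c x = (if x \<in> chart_range c then chart_inv c x else undefined)"

definition chart_measure :: "('m, 'n) chart \<Rightarrow> 'm measure" where
  "chart_measure c = distr (density lborel (\<lambda>x. ennreal (indicator (chart_range c) x * dens c x))) borel (chart_pt c)"

lemma chart_pt_measurable:
  assumes "c \<in> A" shows "chart_pt c \<in> borel_measurable borel"
proof -
  have o: "open (chart_range c)" using chart_range_open chart assms by blast
  show ?thesis unfolding chart_pt_def[abs_def]
  proof (rule measurable_If_restrict_space_iff[THEN iffD2])
    have "chart_inv c \<in> measurable (restrict_space borel (chart_range c)) borel"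
      by (rule borel_measurable_continuous_on_restrict[OF chart_inv_continuous[OF chart[OF assms]]])
    then show "chart_inv c \<in> measurable (restrict_space borel {x. x \<in> chart_range c}) borel \<and>
      (\<lambda>x. undefined) \<in> measurable (restrict_space borel {x. x \<notin> chart_range c}) borel" by simp
  qed (use o in auto)
qed

lemma emeasure_chart_measure:
  assumes c: "c \<in> A" and B: "B \<in> sets borel"
  shows "emeasure (chart_measure c) B = chart_mass c (B \<inter> fst c)"
proof -
  have o: "open (chart_range c)" using chart_range_open chart c by blast
  have m: "chart_pt c \<in> borel_measurable borel" by (rule chart_pt_measurable[OF c])
  have m2: "(\<lambda>x. ennreal (indicator (chart_range c) x * dens c x)) \<in> borel_measurable borel"
    using borel_measurable_dens[OF c, of "chart_range c"] o by auto
  have "emeasure (chart_measure c) B = emeasure (density lborel (\<lambda>x. ennreal (indicator (chart_range c) x * dens c x))) (chart_pt c -` B)"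
    unfolding chart_measure_def using m B by (subst emeasure_distr) auto
  also have "\<dots> = (\<integral>\<^sup>+x. ennreal (indicator (chart_range c) x * dens c x) * indicator (chart_pt c -` B) x \<partial>lborel)"
    using m2 measurable_sets_borel[OF m B] by (subst emeasure_density) auto
  also have "\<dots> = chart_mass c (B \<inter> fst c)"
    unfolding chart_mass_eq
  proof (intro nn_integral_cong)
    fix x
    have "snd c ` (B \<inter> fst c) = {x \<in> chart_range c. chart_inv c x \<in> B \<inter> fst c}"
      by (rule chart_image_eq[OF chart[OF c]]) auto
    then show "ennreal (indicator (chart_range c) x * dens c x) * indicator (chart_pt c -` B) x =
        ennreal (indicator (snd c ` (B \<inter> fst c)) x * dens c x)"
      using chart_inv_in[OF chart[OF c]] by (auto simp: indicator_def chart_pt_def)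
  qed
  finally show ?thesis .
qed

lemma sets_chart_measure [simp]: "sets (chart_measure c) = sets borel"
  by (simp add: chart_measure_def)

text \<open>Second countability yields countably many chart domains that cover the manifold
  (Lindelof), and removing the earlier ones makes them disjoint. Every Borel set then splits into
  countably many pieces whose volume is prescribed by a single chart each.\<close>

lemma chart_partition:
  "\<exists>(e :: nat \<Rightarrow> ('m, 'n) chart) (D :: nat \<Rightarrow> 'm set). (\<forall>n. e n \<in> A \<and> D n \<in> sets borel \<and> D n \<subseteq> fst (e n)) \<and>
    disjoint_family D \<and> (\<Union>n. D n) = UNIV"
proof -
  have op: "open S" if "S \<in> fst ` A" for S using that chart_open[OF chart] by blast
  obtain F' where F': "F' \<subseteq> fst ` A" "countable F'" "\<Union>F' = \<Union>(fst ` A)"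
    by (rule Lindelof[of "fst ` A"]) (erule op)
  have un: "\<Union>(fst ` A) = UNIV" using chart_at by blast
  then have ne: "F' \<noteq> {}" using F'(3) by auto
  \<comment> \<open>The subcover consists of domains, so a chart has to be chosen again for each of
    them. The enumeration may repeat a domain, which \<open>disjointed\<close> turns into an empty
    piece.\<close>
  define e where "e n = (SOME c. c \<in> A \<and> fst c = from_nat_into F' n)" for n
  have e: "e n \<in> A \<and> fst (e n) = from_nat_into F' n" for n
  proof -
    obtain c where "c \<in> A" "from_nat_into F' n = fst c"
      using from_nat_into[OF ne, of n] F'(1) by blast
    then have "\<exists>c. c \<in> A \<and> fst c = from_nat_into F' n" by metis
    then show ?thesis unfolding e_def by (rule someI_ex)
  qed
  have "(\<Union>n. fst (e n)) = \<Union>(range (from_nat_into F'))"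
    using e by (simp add: image_image)
  also have "\<dots> = UNIV" unfolding range_from_nat_into[OF ne F'(2)] F'(3) un ..
  finally have cov: "(\<Union>n. fst (e n)) = UNIV" .
  let ?D = "disjointed (\<lambda>n. fst (e n))"
  have "fst (e n) \<in> sets borel" for n using chart_open[OF chart, of "e n"] e by auto
  then have "?D n \<in> sets borel" for n
    unfolding disjointed_def by (intro sets.Diff sets.finite_UN) auto
  moreover have "(\<Union>n. ?D n) = UNIV" using cov by (simp only: UN_disjointed_eq)
  ultimately show ?thesis
    using e disjointed_subset[of "\<lambda>n. fst (e n)"] disjoint_family_disjointed[of "\<lambda>n. fst (e n)"] by blast
qed

text \<open>The measure is the sum of the chart masses over the pieces of
  \<open>chart_partition\<close>. On a set inside a chart \<open>c\<close> the value does not depend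
  on the partition, because every piece may be measured in \<open>c\<close> instead by
  \<open>chart_mass_change\<close>.\<close>

lemma volume_exists: "\<exists>\<mu>. is_volume \<mu>"
proof -
  obtain e :: "nat \<Rightarrow> ('m, 'n) chart" and D :: "nat \<Rightarrow> 'm set"
    where eD: "(\<forall>n. e n \<in> A \<and> D n \<in> sets borel \<and> D n \<subseteq> fst (e n)) \<and>
      disjoint_family D \<and> (\<Union>n. D n) = UNIV"
    using chart_partition by (elim exE)
  then have e: "\<And>n. e n \<in> A" and D: "\<And>n. D n \<in> sets borel" "\<And>n. D n \<subseteq> fst (e n)"
    "disjoint_family D" "(\<Union>n. D n) = UNIV" by auto
  define \<nu> where "\<nu> B = (\<Sum>n. chart_mass (e n) (B \<inter> D n))" for B
  define \<mu> where "\<mu> = measure_of UNIV (sets borel) \<nu>"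
  have mass: "chart_mass (e n) (B \<inter> D n) = emeasure (chart_measure (e n)) (B \<inter> D n)" if "B \<in> sets borel" for B n
    using emeasure_chart_measure[OF e, of "B \<inter> D n" n] D(2)[of n] that D(1) by (simp add: Int_absorb2 le_infI2)
  have "countably_additive (sets borel) \<nu>"
  proof (rule countably_additiveI)
    fix B :: "nat \<Rightarrow> 'm set"
    assume B: "range B \<subseteq> sets borel" "disjoint_family B"
    have dj: "disjoint_family (\<lambda>i. B i \<inter> D n)" for n using B(2) by (auto simp: disjoint_family_on_def)
    have s: "(\<Sum>i. chart_mass (e n) (B i \<inter> D n)) = chart_mass (e n) ((\<Union>i. B i) \<inter> D n)" for n
    proof -
      have "(\<Sum>i. emeasure (chart_measure (e n)) (B i \<inter> D n)) = emeasure (chart_measure (e n)) (\<Union>i. B i \<inter> D n)"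
        by (rule suminf_emeasure[OF _ dj]) (use B D(1) in auto)
      moreover have "(\<Union>i. B i \<inter> D n) = (\<Union>i. B i) \<inter> D n" by blast
      moreover have "B i \<in> sets borel" "(\<Union>i. B i) \<in> sets borel" for i using B(1) by auto
      ultimately show ?thesis using mass by simp
    qed
    \<comment> \<open>Countable additivity is an exchange of two series; the outer one is read as an
      integral over counting measure to allow it.\<close>
    have "(\<Sum>i. \<nu> (B i)) = (\<integral>\<^sup>+i. (\<Sum>n. chart_mass (e n) (B i \<inter> D n)) \<partial>count_space UNIV)"
      unfolding \<nu>_def by (rule nn_integral_count_space_nat[symmetric])
    also have "\<dots> = (\<Sum>n. \<integral>\<^sup>+i. chart_mass (e n) (B i \<inter> D n) \<partial>count_space UNIV)"
      by (rule nn_integral_suminf) auto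
    also have "\<dots> = \<nu> (\<Union>i. B i)"
      unfolding \<nu>_def by (simp add: nn_integral_count_space_nat s)
    finally show "(\<Sum>i. \<nu> (B i)) = \<nu> (\<Union>i. B i)" .
  qed
  moreover have "positive (sets borel) \<nu>"
    by (simp add: positive_def \<nu>_def chart_mass_def)
  moreover have sb: "sigma_algebra UNIV (sets (borel :: 'm measure))" by (metis sets.sigma_algebra_axioms space_borel)
  moreover have st: "sets \<mu> = sets borel"
    unfolding \<mu>_def by (simp add: sigma_algebra.sets_measure_of_eq[OF sb])
  ultimately have em: "emeasure \<mu> B = \<nu> B" if "B \<in> sets borel" for B
    unfolding \<mu>_def using that by (intro emeasure_measure_of_sigma)
  have "emeasure \<mu> B = chart_mass c B" if c: "c \<in> A" and B: "B \<in> sets borel" "B \<subseteq> fst c" for c B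
  proof -
    have "emeasure \<mu> B = (\<Sum>n. chart_mass (e n) (B \<inter> D n))" using em[OF B(1)] by (simp add: \<nu>_def)
    also have "\<dots> = (\<Sum>n. emeasure (chart_measure c) (B \<inter> D n))"
    proof (intro suminf_cong)
      fix n
      have "chart_mass (e n) (B \<inter> D n) = chart_mass c (B \<inter> D n)"
        by (rule chart_mass_change) (use c e B D(1) D(2)[of n] in auto)
      also have "\<dots> = emeasure (chart_measure c) (B \<inter> D n)"
        using emeasure_chart_measure[OF c, of "B \<inter> D n"] B D(1) by (simp add: Int_absorb2 le_infI1)
      finally show "chart_mass (e n) (B \<inter> D n) = emeasure (chart_measure c) (B \<inter> D n)" .
    qed
    also have "\<dots> = emeasure (chart_measure c) (\<Union>n. B \<inter> D n)"
      by (rule suminf_emeasure) (use B D(1) disjoint_family_subset[OF D(3), of "\<lambda>n. B \<inter> D n"] in auto)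
    also have "(\<Union>n. B \<inter> D n) = B" using D(4) by blast
    also have "emeasure (chart_measure c) B = chart_mass c B"
      using emeasure_chart_measure[OF c B(1)] B(2) by (simp add: Int_absorb2)
    finally show ?thesis .
  qed
  then show ?thesis unfolding is_volume_def using st by blast
qed

lemma volume_unique:
  assumes "is_volume \<mu>" "is_volume \<mu>'" shows "\<mu> = \<mu>'"
proof (rule measure_eqI)
  show "sets \<mu> = sets \<mu>'" using assms by (simp add: is_volume_def)
  obtain e :: "nat \<Rightarrow> ('m, 'n) chart" and D :: "nat \<Rightarrow> 'm set"
    where eD: "(\<forall>n. e n \<in> A \<and> D n \<in> sets borel \<and> D n \<subseteq> fst (e n)) \<and>
      disjoint_family D \<and> (\<Union>n. D n) = UNIV"
    using chart_partition by (elim exE)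
  then have e: "\<And>n. e n \<in> A" and D: "\<And>n. D n \<in> sets borel" "\<And>n. D n \<subseteq> fst (e n)"
    "disjoint_family D" "(\<Union>n. D n) = UNIV" by auto
  fix B assume "B \<in> sets \<mu>"
  then have B: "B \<in> sets borel" using assms by (simp add: is_volume_def)
  have "emeasure \<mu> B = (\<Sum>n. chart_mass (e n) (B \<inter> D n))" if "is_volume \<mu>" for \<mu>
  proof -
    have "B = (\<Union>n. B \<inter> D n)" using D(4) by blast
    then have "emeasure \<mu> B = emeasure \<mu> (\<Union>n. B \<inter> D n)" by simp
    also have "\<dots> = (\<Sum>n. emeasure \<mu> (B \<inter> D n))"
      by (rule suminf_emeasure[symmetric])
        (use B D(1) that disjoint_family_subset[OF D(3), of "\<lambda>n. B \<inter> D n"] in \<open>auto simp: is_volume_def\<close>)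
    also have "\<dots> = (\<Sum>n. chart_mass (e n) (B \<inter> D n))"
    proof (intro suminf_cong)
      fix n
      have "B \<inter> D n \<in> sets borel" "B \<inter> D n \<subseteq> fst (e n)" using B D by auto
      then show "emeasure \<mu> (B \<inter> D n) = chart_mass (e n) (B \<inter> D n)"
        using that e unfolding is_volume_def by blast
    qed
    finally show ?thesis .
  qed
  then show "emeasure \<mu> B = emeasure \<mu>' B" using assms by simp
qed

abbreviation vol :: "'m measure" where "vol \<equiv> riemannian_volume A g"

lemma vol: "is_volume vol"
proof -
  have "riemannian_volume A g = (THE \<mu>. is_volume \<mu>)"
    unfolding riemannian_volume_def is_volume_def chart_mass_def ..
  then show ?thesis using theI'[of is_volume] volume_exists volume_unique by metis
qed

lemma sets_vol [simp, measurable_cong]: "sets vol = sets borel"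
  using vol by (simp add: is_volume_def)

lemma space_vol [simp]: "space vol = UNIV"
  using sets_eq_imp_space_eq[OF sets_vol] by simp

lemma emeasure_vol: "c \<in> A \<Longrightarrow> B \<in> sets borel \<Longrightarrow> B \<subseteq> fst c \<Longrightarrow> emeasure vol B = chart_mass c B"
  using vol by (simp add: is_volume_def)

lemma density_vol:
  assumes "c \<in> A" shows "density vol (indicator (fst c)) = chart_measure c"
proof (rule measure_eqI)
  fix B assume "B \<in> sets (density vol (indicator (fst c)))"
  then have B: "B \<in> sets borel" by simp
  have o: "fst c \<in> sets borel" using chart_open[OF chart[OF assms]] by auto
  have "emeasure (density vol (indicator (fst c))) B = emeasure vol (B \<inter> fst c)"
  proof -
    have "emeasure (density vol (indicator (fst c))) B = (\<integral>\<^sup>+x. indicator (fst c) x * indicator B x \<partial>vol)"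
      using B o by (subst emeasure_density) auto
    also have "\<dots> = (\<integral>\<^sup>+x. indicator (B \<inter> fst c) x \<partial>vol)"
      by (intro nn_integral_cong) (auto simp: indicator_def)
    finally show ?thesis using B o by simp
  qed
  also have "\<dots> = chart_mass c (B \<inter> fst c)" using emeasure_vol assms B o by auto
  finally show "emeasure (density vol (indicator (fst c))) B = emeasure (chart_measure c) B"
    using emeasure_chart_measure[OF assms B] by simp
qed simp

lemma integral_vol_chart:
  fixes F :: "'m \<Rightarrow> real"
  assumes c: "c \<in> A" and F: "F \<in> borel_measurable borel" "\<And>p. p \<notin> fst c \<Longrightarrow> F p = 0"
  shows "(\<integral>p. F p \<partial>vol) = (\<integral>x. indicator (chart_range c) x * dens c x * F (chart_inv c x) \<partial>lborel)"
proof -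
  have o: "fst c \<in> sets borel" "chart_range c \<in> sets borel"
    using chart_open[OF chart[OF c]] chart_range_open[OF chart[OF c]] by auto
  have m: "chart_pt c \<in> borel_measurable borel" by (rule chart_pt_measurable[OF c])
  have m2: "(\<lambda>x. indicator (chart_range c) x * dens c x) \<in> borel_measurable borel"
    using borel_measurable_dens[OF c, of "chart_range c"] o by auto
  have "(\<integral>p. F p \<partial>vol) = (\<integral>p. indicator (fst c) p *\<^sub>R F p \<partial>vol)"
    by (intro Bochner_Integration.integral_cong) (auto simp: indicator_def F(2))
  also have "\<dots> = (\<integral>p. F p \<partial>density vol (\<lambda>p. ennreal (indicator (fst c) p)))"
    using F(1) o by (subst integral_density) auto
  also have "density vol (\<lambda>p. ennreal (indicator (fst c) p)) = chart_measure c"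
    using density_vol[OF c] by (simp add: ennreal_indicator)
  also have "(\<integral>p. F p \<partial>chart_measure c) = (\<integral>x. (indicator (chart_range c) x * dens c x) *\<^sub>R F (chart_pt c x) \<partial>lborel)"
    unfolding chart_measure_def using m m2 F(1) dens_pos[OF c]
    by (subst integral_distr, simp, simp) (subst integral_density,
        auto simp: indicator_def intro: less_imp_le measurable_compose[OF m F(1)])
  also have "\<dots> = (\<integral>x. indicator (chart_range c) x * dens c x * F (chart_inv c x) \<partial>lborel)"
    by (intro Bochner_Integration.integral_cong) (auto simp: indicator_def chart_pt_def)
  finally show ?thesis .
qed

text \<open>Every point has a neighbourhood whose coordinate image lies in a closed ball within the
  chart range, where the continuous density is integrable; a compact set is covered by finitely many
  of these.\<close>

lemma vol_compact_finite:
  assumes "compact K" shows "emeasure vol K < \<infinity>"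
proof -
  have "\<exists>U. open U \<and> p \<in> U \<and> emeasure vol U < \<infinity>" for p
  proof -
    obtain c where c: "c \<in> A" "p \<in> fst c" using chart_at by blast
    obtain r where r: "r > 0" "cball (snd c p) r \<subseteq> chart_range c"
      using chart_range_open[OF chart[OF c(1)]] c(2) open_contains_cball by blast
    define U where "U = fst c \<inter> snd c -` ball (snd c p) r"
    have oU: "open U" unfolding U_def
      using continuous_open_preimage[OF chart_continuous[OF chart[OF c(1)]] chart_open[OF chart[OF c(1)]] open_ball] .
    have sU: "snd c ` U \<subseteq> cball (snd c p) r" by (auto simp: U_def)
    have "emeasure vol U = chart_mass c U" using emeasure_vol c oU by (auto simp: U_def)
    also have "\<dots> \<le> (\<integral>\<^sup>+x. ennreal (indicator (cball (snd c p) r) x * dens c x) \<partial>lborel)"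
      unfolding chart_mass_eq
    proof (intro nn_integral_mono ennreal_leI)
      fix x
      show "indicator (snd c ` U) x * dens c x \<le> indicator (cball (snd c p) r) x * dens c x"
      proof (cases "x \<in> cball (snd c p) r")
        case True
        then have "dens c x > 0" using r(2) dens_pos[OF c(1)] by blast
        then show ?thesis using True by (simp add: indicator_def)
      next
        case False
        then have "x \<notin> snd c ` U" using sU by blast
        with False show ?thesis by (metis indicator_simps(2) mult_zero_left order_refl)
      qed
    qed
    also have "\<dots> < \<infinity>"
    proof -
      have "integrable lborel (\<lambda>x. indicator (cball (snd c p) r) x *\<^sub>R dens c x)"
        by (rule borel_integrable_compact)
          (use continuous_on_subset[OF C1_on_continuous_on[OF dens_C1[OF c(1)]] r(2)] in auto)
      moreover have "indicator (cball (snd c p) r) x * dens c x \<ge> 0" for x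
        using r(2) dens_pos[OF c(1), of x] by (cases "x \<in> cball (snd c p) r") (auto simp: subset_iff)
      ultimately show ?thesis by (auto simp: integrable_iff_bounded)
    qed
    finally show ?thesis using oU c r by (intro exI[of _ U]) (auto simp: U_def)
  qed
  then have "\<forall>p. \<exists>U. open U \<and> p \<in> U \<and> emeasure vol U < \<infinity>" ..
  from choice[OF this] obtain U
    where U: "\<And>p. open (U p)" "\<And>p. p \<in> U p" "\<And>p. emeasure vol (U p) < \<infinity>" by blast
  have cov: "K \<subseteq> (\<Union>p\<in>K. U p)" using U(2) by blast
  obtain C where C: "C \<subseteq> K" "finite C" "K \<subseteq> (\<Union>p\<in>C. U p)"
    by (rule compactE_image[OF assms U(1) cov])
  have "emeasure vol K \<le> emeasure vol (\<Union>p\<in>C. U p)"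
    using C(3) U(1) by (intro emeasure_mono) (auto intro!: borel_open open_UN)
  also have "\<dots> \<le> (\<Sum>p\<in>C. emeasure vol (U p))"
    using C(2) U(1) by (intro emeasure_subadditive_finite) auto
  also have "\<dots> < \<infinity>" using U(3) C(2) by simp
  finally show ?thesis .
qed

lemma integrable_vol_compact:
  fixes F :: "'m \<Rightarrow> real"
  assumes "compact K" "continuous_on K F"
  shows "set_integrable vol K F"
proof -
  have "bounded (F ` K)" using assms compact_continuous_image compact_imp_bounded by blast
  then obtain C where C: "\<And>p. p \<in> K \<Longrightarrow> \<bar>F p\<bar> \<le> C" by (auto simp: bounded_iff)
  have Kb: "K \<in> sets borel" using assms(1) by (simp add: compact_imp_closed)
  show ?thesis unfolding set_integrable_def
  proof (rule integrableI_bounded_set[where A=K and B=C])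
    show "(\<lambda>x. indicator K x *\<^sub>R F x) \<in> borel_measurable vol"
      using borel_measurable_continuous_on_indicator[OF Kb assms(2)] by simp
  qed (use Kb vol_compact_finite[OF assms(1)] C in \<open>auto simp: indicator_def\<close>)
qed

end

text \<open>The rescaled measure has the mass prescribed by the second metric in every chart, and
  only one measure does.\<close>

lemma volume_scale:
  fixes A :: "('m::{t2_space, second_countable_topology}, 'n::finite) chart set"
    and f1 f2 :: "'m \<Rightarrow> real^'k::finite"
  assumes "immersed_manifold A f1" "immersed_manifold A f2" "r \<ge> 0"
    and dens: "\<And>c x. c \<in> A \<Longrightarrow> x \<in> chart_range c \<Longrightarrow>
      sqrt (det (induced_metric f2 c x)) = r * sqrt (det (induced_metric f1 c x))"
  shows "riemannian_volume A (induced_metric f2) = density (riemannian_volume A (induced_metric f1)) (\<lambda>_. ennreal r)"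
proof -
  interpret I1: immersed_manifold A f1 by fact
  interpret I2: immersed_manifold A f2 by fact
  have "I2.chart_mass c B = ennreal r * I1.chart_mass c B" if c: "c \<in> A" and B: "B \<in> sets borel" "B \<subseteq> fst c" for c B
  proof -
    have Sb: "snd c ` B \<in> sets borel" "snd c ` B \<subseteq> chart_range c"
      using chart_image_borel I1.chart c B by blast+
    have "I2.chart_mass c B = (\<integral>\<^sup>+x. ennreal r * ennreal (indicator (snd c ` B) x * I1.dens c x) \<partial>lborel)"
      unfolding I2.chart_mass_eq
    proof (intro nn_integral_cong)
      fix x
      show "ennreal (indicator (snd c ` B) x * I2.dens c x) = ennreal r * ennreal (indicator (snd c ` B) x * I1.dens c x)"
      proof (cases "x \<in> snd c ` B")
        case True
        then have "x \<in> chart_range c" using Sb(2) by blast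
        from dens[OF c this] I1.dens_pos[OF c this] True show ?thesis
          using ennreal_mult[OF assms(3), of "I1.dens c x"] by (simp only: indicator_simps mult_1 less_imp_le)
      qed simp
    qed
    also have "\<dots> = ennreal r * I1.chart_mass c B"
      unfolding I1.chart_mass_eq using I1.borel_measurable_dens[OF c Sb]
      by (intro nn_integral_cmult) auto
    finally show ?thesis .
  qed
  then have "I2.is_volume (density I1.vol (\<lambda>_. ennreal r))"
    by (auto simp: I2.is_volume_def I1.emeasure_vol emeasure_density_const)
  then show ?thesis using I2.volume_unique I2.vol by metis
qed

section \<open>The weak form of the torsion problem\<close>

context immersed_manifold
begin

definition C1_manifold :: "'m set \<Rightarrow> ('m \<Rightarrow> real) \<Rightarrow> bool" where
  "C1_manifold W \<psi> \<longleftrightarrow> (\<forall>c\<in>A. C1_on (snd c ` (fst c \<inter> W)) (local_rep c \<psi>))"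

lemma open_chart_image: "c \<in> A \<Longrightarrow> open W \<Longrightarrow> open (snd c ` (fst c \<inter> W))"
  using chart_image_open chart by blast

lemma C1_manifold_differentiable:
  "C1_manifold W \<psi> \<Longrightarrow> c \<in> A \<Longrightarrow> p \<in> fst c \<Longrightarrow> p \<in> W \<Longrightarrow> local_rep c \<psi> differentiable (at (snd c p))"
  unfolding C1_manifold_def using C1_on_differentiable by blast

lemma C1_manifold_subset: "C1_manifold W \<psi> \<Longrightarrow> V \<subseteq> W \<Longrightarrow> C1_manifold V \<psi>"
  unfolding C1_manifold_def by (meson C1_on_subset Int_mono image_mono order_refl)

lemma C1_manifold_cong:
  assumes "open W" "C1_manifold W \<psi>" "\<And>p. p \<in> W \<Longrightarrow> \<psi> p = \<zeta> p"
  shows "C1_manifold W \<zeta>"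
  unfolding C1_manifold_def
proof
  fix c assume c: "c \<in> A"
  have "C1_on (snd c ` (fst c \<inter> W)) (local_rep c \<psi>)" using assms(2) c by (simp add: C1_manifold_def)
  then show "C1_on (snd c ` (fst c \<inter> W)) (local_rep c \<zeta>)"
    by (rule C1_on_cong[OF open_chart_image[OF c assms(1)]])
      (auto simp: chart_local_rep[OF chart[OF c]] assms(3))
qed

lemma C1_manifold_Un:
  assumes "C1_manifold V \<psi>" "C1_manifold W \<psi>" "open V" "open W"
  shows "C1_manifold (V \<union> W) \<psi>"
  unfolding C1_manifold_def
proof
  fix c assume c: "c \<in> A"
  have "snd c ` (fst c \<inter> (V \<union> W)) = snd c ` (fst c \<inter> V) \<union> snd c ` (fst c \<inter> W)" by blast
  then show "C1_on (snd c ` (fst c \<inter> (V \<union> W))) (local_rep c \<psi>)"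
    using assms c by (simp add: C1_manifold_def C1_on_Un open_chart_image)
qed

lemma C1_manifold_const: "C1_manifold W (\<lambda>_. r)"
  by (simp add: C1_manifold_def local_rep_def[abs_def])

lemma C1_manifold_mult: "C1_manifold W \<psi> \<Longrightarrow> C1_manifold W \<zeta> \<Longrightarrow> C1_manifold W (\<lambda>p. \<psi> p * \<zeta> p)"
  by (simp add: C1_manifold_def local_rep_def[abs_def] C1_on_mult)

lemma C1_manifold_sum: "(\<And>i. i \<in> I \<Longrightarrow> C1_manifold W (\<psi> i)) \<Longrightarrow> C1_manifold W (\<lambda>p. \<Sum>i\<in>I. \<psi> i p)"
  by (simp add: C1_manifold_def local_rep_def[abs_def] C1_on_sum)

lemma C1_manifold_divide:
  assumes "C1_manifold W \<psi>" "C1_manifold W \<zeta>" "\<And>p. p \<in> W \<Longrightarrow> \<zeta> p \<noteq> 0"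
  shows "C1_manifold W (\<lambda>p. \<psi> p / \<zeta> p)"
  unfolding C1_manifold_def
proof
  fix c assume c: "c \<in> A"
  have "C1_on (snd c ` (fst c \<inter> W)) (\<lambda>x. local_rep c \<psi> x / local_rep c \<zeta> x)"
    by (rule C1_on_divide)
      (use assms c in \<open>auto simp: C1_manifold_def chart_local_rep[OF chart[OF c]]\<close>)
  then show "C1_on (snd c ` (fst c \<inter> W)) (local_rep c (\<lambda>p. \<psi> p / \<zeta> p))"
    by (simp add: local_rep_def[abs_def])
qed

lemma C1_manifold_compose:
  assumes "C1_on UNIV h" "C1_manifold W \<psi>"
  shows "C1_manifold W (\<lambda>p. h (\<psi> p))"
  using assms(2) C1_on_compose[OF assms(1)] unfolding C1_manifold_def local_rep_def[abs_def] by blast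

lemma C1_manifold_continuous:
  assumes "C1_manifold W \<psi>" "open W" shows "continuous_on W \<psi>"
proof (rule continuous_at_imp_continuous_on, rule ballI)
  fix p assume p: "p \<in> W"
  obtain c where c: "c \<in> A" "p \<in> fst c" using chart_at by blast
  have 1: "continuous_on (snd c ` (fst c \<inter> W)) (local_rep c \<psi>)"
    using assms(1) c(1) C1_on_continuous_on by (auto simp: C1_manifold_def)
  have 2: "continuous_on (fst c \<inter> W) (snd c)"
    using chart_continuous[OF chart[OF c(1)]] continuous_on_subset by blast
  have "continuous_on (fst c \<inter> W) (\<lambda>q. local_rep c \<psi> (snd c q))"
    by (rule continuous_on_compose2[OF 1 2 order_refl])
  then have "continuous_on (fst c \<inter> W) \<psi>"
    by (rule continuous_on_eq) (simp add: chart_local_rep[OF chart[OF c(1)]])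
  moreover have "open (fst c \<inter> W)" using chart_open[OF chart[OF c(1)]] assms(2) by blast
  ultimately show "isCont \<psi> p" using c(2) p by (simp add: continuous_on_eq_continuous_at)
qed

lemma dvec_continuous:
  assumes "C1_manifold W \<psi>" "c \<in> A"
  shows "continuous_on (snd c ` (fst c \<inter> W)) (dvec c \<psi>)"
  unfolding dvec_def[abs_def]
  using assms C1_on_partial_deriv by (intro continuous_on_vec_lambda) (auto simp: C1_manifold_def)

section \<open>The inverse metric\<close>

lemma inner_inv_g:
  assumes "c \<in> A" "x \<in> chart_range c"
  shows "v \<bullet> (matrix_inv (g c x) *v w) = (matrix_inv (g c x) *v v) \<bullet> (g c x *v (matrix_inv (g c x) *v w))"
proof -
  have "v \<bullet> (matrix_inv (g c x) *v w) = (g c x *v (matrix_inv (g c x) *v v)) \<bullet> (matrix_inv (g c x) *v w)"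
    by (simp only: g_inv(1)[OF assms])
  then show ?thesis by (simp only: inner_commute g_sym)
qed

lemma inv_g_sym:
  assumes "c \<in> A" "x \<in> chart_range c"
  shows "v \<bullet> (matrix_inv (g c x) *v w) = w \<bullet> (matrix_inv (g c x) *v v)"
  by (simp only: inner_inv_g[OF assms, of v w] inner_inv_g[OF assms, of w v] g_sym)

lemma inv_g_nonneg: "c \<in> A \<Longrightarrow> x \<in> chart_range c \<Longrightarrow> v \<bullet> (matrix_inv (g c x) *v v) \<ge> 0"
  by (simp only: inner_inv_g g_nonneg)

text \<open>Cramer's rule displays the inverse metric as a quotient of polynomials in the entries of
  the metric, from which its C^1 dependence on the point follows.\<close>

lemma inv_g_column:
  assumes "c \<in> A" "x \<in> chart_range c"
  shows "(matrix_inv (g c x) *v v) $ k = det (\<chi> i j. if j = k then v $ i else g c x $ i $ j) / det (g c x)"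
proof -
  have "det (g c x) \<noteq> 0" using det_g_pos[OF assms] by simp
  from cramer[OF this, of "matrix_inv (g c x) *v v" v] show ?thesis
    using g_inv(1)[OF assms] by simp
qed

lemma inv_g_C1:
  assumes "c \<in> A" "S \<subseteq> chart_range c" "\<And>i. C1_on S (\<lambda>x. v x $ i)"
  shows "C1_on S (\<lambda>x. (matrix_inv (g c x) *v v x) $ k)"
proof -
  have *: "C1_on S (\<lambda>x. det (\<chi> i j. if j = k then v x $ i else g c x $ i $ j) / det (g c x))"
  proof (intro C1_on_divide C1_on_det)
    show "C1_on S (\<lambda>x. (\<chi> i j. if j = k then v x $ i else g c x $ i $ j) $ i $ j)" for i j
      using assms(3) C1_on_subset[OF g_C1[OF assms(1)] assms(2)] by (cases "j = k") auto
    show "C1_on S (\<lambda>x. g c x $ i $ j)" for i j using C1_on_subset[OF g_C1[OF assms(1)] assms(2)] .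
    show "det (g c x) \<noteq> 0" if "x \<in> S" for x using det_g_pos[OF assms(1)] that assms(2) by (metis less_irrefl subsetD)
  qed
  show ?thesis
    by (rule C1_on_cong_superset[OF * chart_range_open[OF chart[OF assms(1)]] assms(2)])
      (simp add: inv_g_column[OF assms(1)])
qed

lemma inv_g_continuous:
  assumes "c \<in> A" "S \<subseteq> chart_range c" "continuous_on S v"
  shows "continuous_on S (\<lambda>x. matrix_inv (g c x) *v v x)"
proof -
  have e: "C1_on S (\<lambda>x. (matrix_inv (g c x) *v axis j 1) $ i)" for i j
    by (rule inv_g_C1[OF assms(1,2)]) auto
  have "continuous_on S (\<lambda>x. \<chi> i. \<Sum>j\<in>UNIV. (matrix_inv (g c x) *v axis j 1) $ i * v x $ j)"
    using assms(3) by (intro continuous_on_vec_lambda continuous_on_sum continuous_on_mult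
        C1_on_continuous_on[OF e] continuous_on_component)
  then show ?thesis
    by (simp add: matrix_vector_mult_basis column_def) (simp add: matrix_vector_mult_def)
qed

lemma gpair_continuous:
  assumes "C1_manifold W u" "C1_manifold W \<psi>" "open W"
  shows "continuous_on W (gpair u \<psi>)"
proof (rule continuous_at_imp_continuous_on, rule ballI)
  fix p assume p: "p \<in> W"
  obtain c where c: "c \<in> A" "p \<in> fst c" using chart_at by blast
  let ?S = "snd c ` (fst c \<inter> W)"
  have 1: "continuous_on ?S (gpair_chart c u \<psi>)"
    unfolding gpair_chart_def[abs_def]
    by (intro continuous_on_inner inv_g_continuous dvec_continuous assms c) auto
  have 2: "continuous_on (fst c \<inter> W) (snd c)"
    using chart_continuous[OF chart[OF c(1)]] continuous_on_subset by blast
  have "continuous_on (fst c \<inter> W) (\<lambda>q. gpair_chart c u \<psi> (snd c q))"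
    by (rule continuous_on_compose2[OF 1 2 order_refl])
  then have "continuous_on (fst c \<inter> W) (gpair u \<psi>)"
    by (rule continuous_on_eq)
      (use gpair_eq[OF c(1)] C1_manifold_differentiable assms c(1) in auto)
  moreover have "open (fst c \<inter> W)" using chart_open[OF chart[OF c(1)]] assms(3) by blast
  ultimately show "isCont (gpair u \<psi>) p" using c(2) p by (simp add: continuous_on_eq_continuous_at)
qed

lemma dvec_cong:
  assumes "open W" "c \<in> A" "p \<in> fst c" "p \<in> W" "\<And>q. q \<in> W \<Longrightarrow> \<psi> q = \<zeta> q"
  shows "dvec c \<psi> (snd c p) = dvec c \<zeta> (snd c p)"
proof -
  have "partial_deriv i (local_rep c \<psi>) (snd c p) = partial_deriv i (local_rep c \<zeta>) (snd c p)" for i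
    by (rule partial_deriv_cong[OF open_chart_image[OF assms(2,1)]])
      (use assms in \<open>auto simp: chart_local_rep[OF chart[OF assms(2)]]\<close>)
  then show ?thesis by (simp add: dvec_def)
qed

lemma gpair_cong:
  assumes "open W" "p \<in> W" "\<And>q. q \<in> W \<Longrightarrow> \<psi> q = \<zeta> q"
  shows "gpair u \<psi> p = gpair u \<zeta> p"
proof -
  have "\<exists>c. c \<in> A \<and> p \<in> fst c" using chart_at by blast
  from someI_ex[OF this] have "dvec (SOME c. c \<in> A \<and> p \<in> fst c) \<psi> (snd (SOME c. c \<in> A \<and> p \<in> fst c) p) =
    dvec (SOME c. c \<in> A \<and> p \<in> fst c) \<zeta> (snd (SOME c. c \<in> A \<and> p \<in> fst c) p)"
    by (intro dvec_cong[OF assms(1) _ _ assms(2)] assms(3)) auto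
  then show ?thesis by (simp add: gpair_def Let_def gpair_chart_def)
qed

lemma gpair_zero: "gpair u (\<lambda>_. 0) p = 0"
  by (simp add: gpair_def Let_def gpair_chart_def dvec_def local_rep_def[abs_def] partial_deriv_def zero_vec_def[symmetric])

lemma gpair_outside:
  assumes "closed K" "\<And>q. q \<notin> K \<Longrightarrow> \<psi> q = 0" "p \<notin> K"
  shows "gpair u \<psi> p = 0"
  using gpair_cong[of "-K" p \<psi> "\<lambda>_. 0" u] assms gpair_zero by (auto simp: open_Compl)

lemma integrable_vol_supp:
  fixes F :: "'m \<Rightarrow> real"
  assumes "continuous_on W F" "compact K" "K \<subseteq> W" "\<And>p. p \<notin> K \<Longrightarrow> F p = 0"
  shows "integrable vol F"
proof -
  have "set_integrable vol K F"
    by (rule integrable_vol_compact[OF assms(2) continuous_on_subset[OF assms(1,3)]])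
  moreover have "indicator K p *\<^sub>R F p = F p" for p using assms(4) by (cases "p \<in> K") auto
  ultimately show ?thesis unfolding set_integrable_def by (simp only:)
qed

context
  fixes \<Omega> u
  assumes \<Omega>: "open \<Omega>" and torsion: "torsion_function A g \<Omega> u"
begin

lemma torsion_C1: "C1_manifold \<Omega> u"
  unfolding C1_manifold_def
proof
  fix c assume c: "c \<in> A"
  have "C_k_on 2 (snd c ` (fst c \<inter> \<Omega>)) (local_rep c u)"
    using torsion c by (simp add: torsion_function_def)
  then show "C1_on (snd c ` (fst c \<inter> \<Omega>)) (local_rep c u)"
    by (rule C_k_on_2_C1[OF open_chart_image[OF c \<Omega>]])
qed

lemma flux_C1:
  assumes "c \<in> A"
  shows "C1_on (snd c ` (fst c \<inter> \<Omega>)) (\<lambda>x. dens c x * gradient g c u x $ i)"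
  unfolding gradient_def
proof (intro C1_on_mult inv_g_C1 assms)
  show "C1_on (snd c ` (fst c \<inter> \<Omega>)) (dens c)" by (rule C1_on_subset[OF dens_C1[OF assms]]) auto
  show "C1_on (snd c ` (fst c \<inter> \<Omega>)) (\<lambda>x. (\<chi> j. partial_deriv j (local_rep c u) x) $ i)" for i
    using torsion assms C_k_on_2_partial[OF open_chart_image[OF assms \<Omega>]]
    by (auto simp: torsion_function_def)
qed auto

text \<open>The equation with the density cleared from the denominator, in the form needed for
  integration over coordinate space.\<close>

lemma flux_divergence:
  assumes "c \<in> A" "p \<in> fst c" "p \<in> \<Omega>"
  shows "(\<Sum>i\<in>UNIV. partial_deriv i (\<lambda>x. dens c x * gradient g c u x $ i) (snd c p)) = - dens c (snd c p)"
proof -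
  have "laplace_beltrami g c u (snd c p) = -1" using torsion assms by (auto simp: torsion_function_def)
  moreover have "dens c (snd c p) > 0" using dens_pos assms by blast
  ultimately show ?thesis
    by (simp add: laplace_beltrami_def divergence_def divide_eq_eq split: if_splits)
qed

text \<open>The flux of \<open>u\<close> times \<open>\<psi>\<close>, extended by zero, is C^1 with
  compact support in coordinate space, so its divergence integrates to 0. By the product rule and
  the equation, this divergence is the density times \<open>gpair u \<psi> - \<psi>\<close>.\<close>

lemma weak_form_chart:
  assumes c: "c \<in> A" and \<psi>: "C1_manifold \<Omega> \<psi>" and K: "compact K" "K \<subseteq> fst c \<inter> \<Omega>" "\<And>p. p \<notin> K \<Longrightarrow> \<psi> p = 0"
  shows "(\<integral>p. gpair u \<psi> p \<partial>vol) = (\<integral>p. \<psi> p \<partial>vol)"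
proof -
  let ?S = "snd c ` (fst c \<inter> \<Omega>)" and ?L = "snd c ` K"
  let ?Y = "\<lambda>i x. dens c x * gradient g c u x $ i"
  have S: "open ?S" by (rule open_chart_image[OF c \<Omega>])
  have L: "compact ?L" "?L \<subseteq> ?S" using chart_image_compact[OF chart[OF c] K(1)] K(2) by auto
  have clK: "closed K" using K(1) compact_imp_closed by blast
  define F where "F i x = (if x \<in> ?L then local_rep c \<psi> x * ?Y i x else 0)" for i x
  have out: "local_rep c \<psi> x = 0" if "x \<in> ?S" "x \<notin> ?L" for x
    using that K(3) by (force simp: chart_local_rep[OF chart[OF c]])
  have FS: "F i x = local_rep c \<psi> x * ?Y i x" if "x \<in> ?S" for i x
    using out[OF that] by (simp add: F_def)
  have psiC: "C1_on ?S (local_rep c \<psi>)" using \<psi> c by (simp add: C1_manifold_def)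
  \<comment> \<open>Two open sets cover the space: on \<open>?S\<close> the function is a product of
    C^1 functions, off the compact \<open>?L\<close> it is zero, and the two descriptions agree on
    the overlap because \<open>\<psi>\<close> vanishes off \<open>K\<close>.\<close>
  have FC1: "C1_on UNIV (F i)" for i
  proof -
    have "C1_on ?S (F i)"
      by (rule C1_on_cong[OF S C1_on_mult[OF psiC flux_C1[OF c, of i]]]) (simp add: FS)
    moreover have "C1_on (-?L) (F i)"
      by (rule C1_on_cong[OF _ C1_on_const[of _ 0]]) (use L in \<open>auto simp: F_def compact_imp_closed open_Compl\<close>)
    ultimately have "C1_on (?S \<union> -?L) (F i)"
      using S L by (intro C1_on_Un) (auto simp: compact_imp_closed open_Compl)
    moreover have "?S \<union> -?L = UNIV" using L(2) by blast
    ultimately show ?thesis by simp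
  qed
  have F0: "F i x = 0" if "x \<notin> ?L" for i x using that by (simp add: F_def)
  have pF: "integrable lborel (partial_deriv i (F i))" "(\<integral>x. partial_deriv i (F i) x \<partial>lborel) = 0" for i
    unfolding partial_deriv_def[abs_def] using integral_derivative_zero[OF FC1 L(1) F0] by auto
  define G where "G p = gpair u \<psi> p - \<psi> p" for p
  have G0: "G p = 0" if "p \<notin> K" for p
    unfolding G_def using gpair_outside[OF clK K(3) that] K(3)[OF that] by simp
  have ig: "integrable vol (gpair u \<psi>)"
    by (rule integrable_vol_supp[OF gpair_continuous[OF torsion_C1 \<psi> \<Omega>] K(1)])
      (use K gpair_outside[OF clK K(3)] in auto)
  have ip: "integrable vol \<psi>"
    by (rule integrable_vol_supp[OF C1_manifold_continuous[OF \<psi> \<Omega>] K(1)]) (use K in auto)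
  have Gm: "G \<in> borel_measurable borel"
    using borel_measurable_integrable[OF Bochner_Integration.integrable_diff[OF ig ip]]
    unfolding G_def[abs_def] measurable_cong_sets[OF sets_vol refl] .
  have eq: "indicator (chart_range c) x * dens c x * G (chart_inv c x) = (\<Sum>i\<in>UNIV. partial_deriv i (F i) x)" for x
  proof (cases "x \<in> ?S")
    case True
    then obtain p where p: "p \<in> fst c" "p \<in> \<Omega>" "x = snd c p" by blast
    have dpsi: "local_rep c \<psi> differentiable (at x)" using C1_on_differentiable[OF psiC True] .
    have dY: "?Y i differentiable (at x)" for i using C1_on_differentiable[OF flux_C1[OF c] True] .
    have "partial_deriv i (F i) x = local_rep c \<psi> x * partial_deriv i (?Y i) x + partial_deriv i (local_rep c \<psi>) x * ?Y i x" for i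
      using partial_deriv_mult[OF dpsi dY[of i], where i=i] partial_deriv_cong[OF S True FS[where i=i], where i=i] by simp
    then have "(\<Sum>i\<in>UNIV. partial_deriv i (F i) x) =
        local_rep c \<psi> x * (\<Sum>i\<in>UNIV. partial_deriv i (?Y i) x) + (\<Sum>i\<in>UNIV. partial_deriv i (local_rep c \<psi>) x * ?Y i x)"
      by (simp add: sum.distrib sum_distrib_left)
    also have "(\<Sum>i\<in>UNIV. partial_deriv i (?Y i) x) = - dens c x"
      using flux_divergence[OF c p(1,2)] p(3) by simp
    also have "(\<Sum>i\<in>UNIV. partial_deriv i (local_rep c \<psi>) x * ?Y i x) = dens c x * gpair_chart c \<psi> u x"
      by (simp add: gpair_chart_def inner_vec_def dvec_def gradient_def sum_distrib_left mult_ac)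
    also have "gpair_chart c \<psi> u x = gpair_chart c u \<psi> x"
      unfolding gpair_chart_def using inv_g_sym[OF c, of x] p by blast
    also have "gpair_chart c u \<psi> x = gpair u \<psi> p"
      using gpair_eq[OF c p(1)] C1_manifold_differentiable[OF torsion_C1 c p(1,2)] dpsi p(3) by simp
    also have "local_rep c \<psi> x * - dens c x + dens c x * gpair u \<psi> p = dens c x * G p"
      by (simp add: G_def p(3) chart_local_rep[OF chart[OF c] p(1)] algebra_simps)
    finally show ?thesis using p chart_inv_chart[OF chart[OF c] p(1)] by simp
  next
    case False
    then have xL: "x \<notin> ?L" using L(2) by blast
    have "partial_deriv i (F i) x = partial_deriv i (\<lambda>_. 0 :: real) x" for i
      by (rule partial_deriv_cong[of "-?L"]) (use xL L(1) F0 in \<open>auto simp: compact_imp_closed open_Compl\<close>)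
    then have "partial_deriv i (F i) x = 0" for i by (simp add: partial_deriv_def)
    moreover have "G (chart_inv c x) = 0" if "x \<in> chart_range c"
    proof (rule G0)
      show "chart_inv c x \<notin> K" using xL chart_chart_inv[OF chart[OF c] that] by (metis image_eqI)
    qed
    ultimately show ?thesis by (auto simp: indicator_def)
  qed
  have "(\<integral>p. G p \<partial>vol) = (\<integral>x. indicator (chart_range c) x * dens c x * G (chart_inv c x) \<partial>lborel)"
    by (rule integral_vol_chart[OF c Gm]) (use G0 K(2) in blast)
  also have "\<dots> = (\<Sum>i\<in>UNIV. \<integral>x. partial_deriv i (F i) x \<partial>lborel)"
    unfolding eq using pF(1) by (intro Bochner_Integration.integral_sum)
  also have "\<dots> = 0" using pF(2) by simp
  finally show ?thesis using ig ip by (simp add: G_def)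
qed

end

text \<open>The bump is \<open>(r\<^sup>2 - |x - x\<^sub>0|\<^sup>2)\<^sub>+\<^sup>2\<close> in a chart around \<open>p\<close>.\<close>

lemma bump_exists:
  assumes "open W" "p \<in> W"
  shows "\<exists>b c L. c \<in> A \<and> compact L \<and> L \<subseteq> fst c \<inter> W \<and> C1_manifold UNIV b \<and> b p > 0 \<and> (\<forall>q. b q \<ge> 0) \<and>
    (\<forall>q. q \<notin> L \<longrightarrow> b q = 0)"
proof -
  obtain c where c: "c \<in> A" "p \<in> fst c" using chart_at by blast
  obtain r where r: "r > 0" "cball (snd c p) r \<subseteq> snd c ` (fst c \<inter> W)"
    using open_chart_image[OF c(1) assms(1)] c(2) assms(2) open_contains_cball by blast
  define L where "L = chart_inv c ` cball (snd c p) r"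
  define bx where "bx x = pos_sq (r\<^sup>2 - (x - snd c p) \<bullet> (x - snd c p))" for x
  define b where "b q = (if q \<in> fst c then bx (snd c q) else 0)" for q
  have L: "compact L"
    unfolding L_def by (rule chart_inv_image_compact[OF chart[OF c(1)] compact_cball]) (use r(2) in blast)
  have LW: "L \<subseteq> fst c \<inter> W"
  proof
    fix q assume "q \<in> L"
    then obtain x where x: "x \<in> cball (snd c p) r" "q = chart_inv c x" by (auto simp: L_def)
    then obtain q' where "q' \<in> fst c \<inter> W" "x = snd c q'" using r(2) by blast
    then show "q \<in> fst c \<inter> W" using x chart_inv_chart[OF chart[OF c(1)]] by simp
  qed
  have b0: "b q = 0" if "q \<notin> L" for q
  proof (cases "q \<in> fst c")
    case True
    have "snd c q \<notin> cball (snd c p) r"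
      using that chart_inv_chart[OF chart[OF c(1)] True] unfolding L_def by (metis image_eqI)
    then have "norm (snd c q - snd c p) > r" by (simp add: dist_norm norm_minus_commute)
    then have "r\<^sup>2 - (snd c q - snd c p) \<bullet> (snd c q - snd c p) \<le> 0"
      using r(1) by (simp add: power2_norm_eq_inner[symmetric])
    then show ?thesis using True by (simp add: b_def bx_def pos_sq_def)
  qed (simp add: b_def)
  have bxC: "C1_on S bx" for S
    unfolding bx_def[abs_def]
    by (rule C1_on_compose[OF pos_sq_C1]) (auto intro!: C1_on_diff C1_on_inner)
  have "C1_manifold UNIV b"
    unfolding C1_manifold_def
  proof
    fix d assume d: "d \<in> A"
    have oc: "open (snd c ` (fst c \<inter> UNIV))" by (rule open_chart_image[OF c(1) open_UNIV])
    have "C1_on (snd c ` (fst c \<inter> UNIV)) (local_rep c b)"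
      by (rule C1_on_cong[OF oc bxC]) (auto simp: chart_local_rep[OF chart[OF c(1)]] b_def)
    from C1_on_change_chart[OF d c(1) this open_UNIV]
    have "C1_on (snd d ` (fst d \<inter> fst c)) (local_rep d b)" by simp
    moreover have "C1_on (snd d ` (fst d \<inter> - L)) (local_rep d b)"
      by (rule C1_on_cong[OF _ C1_on_const[of _ 0]])
        (use L b0 open_chart_image[OF d] in \<open>auto simp: chart_local_rep[OF chart[OF d]] compact_imp_closed open_Compl\<close>)
    ultimately have "C1_on (snd d ` (fst d \<inter> fst c) \<union> snd d ` (fst d \<inter> - L)) (local_rep d b)"
      using L open_chart_image[OF d] chart_open[OF chart[OF c(1)]]
      by (intro C1_on_Un) (auto simp: compact_imp_closed open_Compl)
    moreover have "snd d ` (fst d \<inter> UNIV) \<subseteq> snd d ` (fst d \<inter> fst c) \<union> snd d ` (fst d \<inter> - L)"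
      using LW by blast
    ultimately show "C1_on (snd d ` (fst d \<inter> UNIV)) (local_rep d b)" using C1_on_subset by blast
  qed
  moreover have "b p > 0" using c(2) r(1) by (simp add: b_def bx_def pos_sq_def)
  moreover have "b q \<ge> 0" for q by (simp add: b_def bx_def pos_sq_def)
  ultimately show ?thesis using c(1) L LW b0 by blast
qed

lemma gpair_sum:
  assumes "C1_manifold W u" "\<And>i. i \<in> I \<Longrightarrow> C1_manifold W (\<psi> i)" "p \<in> W"
  shows "gpair u (\<lambda>q. \<Sum>i\<in>I. \<psi> i q) p = (\<Sum>i\<in>I. gpair u (\<psi> i) p)"
proof -
  obtain c where c: "c \<in> A" "p \<in> fst c" using chart_at by blast
  note d = C1_manifold_differentiable[OF _ c assms(3)]
  have "dvec c (\<lambda>q. \<Sum>i\<in>I. \<psi> i q) (snd c p) = (\<Sum>i\<in>I. dvec c (\<psi> i) (snd c p))"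
    using partial_deriv_sum[of I "\<lambda>i. local_rep c (\<psi> i)" "snd c p"] d[OF assms(2)]
    by (simp add: dvec_def vec_eq_iff local_rep_def[abs_def])
  then have "gpair_chart c u (\<lambda>q. \<Sum>i\<in>I. \<psi> i q) (snd c p) = (\<Sum>i\<in>I. gpair_chart c u (\<psi> i) (snd c p))"
    by (simp add: gpair_chart_def linear_sum[OF matrix_vector_mul_linear] inner_sum_right)
  then show ?thesis
    using gpair_eq[OF c d[OF assms(1)] d] C1_manifold_sum[of I W \<psi>] assms(2) by simp
qed

text \<open>A partition of unity reduces the claim to test functions supported in one chart. The
  bumps \<open>b p\<close> are divided by their sum \<open>s\<close>, which is known to be positive
  only on \<open>K\<close>; the factor \<open>\<psi>\<close>, which vanishes off \<open>K\<close>,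
  makes the pieces C^1 on all of \<Omega>.\<close>

lemma weak_form:
  assumes \<Omega>: "open \<Omega>" and torsion: "torsion_function A g \<Omega> u"
    and \<psi>: "C1_manifold \<Omega> \<psi>" and K: "compact K" "K \<subseteq> \<Omega>" "\<And>p. p \<notin> K \<Longrightarrow> \<psi> p = 0"
  shows "integrable vol (gpair u \<psi>)" "integrable vol \<psi>" "(\<integral>p. gpair u \<psi> p \<partial>vol) = (\<integral>p. \<psi> p \<partial>vol)"
proof -
  have clK: "closed K" using K(1) compact_imp_closed by blast
  note uC = torsion_C1[OF \<Omega> torsion]
  have ig: "integrable vol (gpair u \<zeta>)" if "C1_manifold \<Omega> \<zeta>" "\<And>p. p \<notin> K \<Longrightarrow> \<zeta> p = 0" for \<zeta>
    by (rule integrable_vol_supp[OF gpair_continuous[OF uC that(1) \<Omega>] K(1)])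
      (use K gpair_outside[OF clK that(2)] in auto)
  have ip: "integrable vol \<zeta>" if "C1_manifold \<Omega> \<zeta>" "\<And>p. p \<notin> K \<Longrightarrow> \<zeta> p = 0" for \<zeta>
    by (rule integrable_vol_supp[OF C1_manifold_continuous[OF that(1) \<Omega>] K(1)]) (use K that(2) in auto)
  show "integrable vol (gpair u \<psi>)" "integrable vol \<psi>" using ig ip \<psi> K(3) by auto
  have "\<forall>p\<in>K. \<exists>b c L. c \<in> A \<and> compact L \<and> L \<subseteq> fst c \<inter> \<Omega> \<and> C1_manifold UNIV b \<and> b p > 0 \<and> (\<forall>q. b q \<ge> 0) \<and>
    (\<forall>q. q \<notin> L \<longrightarrow> b q = 0)" using bump_exists[OF \<Omega>] K(2) by blast
  then obtain b c L where b: "\<forall>p\<in>K. c p \<in> A \<and> compact (L p) \<and> L p \<subseteq> fst (c p) \<inter> \<Omega> \<and> C1_manifold UNIV (b p) \<and>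
    b p p > 0 \<and> (\<forall>q. b p q \<ge> 0) \<and> (\<forall>q. q \<notin> L p \<longrightarrow> b p q = 0)" unfolding bchoice_iff by blast
  have bcont: "continuous_on UNIV (b p)" if "p \<in> K" for p
    using C1_manifold_continuous[of UNIV "b p"] b that by auto
  have bo: "open {q. b p q > 0}" if "p \<in> K" for p
    using open_Collect_less[OF continuous_on_const bcont[OF that], of 0] by simp
  have cov: "K \<subseteq> (\<Union>p\<in>K. {q. b p q > 0})" using b by blast
  obtain C where C: "C \<subseteq> K" "finite C" "K \<subseteq> (\<Union>p\<in>C. {q. b p q > 0})"
    by (rule compactE_image[OF K(1) bo cov])
  define s where "s q = (\<Sum>p\<in>C. b p q)" for q
  have sC: "C1_manifold UNIV s" unfolding s_def[abs_def] using b C(1) by (intro C1_manifold_sum) blast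
  have sK: "s q > 0" if qK: "q \<in> K" for q
  proof -
    obtain p where p: "p \<in> C" "b p q > 0" using C(3) qK by blast
    have "b p q \<ge> 0" if "p \<in> C" for p using b C(1) that by blast
    then show ?thesis unfolding s_def using C(2) p by (intro sum_pos2[of C p])
  qed
  define \<psi>' where "\<psi>' p q = \<psi> q * b p q / s q" for p q
  have os: "open {q. s q > 0}"
    using open_Collect_less[OF continuous_on_const C1_manifold_continuous[OF sC open_UNIV], of 0] by simp
  have \<psi>'C: "C1_manifold \<Omega> (\<psi>' p)" if "p \<in> C" for p
  proof -
    have 1: "C1_manifold (\<Omega> \<inter> {q. s q > 0}) (\<psi>' p)"
      unfolding \<psi>'_def[abs_def]
      using \<psi> b sC C(1) that by (intro C1_manifold_divide C1_manifold_mult) (auto intro: C1_manifold_subset)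
    have 2: "C1_manifold (\<Omega> \<inter> -K) (\<psi>' p)"
      by (rule C1_manifold_cong[OF _ C1_manifold_const[of _ 0]])
        (use \<Omega> clK K(3) in \<open>auto simp: \<psi>'_def open_Compl\<close>)
    have "C1_manifold (\<Omega> \<inter> {q. s q > 0} \<union> \<Omega> \<inter> -K) (\<psi>' p)"
      using \<Omega> clK os by (intro C1_manifold_Un 1 2) (auto simp: open_Compl)
    moreover have "\<Omega> \<inter> {q. s q > 0} \<union> \<Omega> \<inter> -K = \<Omega>" using sK by blast
    ultimately show ?thesis by simp
  qed
  have \<psi>'0: "\<psi>' p q = 0" if "q \<notin> K" for p q using K(3)[OF that] by (simp add: \<psi>'_def)
  have sum: "\<psi> = (\<lambda>q. \<Sum>p\<in>C. \<psi>' p q)"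
  proof
    fix q
    have "(\<Sum>p\<in>C. \<psi>' p q) = \<psi> q * s q / s q"
      by (simp add: \<psi>'_def s_def sum_distrib_left sum_divide_distrib)
    then show "\<psi> q = (\<Sum>p\<in>C. \<psi>' p q)" using sK[of q] K(3)[of q] by (cases "q \<in> K") auto
  qed
  have w: "(\<integral>q. gpair u (\<psi>' p) q \<partial>vol) = (\<integral>q. \<psi>' p q \<partial>vol)" if "p \<in> C" for p
  proof (rule weak_form_chart[OF \<Omega> torsion _ \<psi>'C[OF that]])
    have bp: "c p \<in> A" "compact (L p)" "L p \<subseteq> fst (c p) \<inter> \<Omega>" "\<And>q. q \<notin> L p \<Longrightarrow> b p q = 0"
      using b C(1) that by blast+
    show "c p \<in> A" "L p \<subseteq> fst (c p) \<inter> \<Omega>" "compact (L p)" by fact+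
    show "\<psi>' p q = 0" if "q \<notin> L p" for q using bp(4)[OF that] by (simp add: \<psi>'_def)
  qed
  have gs: "gpair u \<psi> q = (\<Sum>p\<in>C. gpair u (\<psi>' p) q)" for q
  proof (cases "q \<in> \<Omega>")
    case True
    show ?thesis by (subst sum) (rule gpair_sum[OF uC \<psi>'C True])
  next
    case False
    then have "q \<notin> K" using K(2) by blast
    then show ?thesis
      using gpair_outside[OF clK K(3) \<open>q \<notin> K\<close>] gpair_outside[OF clK \<psi>'0 \<open>q \<notin> K\<close>] by simp
  qed
  have "(\<integral>p. gpair u \<psi> p \<partial>vol) = (\<Sum>p\<in>C. \<integral>q. gpair u (\<psi>' p) q \<partial>vol)"
    unfolding gs using ig \<psi>'C \<psi>'0 by (intro Bochner_Integration.integral_sum) auto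
  also have "\<dots> = (\<Sum>p\<in>C. \<integral>q. \<psi>' p q \<partial>vol)" using w by simp
  also have "\<dots> = (\<integral>q. (\<Sum>p\<in>C. \<psi>' p q) \<partial>vol)"
    using ip \<psi>'C \<psi>'0 by (intro Bochner_Integration.integral_sum[symmetric]) auto
  finally show "(\<integral>p. gpair u \<psi> p \<partial>vol) = (\<integral>p. \<psi> p \<partial>vol)" unfolding sum[symmetric] .
qed

end

section \<open>Positivity of the torsion function\<close>

text \<open>The second derivative test along the line \<open>l\<close>. The first derivative
  \<open>h'\<close> vanishes at 0; if its derivative \<open>H\<close> were negative,
  \<open>h'\<close> would be negative just after 0, and the mean value theorem would give a value of
  \<open>w\<close> below the minimum.\<close>

lemma hessian_nonneg_at_min:
  fixes w :: "real^'n \<Rightarrow> real"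
  assumes S: "open S" "x \<in> S" and w: "C_k_on 2 S w" and min: "\<And>y. y \<in> S \<Longrightarrow> w x \<le> w y"
  shows "partial_deriv i w x = 0"
    and "(\<Sum>i\<in>UNIV. \<Sum>j\<in>UNIV. v $ i * v $ j * partial_deriv i (partial_deriv j w) x) \<ge> 0"
proof -
  have wC: "C1_on S w" by (rule C_k_on_2_C1[OF S(1) w])
  have pC: "C1_on S (partial_deriv j w)" for j by (rule C_k_on_2_partial[OF S(1) w])
  have grad0: "frechet_derivative w (at x) = (\<lambda>v. 0)"
    by (rule differential_zero_maxmin[OF S(2,1) C1_on_has_derivative[OF wC S(2)]]) (use min in auto)
  show p0: "partial_deriv i w x = 0" for i using grad0 by (simp add: partial_deriv_def)
  define l where "l s = x + s *\<^sub>R v" for s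
  have ld: "(l has_derivative (\<lambda>r. r *\<^sub>R v)) (at s)" for s
    unfolding l_def[abs_def] by (auto intro!: derivative_eq_intros)
  define h' where "h' s = (\<Sum>j\<in>UNIV. v $ j * partial_deriv j w (l s))" for s
  have dw: "((\<lambda>s. k (l s)) has_real_derivative (\<Sum>j\<in>UNIV. v $ j * partial_deriv j k (l s))) (at s)"
    if "C1_on S k" "l s \<in> S" for k :: "real^'n \<Rightarrow> real" and s
  proof -
    have kd: "k differentiable (at (l s))" by (rule C1_on_differentiable[OF that])
    have "(k has_derivative frechet_derivative k (at (l s))) (at (l s))"
      by (rule C1_on_has_derivative[OF that])
    from diff_chain_at[OF ld this]
    have "((\<lambda>s. k (l s)) has_derivative (\<lambda>r. frechet_derivative k (at (l s)) (r *\<^sub>R v))) (at s)"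
      by (simp add: o_def)
    then show ?thesis
      unfolding has_field_derivative_def
      by (rule has_derivative_eq_rhs)
        (simp add: frechet_partial[OF kd] fun_eq_iff sum_distrib_left mult_ac)
  qed
  define H where "H = (\<Sum>j\<in>UNIV. v $ j * (\<Sum>i\<in>UNIV. v $ i * partial_deriv i (partial_deriv j w) x))"
  have l0: "l 0 = x" by (simp add: l_def)
  have h'd: "(h' has_real_derivative H) (at 0)"
    unfolding h'_def[abs_def] H_def
    using dw[OF pC, of 0] S(2) l0 by (intro DERIV_sum DERIV_cmult) simp
  have "H \<ge> 0"
  proof (rule ccontr)
    assume "\<not> H \<ge> 0"
    then have "H < 0" by simp
    from DERIV_neg_dec_right[OF h'd this] obtain d where d: "d > 0" "\<And>s. 0 < s \<Longrightarrow> s < d \<Longrightarrow> h' s < h' 0" by auto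
    have "h' 0 = 0" using p0 by (simp add: h'_def l0)
    have "continuous_on UNIV l" unfolding l_def[abs_def] by (intro continuous_intros)
    then have "open (l -` S)" using S(1) by (simp add: open_vimage)
    moreover have "0 \<in> l -` S" using S(2) l0 by simp
    ultimately obtain e where e: "e > 0" "ball 0 e \<subseteq> l -` S" using openE by blast
    define s where "s = min d e / 2"
    have s: "0 < s" "s < d" "s < e" using d(1) e(1) by (auto simp: s_def)
    have lS: "l r \<in> S" if "0 \<le> r" "r \<le> s" for r using e(2) that s(3) by (auto simp: subset_iff)
    have "\<exists>z>0. z < s \<and> w (l s) - w (l 0) = (s - 0) * h' z"
      using MVT2[OF s(1), of "\<lambda>s. w (l s)" h'] dw[OF wC lS] unfolding h'_def by blast
    then obtain z where z: "0 < z" "z < s" "w (l s) - w x = s * h' z" using l0 by auto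
    have "h' z < 0" using d(2)[of z] z s \<open>h' 0 = 0\<close> by simp
    then have "w (l s) < w x" using z(3) s(1) by (smt (verit) mult_pos_neg)
    then show False using min[OF lS[of s]] s(1) by simp
  qed
  also have "H = (\<Sum>i\<in>UNIV. \<Sum>j\<in>UNIV. v $ i * v $ j * partial_deriv i (partial_deriv j w) x)"
    unfolding H_def by (subst sum.swap) (simp add: sum_distrib_left mult_ac)
  finally show "(\<Sum>i\<in>UNIV. \<Sum>j\<in>UNIV. v $ i * v $ j * partial_deriv i (partial_deriv j w) x) \<ge> 0" .
qed

context immersed_manifold
begin

text \<open>With \<open>B = J g^{-1}\<close> one has
  \<open>B^T B = g^{-1} J^T J g^{-1} = g^{-1}\<close>. The rows of \<open>B\<close> act like an
  orthonormal frame: the trace of a form against the inverse metric is the sum of its values on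
  these rows.\<close>

lemma inv_g_gram:
  assumes "c \<in> A" "x \<in> chart_range c"
  shows "matrix_inv (g c x) $ i $ j =
    (\<Sum>k\<in>UNIV. (jac c x ** matrix_inv (g c x)) $ k $ i * (jac c x ** matrix_inv (g c x)) $ k $ j)"
proof -
  let ?a = "matrix_inv (g c x)"
  have col: "(jac c x *v (?a *v axis j 1)) $ k = (jac c x ** ?a) $ k $ j" for j k
    by (simp add: matrix_vector_mult_basis column_def)
      (simp add: matrix_vector_mult_def matrix_matrix_mult_def)
  have "?a $ i $ j = axis i 1 \<bullet> (?a *v axis j 1)"
    by (simp add: inner_axis' matrix_vector_mult_basis column_def)
  also have "\<dots> = (jac c x *v (?a *v axis i 1)) \<bullet> (jac c x *v (?a *v axis j 1))"
    by (simp only: inner_inv_g[OF assms] inner_g)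
  finally show ?thesis by (simp only: inner_vec_def col inner_real_def)
qed

lemma inv_g_trace_nonneg:
  assumes "c \<in> A" "x \<in> chart_range c" "\<And>v. (\<Sum>i\<in>UNIV. \<Sum>j\<in>UNIV. v $ i * v $ j * H i j) \<ge> 0"
  shows "(\<Sum>i\<in>UNIV. \<Sum>j\<in>UNIV. matrix_inv (g c x) $ i $ j * H i j) \<ge> 0"
proof -
  let ?B = "jac c x ** matrix_inv (g c x)"
  have "(\<Sum>i\<in>UNIV. \<Sum>j\<in>UNIV. matrix_inv (g c x) $ i $ j * H i j) =
      (\<Sum>i\<in>UNIV. \<Sum>j\<in>UNIV. \<Sum>k\<in>UNIV. ?B $ k $ i * ?B $ k $ j * H i j)"
    unfolding inv_g_gram[OF assms(1,2)] by (simp add: sum_distrib_right)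
  also have "\<dots> = (\<Sum>i\<in>UNIV. \<Sum>k\<in>UNIV. \<Sum>j\<in>UNIV. ?B $ k $ i * ?B $ k $ j * H i j)"
    by (intro sum.cong refl sum.swap)
  also have "\<dots> = (\<Sum>k\<in>UNIV. \<Sum>i\<in>UNIV. \<Sum>j\<in>UNIV. ?B $ k $ i * ?B $ k $ j * H i j)"
    by (rule sum.swap)
  also have "\<dots> \<ge> 0"
    by (rule sum_nonneg) (rule assms(3)[of "?B $ k" for k])
  finally show ?thesis .
qed

text \<open>The minimum principle: at an interior minimum the first derivatives vanish, so only the
  trace of the Hessian against the inverse metric is left of the Laplacian. It is nonnegative,
  whereas the equation says -1.\<close>

lemma torsion_not_min:
  assumes \<Omega>: "open \<Omega>" and torsion: "torsion_function A g \<Omega> u" and q: "q \<in> \<Omega>"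
    and min: "\<And>z. z \<in> \<Omega> \<Longrightarrow> u q \<le> u z"
  shows False
proof -
  obtain c where c: "c \<in> A" "q \<in> fst c" using chart_at by blast
  let ?S = "snd c ` (fst c \<inter> \<Omega>)" and ?x = "snd c q" and ?w = "local_rep c u"
  have S: "open ?S" "?x \<in> ?S" using open_chart_image[OF c(1) \<Omega>] c(2) q by auto
  have w: "C_k_on 2 ?S ?w" using torsion c by (simp add: torsion_function_def)
  have mn: "?w ?x \<le> ?w y" if "y \<in> ?S" for y
    using that min c(2) by (auto simp: chart_local_rep[OF chart[OF c(1)]])
  note hess = hessian_nonneg_at_min[OF S w mn]
  have xr: "?x \<in> chart_range c" using c(2) by blast
  \<comment> \<open>The coefficients of the divergence form. In the product rule, the terms that
    differentiate \<open>P\<close> carry a first derivative of \<open>u\<close> and drop out at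
    \<open>q\<close>.\<close>
  define P where "P i j x = dens c x * (matrix_inv (g c x) *v axis j 1) $ i" for i j x
  have Pd: "P i j differentiable (at ?x)" for i j
  proof -
    have "C1_on ?S (P i j)"
      unfolding P_def[abs_def]
      by (intro C1_on_mult inv_g_C1 C1_on_subset[OF dens_C1] c) auto
    then show ?thesis using C1_on_differentiable S(2) by blast
  qed
  have wd: "partial_deriv j ?w differentiable (at ?x)" for j
    using C1_on_differentiable[OF C_k_on_2_partial[OF S(1) w] S(2)] .
  have Y: "dens c x * gradient g c u x $ i = (\<Sum>j\<in>UNIV. P i j x * partial_deriv j ?w x)" for i x
    by (simp add: gradient_def P_def matrix_vector_mult_basis column_def sum_distrib_left mult_ac)
      (simp add: matrix_vector_mult_def sum_distrib_left mult_ac)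
  have "partial_deriv i (\<lambda>x. dens c x * gradient g c u x $ i) ?x =
      (\<Sum>j\<in>UNIV. P i j ?x * partial_deriv i (partial_deriv j ?w) ?x)" for i
  proof -
    have "partial_deriv i (\<lambda>x. \<Sum>j\<in>UNIV. P i j x * partial_deriv j ?w x) ?x =
        (\<Sum>j\<in>UNIV. partial_deriv i (\<lambda>x. P i j x * partial_deriv j ?w x) ?x)"
      using Pd wd by (intro partial_deriv_sum differentiable_mult) auto
    also have "\<dots> = (\<Sum>j\<in>UNIV. P i j ?x * partial_deriv i (partial_deriv j ?w) ?x)"
      by (intro sum.cong refl) (simp add: partial_deriv_mult[OF Pd wd] hess(1))
    finally show ?thesis unfolding Y .
  qed
  then have "- dens c ?x = (\<Sum>i\<in>UNIV. \<Sum>j\<in>UNIV. P i j ?x * partial_deriv i (partial_deriv j ?w) ?x)"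
    using flux_divergence[OF \<Omega> torsion c q] by simp
  also have "\<dots> = dens c ?x * (\<Sum>i\<in>UNIV. \<Sum>j\<in>UNIV. matrix_inv (g c ?x) $ i $ j * partial_deriv i (partial_deriv j ?w) ?x)"
    by (simp add: P_def matrix_vector_mult_basis column_def sum_distrib_left mult_ac)
  also have "\<dots> \<ge> 0"
    using inv_g_trace_nonneg[OF c(1) xr hess(2)] dens_pos[OF c(1) xr] by (intro mult_nonneg_nonneg) auto
  finally show False using dens_pos[OF c(1) xr] by simp
qed

text \<open>A minimum over the compact closure lies inside, which \<open>torsion_not_min\<close>
  excludes, or on the boundary, where the value is 0. In the second case a point \<open>p\<close>
  with \<open>u p \<le> 0\<close> would itself be an interior minimum, so strict positivity comes at
  once.\<close>

lemma torsion_pos: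
  assumes \<Omega>: "open \<Omega>" "compact (closure \<Omega>)" and torsion: "torsion_function A g \<Omega> u" and p: "p \<in> \<Omega>"
  shows "u p > 0"
proof (rule ccontr)
  assume np: "\<not> u p > 0"
  have "closure \<Omega> \<noteq> {}" using p by auto
  moreover have "continuous_on (closure \<Omega>) u" and fr: "\<And>q. q \<in> frontier \<Omega> \<Longrightarrow> u q = 0"
    using torsion by (auto simp: torsion_function_def)
  ultimately obtain q where q: "q \<in> closure \<Omega>" "\<And>z. z \<in> closure \<Omega> \<Longrightarrow> u q \<le> u z"
    using continuous_attains_inf[OF \<Omega>(2)] by blast
  have cl: "z \<in> closure \<Omega>" if "z \<in> \<Omega>" for z using that closure_subset by blast
  show False
  proof (cases "q \<in> \<Omega>")
    case True
    show ?thesis by (rule torsion_not_min[OF \<Omega>(1) torsion True]) (use q(2) cl in blast)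
  next
    case False
    then have "q \<in> frontier \<Omega>" using q(1) \<Omega>(1) by (simp add: frontier_def interior_open)
    then have "u q = 0" by (rule fr)
    then have "u p \<le> u z" if "z \<in> \<Omega>" for z using q(2)[OF cl[OF that]] np by linarith
    then show ?thesis by (rule torsion_not_min[OF \<Omega>(1) torsion p])
  qed
qed

end

section \<open>Comparison of torsional rigidities\<close>

text \<open>Outside the closure of \<Omega> the values of a torsion function are arbitrary, hence
  the explicit zero off \<Omega>.\<close>

definition cutoff_torsion :: "real \<Rightarrow> 'm set \<Rightarrow> ('m \<Rightarrow> real) \<Rightarrow> 'm \<Rightarrow> real" where
  "cutoff_torsion e \<Omega> u p = (if p \<in> \<Omega> then cutoff e (u p) else 0)"

context immersed_manifold
begin

lemma gpair_cutoff_torsion: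
  assumes "open \<Omega>" "C1_manifold \<Omega> u" "C1_manifold \<Omega> v" "e > 0" "p \<in> \<Omega>"
  shows "gpair u (cutoff_torsion e \<Omega> v) p = cutoff_deriv e (v p) * gpair u v p"
proof -
  obtain c where c: "c \<in> A" "p \<in> fst c" using chart_at by blast
  have vd: "local_rep c v differentiable (at (snd c p))" and ud: "local_rep c u differentiable (at (snd c p))"
    using C1_manifold_differentiable assms c by blast+
  have cd: "(cutoff e has_real_derivative cutoff_deriv e (v p)) (at (local_rep c v (snd c p)))"
    using cutoff_has_derivative[OF assms(4)] by (simp add: chart_local_rep[OF chart[OF c(1)] c(2)])
  have "gpair u (cutoff_torsion e \<Omega> v) p = gpair u (\<lambda>q. cutoff e (v q)) p"
    by (rule gpair_cong[OF assms(1,5)]) (simp add: cutoff_torsion_def)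
  also have "\<dots> = gpair_chart c u (\<lambda>q. cutoff e (v q)) (snd c p)"
    using C1_manifold_compose[OF cutoff_C1[OF assms(4)] assms(3)] C1_manifold_differentiable[OF _ c assms(5)]
    by (intro gpair_eq c ud) blast
  also have "dvec c (\<lambda>q. cutoff e (v q)) (snd c p) = cutoff_deriv e (v p) *\<^sub>R dvec c v (snd c p)"
    using partial_deriv_compose_real[OF vd cd]
    by (simp add: dvec_def vec_eq_iff local_rep_def[abs_def])
  then have "gpair_chart c u (\<lambda>q. cutoff e (v q)) (snd c p) = cutoff_deriv e (v p) * gpair_chart c u v (snd c p)"
    by (simp add: gpair_chart_def matrix_vector_mult_scaleR)
  also have "gpair_chart c u v (snd c p) = gpair u v p" using gpair_eq[OF c ud vd] by simp
  finally show ?thesis .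
qed

lemma cutoff_torsion_C1: "open \<Omega> \<Longrightarrow> C1_manifold \<Omega> v \<Longrightarrow> e > 0 \<Longrightarrow> C1_manifold \<Omega> (cutoff_torsion e \<Omega> v)"
  by (rule C1_manifold_cong[OF _ C1_manifold_compose[OF cutoff_C1]]) (auto simp: cutoff_torsion_def)

text \<open>Since \<open>u\<close> vanishes on the boundary, a superlevel set at a positive level
  avoids it and is compact inside \<Omega>. This makes the cut-off function admissible in
  \<open>weak_form\<close>.\<close>

lemma torsion_superlevel:
  assumes "open \<Omega>" "compact (closure \<Omega>)" "torsion_function A g \<Omega> u" "e > 0"
  shows "compact {p \<in> closure \<Omega>. u p \<ge> e}" "{p \<in> closure \<Omega>. u p \<ge> e} \<subseteq> \<Omega>"
    "p \<notin> {p \<in> closure \<Omega>. u p \<ge> e} \<Longrightarrow> cutoff_torsion e \<Omega> u p = 0"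
proof -
  have uc: "continuous_on (closure \<Omega>) u" and fr: "\<And>q. q \<in> frontier \<Omega> \<Longrightarrow> u q = 0"
    using assms(3) by (auto simp: torsion_function_def)
  have "{p \<in> closure \<Omega>. u p \<ge> e} = closure \<Omega> \<inter> u -` {e..}" by auto
  moreover have "closed (closure \<Omega> \<inter> u -` {e..})"
    by (intro continuous_closed_preimage uc) auto
  ultimately show "compact {p \<in> closure \<Omega>. u p \<ge> e}"
    using compact_Int_closed[OF assms(2)] by (metis Int_lower1 Int_absorb1)
  show "{p \<in> closure \<Omega>. u p \<ge> e} \<subseteq> \<Omega>"
  proof
    fix p assume p: "p \<in> {p \<in> closure \<Omega>. u p \<ge> e}"
    show "p \<in> \<Omega>"
    proof (rule ccontr)
      assume "p \<notin> \<Omega>"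
      then have "p \<in> frontier \<Omega>" using p assms(1) by (simp add: frontier_def interior_open)
      from fr[OF this] p assms(4) show False by simp
    qed
  qed
  show "cutoff_torsion e \<Omega> u p = 0" if "p \<notin> {p \<in> closure \<Omega>. u p \<ge> e}"
    using that closure_subset[of \<Omega>] cutoff_zero[OF assms(4), of "u p"] by (auto simp: cutoff_torsion_def)
qed

lemma integrable_torsion:
  assumes "open \<Omega>" "compact (closure \<Omega>)" "torsion_function A g \<Omega> u"
  shows "set_integrable vol \<Omega> u"
proof (rule set_integrable_subset)
  show "set_integrable vol (closure \<Omega>) u"
    using assms by (intro integrable_vol_compact) (auto simp: torsion_function_def)
qed (use assms closure_subset in auto)

end

text \<open>Testing the equation of the first torsion function against itself and against the second
  one, and the equation of the second one against itself, the three integrals combine to that of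
  a nonnegative quadratic form. The cutoff-off of \<open>u1\<close> is chosen to be the identity up to a constant on
  the support of the cutoff-off of \<open>u2\<close>.\<close>

lemma torsion_comparison:
  fixes A :: "('m::{t2_space, second_countable_topology}, 'n::finite) chart set"
    and f1 f2 :: "'m \<Rightarrow> real^'k::finite"
  assumes I: "immersed_manifold A f1" "immersed_manifold A f2"
    and \<Omega>: "open \<Omega>" "compact (closure \<Omega>)"
    and u1: "torsion_function A (induced_metric f1) \<Omega> u1"
    and u2: "torsion_function A (induced_metric f2) \<Omega> u2"
    and r: "r > 0" and vol: "riemannian_volume A (induced_metric f2) = density (riemannian_volume A (induced_metric f1)) (\<lambda>_. ennreal r)"
    and \<kappa>: "\<kappa> > 0" and le: "\<And>c x v. c \<in> A \<Longrightarrow> x \<in> chart_range c \<Longrightarrow>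
      v \<bullet> (induced_metric f2 c x *v v) \<le> \<kappa> * (v \<bullet> (induced_metric f1 c x *v v))"
  shows "(LINT p:\<Omega>|riemannian_volume A (induced_metric f1). u2 p) \<le>
    \<kappa> * (LINT p:\<Omega>|riemannian_volume A (induced_metric f1). u1 p)"
proof -
  interpret I1: immersed_manifold A f1 by fact
  interpret I2: immersed_manifold A f2 by fact
  let ?V = "riemannian_volume A (induced_metric f1)"
  note C1 = I1.torsion_C1[OF \<Omega>(1) u1]
  note C2 = I2.torsion_C1[OF \<Omega>(1) u2]
  have sc: "\<Omega> \<subseteq> closure \<Omega>" by (rule closure_subset)
  have \<Omega>b: "\<Omega> \<in> sets borel" using \<Omega>(1) by auto
  have int2: "integrable I2.vol F \<longleftrightarrow> integrable ?V F" "(\<integral>p. F p \<partial>I2.vol) = r * (\<integral>p. F p \<partial>?V)"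
    if "F \<in> borel_measurable borel" for F :: "'m \<Rightarrow> real"
    using that r unfolding vol
    by (subst integrable_density, auto)[] (subst vol integral_density, use that r in auto)
  have i1: "set_integrable ?V \<Omega> u1" by (rule I1.integrable_torsion[OF \<Omega> u1])
  have u2c: "continuous_on (closure \<Omega>) u2" and u1c: "continuous_on (closure \<Omega>) u1"
    using u1 u2 by (auto simp: torsion_function_def)
  have i2: "set_integrable ?V \<Omega> u2"
    by (rule set_integrable_subset[OF I1.integrable_vol_compact[OF \<Omega>(2) u2c]]) (use \<Omega>b sc in auto)
  have pos1: "u1 p > 0" and pos2: "u2 p > 0" if "p \<in> \<Omega>" for p
    using I1.torsion_pos[OF \<Omega> u1 that] I2.torsion_pos[OF \<Omega> u2 that] by auto
  \<comment> \<open>Evaluate the inverse of the first metric at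
    \<open>\<kappa> *\<^sub>R w1 - w2\<close>, estimate its last term by \<open>ab\<close>, and
    divide by \<open>\<kappa>\<close>.\<close>
  have form: "\<kappa> * I1.gpair u1 u1 p - 2 * I1.gpair u1 u2 p + I2.gpair u2 u2 p \<ge> 0 \<and> I1.gpair u1 u1 p \<ge> 0"
    if p: "p \<in> \<Omega>" for p
  proof -
    obtain c where c: "c \<in> A" "p \<in> fst c" using I1.chart_at by blast
    let ?x = "snd c p"
    have x: "?x \<in> chart_range c" using c(2) by blast
    note d1 = I1.C1_manifold_differentiable[OF C1 c p] and d2 = I2.C1_manifold_differentiable[OF C2 c p]
    define w1 where "w1 = I1.dvec c u1 ?x"
    define w2 where "w2 = I1.dvec c u2 ?x"
    have w2': "w2 = I2.dvec c u2 ?x" by (simp add: w2_def I1.dvec_def I2.dvec_def)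
    let ?a = "matrix_inv (induced_metric f1 c ?x)" and ?b = "matrix_inv (induced_metric f2 c ?x)"
    have e: "I1.gpair u1 u1 p = w1 \<bullet> (?a *v w1)" "I1.gpair u1 u2 p = w1 \<bullet> (?a *v w2)"
      "I2.gpair u2 u2 p = w2 \<bullet> (?b *v w2)"
      using I1.gpair_eq[OF c d1 d1] I1.gpair_eq[OF c d1 d2] I2.gpair_eq[OF c d2 d2]
      by (simp_all add: I1.gpair_chart_def I2.gpair_chart_def w1_def w2_def[symmetric] w2'[symmetric])
    \<comment> \<open>Inversion reverses the order of metrics. The vectors \<open>y\<close> and
      \<open>z\<close> are dual to \<open>w2\<close> under the first and the second metric; the
      claim is the nonnegativity of the second metric at
      \<open>\<kappa> *\<^sub>R z - y\<close>.\<close>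
    have ab: "w2 \<bullet> (?a *v w2) \<le> \<kappa> * (w2 \<bullet> (?b *v w2))"
    proof -
      define y where "y = ?a *v w2"
      define z where "z = ?b *v w2"
      have gz: "induced_metric f2 c ?x *v z = w2" and gy: "induced_metric f1 c ?x *v y = w2"
        unfolding y_def z_def using I1.g_inv(1)[OF c(1) x] I2.g_inv(1)[OF c(1) x] by auto
      have "0 \<le> (\<kappa> *\<^sub>R z - y) \<bullet> (induced_metric f2 c ?x *v (\<kappa> *\<^sub>R z - y))" by (rule I2.g_nonneg)
      also have "\<dots> = \<kappa> * \<kappa> * (z \<bullet> w2) - 2 * \<kappa> * (y \<bullet> w2) + y \<bullet> (induced_metric f2 c ?x *v y)"
        using I2.g_sym[of z c ?x y]
        by (simp add: matrix_vector_mult_diff_distrib matrix_vector_mult_scaleR gz inner_diff_left inner_diff_right algebra_simps)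
      also have "\<dots> \<le> \<kappa> * \<kappa> * (z \<bullet> w2) - 2 * \<kappa> * (y \<bullet> w2) + \<kappa> * (y \<bullet> w2)"
        using le[OF c(1) x, of y] by (simp add: gy)
      finally have "0 \<le> \<kappa> * (\<kappa> * (z \<bullet> w2) - y \<bullet> w2)" by (simp add: algebra_simps)
      then have "y \<bullet> w2 \<le> \<kappa> * (z \<bullet> w2)" using \<kappa> by (simp add: zero_le_mult_iff)
      then show ?thesis by (simp add: y_def z_def inner_commute)
    qed
    have "0 \<le> (\<kappa> *\<^sub>R w1 - w2) \<bullet> (?a *v (\<kappa> *\<^sub>R w1 - w2))" by (rule I1.inv_g_nonneg[OF c(1) x])
    also have "\<dots> = \<kappa> * \<kappa> * (w1 \<bullet> (?a *v w1)) - 2 * \<kappa> * (w1 \<bullet> (?a *v w2)) + w2 \<bullet> (?a *v w2)"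
      using I1.inv_g_sym[OF c(1) x, of w2 w1]
      by (simp add: matrix_vector_mult_diff_distrib matrix_vector_mult_scaleR inner_diff_left inner_diff_right algebra_simps)
    also have "\<dots> \<le> \<kappa> * (\<kappa> * (w1 \<bullet> (?a *v w1)) - 2 * (w1 \<bullet> (?a *v w2)) + w2 \<bullet> (?b *v w2))"
      using ab by (simp add: algebra_simps)
    finally have "0 \<le> \<kappa> * (w1 \<bullet> (?a *v w1)) - 2 * (w1 \<bullet> (?a *v w2)) + w2 \<bullet> (?b *v w2)"
      using \<kappa> by (simp add: zero_le_mult_iff)
    then show ?thesis unfolding e using I1.inv_g_nonneg[OF c(1) x] by simp
  qed
  have approx: "(LINT p:\<Omega>|?V. u2 p) - 2 * \<delta> * measure ?V \<Omega> \<le> \<kappa> * (LINT p:\<Omega>|?V. u1 p)"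
    if \<delta>: "\<delta> > 0" for \<delta>
  proof -
    define K2 where "K2 = {p \<in> closure \<Omega>. u2 p \<ge> \<delta>}"
    note K = I2.torsion_superlevel[OF \<Omega> u2 \<delta>, folded K2_def]
    \<comment> \<open>\<open>\<epsilon>\<close> is half the minimum of \<open>u1\<close> on the
      compact \<open>K2\<close>, because the cut-off has derivative 1 from
      \<open>2 * \<epsilon>\<close> on. For empty \<open>K2\<close> any value serves.\<close>
    obtain \<epsilon> where \<epsilon>: "\<epsilon> > 0" "\<And>p. p \<in> K2 \<Longrightarrow> 2 * \<epsilon> \<le> u1 p"
    proof (cases "K2 = {}")
      case True
      show ?thesis by (rule that[of 1]) (use True in auto)
    next
      case False
      have "continuous_on K2 u1" by (rule continuous_on_subset[OF u1c]) (simp add: K2_def)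
      from continuous_attains_inf[OF K(1) False this]
      obtain q where q: "q \<in> K2" "\<forall>p\<in>K2. u1 q \<le> u1 p" by (elim bexE)
      have "u1 q > 0" using pos1 K(2) q(1) by (meson subsetD)
      show ?thesis
      proof (rule that[of "u1 q / 2"])
        show "2 * (u1 q / 2) \<le> u1 p" if "p \<in> K2" for p using bspec[OF q(2) that] by simp
      qed (use \<open>u1 q > 0\<close> in simp)
    qed
    define K1 where "K1 = {p \<in> closure \<Omega>. u1 p \<ge> \<epsilon>}"
    note L = I1.torsion_superlevel[OF \<Omega> u1 \<epsilon>(1), folded K1_def]
    let ?\<psi>1 = "cutoff_torsion \<epsilon> \<Omega> u1" and ?\<psi>2 = "cutoff_torsion \<delta> \<Omega> u2"
    have c2: "I1.C1_manifold \<Omega> u2" using C2 by (simp add: I1.C1_manifold_def I2.C1_manifold_def)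
    note w11 = I1.weak_form[where \<psi>="?\<psi>1" and K=K1, OF \<Omega>(1) u1 I1.cutoff_torsion_C1[OF \<Omega>(1) C1 \<epsilon>(1)] L]
    note w12 = I1.weak_form[where \<psi>="?\<psi>2" and K=K2, OF \<Omega>(1) u1 I1.cutoff_torsion_C1[OF \<Omega>(1) c2 \<delta>] K(1,2) K(3)]
    note w22 = I2.weak_form[where \<psi>="?\<psi>2" and K=K2, OF \<Omega>(1) u2 I2.cutoff_torsion_C1[OF \<Omega>(1) C2 \<delta>] K(1,2) K(3)]
    have m: "F \<in> borel_measurable borel" if "integrable I2.vol F" for F :: "'m \<Rightarrow> real"
      using borel_measurable_integrable[OF that] unfolding measurable_cong_sets[OF I2.sets_vol refl] .
    \<comment> \<open>The constant factor \<open>r\<close> between the two volumes cancels, so the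
      weak equation of \<open>u2\<close> may be integrated against the first volume.\<close>
    have w22': "integrable ?V (I2.gpair u2 ?\<psi>2)" "(\<integral>p. I2.gpair u2 ?\<psi>2 p \<partial>?V) = (\<integral>p. ?\<psi>2 p \<partial>?V)"
      using w22 int2[OF m[OF w22(1)]] int2[OF m[OF w22(2)]] r by auto
    \<comment> \<open>Let \<open>?\<theta>\<close> be the derivative of the cut-off of
      \<open>u2\<close>, a number between 0 and 1. On \<open>K2\<close> the cut-off of
      \<open>u1\<close> has derivative 1, and the expression is \<open>?\<theta>\<close> times the
      quadratic form plus \<open>1 - ?\<theta>\<close> times the nonnegative energy term of
      \<open>u1\<close>. In the rest of \<Omega> \<open>?\<theta>\<close> is 0 and only the energy
      term remains.\<close>
    have ge: "0 \<le> \<kappa> * I1.gpair u1 ?\<psi>1 p + I2.gpair u2 ?\<psi>2 p - 2 * I1.gpair u1 ?\<psi>2 p" for p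
    proof (cases "p \<in> \<Omega>")
      case True
      let ?\<theta> = "cutoff_deriv \<delta> (u2 p)" and ?\<eta> = "cutoff_deriv \<epsilon> (u1 p)"
      have g: "I1.gpair u1 ?\<psi>1 p = ?\<eta> * I1.gpair u1 u1 p" "I1.gpair u1 ?\<psi>2 p = ?\<theta> * I1.gpair u1 u2 p"
        "I2.gpair u2 ?\<psi>2 p = ?\<theta> * I2.gpair u2 u2 p"
        using I1.gpair_cutoff_torsion[OF \<Omega>(1) C1 C1 \<epsilon>(1) True] I1.gpair_cutoff_torsion[OF \<Omega>(1) C1 c2 \<delta> True]
          I2.gpair_cutoff_torsion[OF \<Omega>(1) C2 C2 \<delta> True] by auto
      have b: "0 \<le> ?\<theta>" "?\<theta> \<le> 1" "0 \<le> ?\<eta>" using cutoff_deriv_bounds \<delta> \<epsilon>(1) by auto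
      note f = form[OF True]
      show ?thesis
      proof (cases "u2 p \<ge> \<delta>")
        case K: True
        then have "p \<in> K2" using True sc by (auto simp: K2_def)
        then have "?\<eta> = 1" using \<epsilon> by (intro cutoff_deriv_one) auto
        then have "\<kappa> * I1.gpair u1 ?\<psi>1 p + I2.gpair u2 ?\<psi>2 p - 2 * I1.gpair u1 ?\<psi>2 p =
            ?\<theta> * (\<kappa> * I1.gpair u1 u1 p - 2 * I1.gpair u1 u2 p + I2.gpair u2 u2 p) + (1 - ?\<theta>) * (\<kappa> * I1.gpair u1 u1 p)"
          unfolding g by (simp add: algebra_simps)
        then show ?thesis using f b \<kappa> by simp
      next
        case False
        then have "?\<theta> = 0" using cutoff_deriv_zero[OF \<delta>] by simp
        then show ?thesis unfolding g using f b \<kappa> by simp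
      qed
    next
      case False
      have o: "p \<notin> K2" "p \<notin> K1" using False K(2) L(2) by blast+
      have "I1.gpair u1 ?\<psi>1 p = 0" "I1.gpair u1 ?\<psi>2 p = 0" "I2.gpair u2 ?\<psi>2 p = 0"
        using I1.gpair_outside[where K=K1 and \<psi>="?\<psi>1", OF compact_imp_closed[OF L(1)] L(3) o(2)]
          I1.gpair_outside[where K=K2 and \<psi>="?\<psi>2", OF compact_imp_closed[OF K(1)] K(3) o(1)]
          I2.gpair_outside[where K=K2 and \<psi>="?\<psi>2", OF compact_imp_closed[OF K(1)] K(3) o(1)] by auto
      then show ?thesis by simp
    qed
    \<comment> \<open>The weak equations replace every gradient term by the integral of its test
      function: \<open>?\<psi>2\<close> occurs once with factor 1 and once with -2, which leaves
      -1.\<close>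
    have "0 \<le> (\<integral>p. \<kappa> * I1.gpair u1 ?\<psi>1 p + I2.gpair u2 ?\<psi>2 p - 2 * I1.gpair u1 ?\<psi>2 p \<partial>?V)"
      by (rule Bochner_Integration.integral_nonneg) (rule ge)
    also have "\<dots> = \<kappa> * (\<integral>p. ?\<psi>1 p \<partial>?V) + (\<integral>p. ?\<psi>2 p \<partial>?V) - 2 * (\<integral>p. ?\<psi>2 p \<partial>?V)"
      using w11 w12 w22' by simp
    finally have main: "(\<integral>p. ?\<psi>2 p \<partial>?V) \<le> \<kappa> * (\<integral>p. ?\<psi>1 p \<partial>?V)" by simp
    have "(\<integral>p. ?\<psi>1 p \<partial>?V) \<le> (LINT p:\<Omega>|?V. u1 p)"
      unfolding set_lebesgue_integral_def
    proof (rule Bochner_Integration.integral_mono)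
      show "integrable ?V ?\<psi>1" by (rule w11)
      show "integrable ?V (\<lambda>p. indicator \<Omega> p *\<^sub>R u1 p)" using i1 by (simp add: set_integrable_def)
      show "?\<psi>1 p \<le> indicator \<Omega> p *\<^sub>R u1 p" for p
        using cutoff_bounds(2)[OF \<epsilon>(1), of "u1 p"] pos1[of p] by (auto simp: cutoff_torsion_def)
    qed
    then have a: "(\<integral>p. ?\<psi>2 p \<partial>?V) \<le> \<kappa> * (LINT p:\<Omega>|?V. u1 p)"
      using main \<kappa> by (smt (verit) mult_left_mono)
    have fin: "emeasure ?V \<Omega> < \<infinity>"
      using I1.vol_compact_finite[OF \<Omega>(2)] emeasure_mono[OF sc, of ?V] by (auto simp: less_top[symmetric] top_unique)
    have ind: "integrable ?V (\<lambda>p. 2 * \<delta> * indicator \<Omega> p)"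
      using fin \<Omega>b by (intro integrable_mult_right integrable_real_indicator) auto
    have i2': "integrable ?V (\<lambda>p. indicator \<Omega> p *\<^sub>R u2 p)" using i2 by (simp add: set_integrable_def)
    have "(LINT p:\<Omega>|?V. u2 p) - 2 * \<delta> * measure ?V \<Omega> = (\<integral>p. indicator \<Omega> p *\<^sub>R u2 p - 2 * \<delta> * indicator \<Omega> p \<partial>?V)"
      unfolding set_lebesgue_integral_def using i2' ind \<Omega>b fin by (subst Bochner_Integration.integral_diff) auto
    also have "\<dots> \<le> (\<integral>p. ?\<psi>2 p \<partial>?V)"
    proof (rule Bochner_Integration.integral_mono)
      show "integrable ?V (\<lambda>p. indicator \<Omega> p *\<^sub>R u2 p - 2 * \<delta> * indicator \<Omega> p)"
        using i2' ind by (rule Bochner_Integration.integrable_diff)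
      show "integrable ?V ?\<psi>2" by (rule w12)
      show "indicator \<Omega> p *\<^sub>R u2 p - 2 * \<delta> * indicator \<Omega> p \<le> ?\<psi>2 p" for p
        using cutoff_bounds(1)[OF \<delta>, of "u2 p"] pos2[of p] by (auto simp: cutoff_torsion_def)
    qed
    finally show ?thesis using a by linarith
  qed
  have "((\<lambda>\<delta>. (LINT p:\<Omega>|?V. u2 p) - 2 * \<delta> * measure ?V \<Omega>) \<longlongrightarrow> (LINT p:\<Omega>|?V. u2 p) - 2 * 0 * measure ?V \<Omega>) (at_right 0)"
    by (intro tendsto_intros)
  then have "(LINT p:\<Omega>|?V. u2 p) - 2 * 0 * measure ?V \<Omega> \<le> \<kappa> * (LINT p:\<Omega>|?V. u1 p)"
    by (rule tendsto_upperbound) (use approx in \<open>auto simp: eventually_at_right_field intro!: exI[of _ 1]\<close>)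
  then show ?thesis by simp
qed

section \<open>Linear algebra of hypersurfaces\<close>

text \<open>The orthogonal complement of the range of \<open>J\<close> is a line. The part of
  \<open>w\<close> orthogonal to \<open>N\<close> lies in it as well; if it were nonzero, it would
  be a second independent vector there.\<close>

lemma codimension_one:
  fixes J :: "real^'n^'k"
  assumes card: "CARD('k) = CARD('n) + 1" and inj: "\<And>v. J *v v = 0 \<Longrightarrow> v = 0"
    and N: "norm N = 1" "\<And>v. N \<bullet> (J *v v) = 0" and w: "\<And>v. w \<bullet> (J *v v) = 0"
  shows "w = (w \<bullet> N) *\<^sub>R N"
proof -
  let ?R = "range ((*v) J)"
  have lin: "linear ((*v) J)" by simp
  have "inj ((*v) J)" using inj linear_injective_0[OF lin] by blast
  then have "dim ?R = dim (UNIV :: (real^'n) set)" by (intro dim_image_eq[OF lin]) (simp add: inj_on_subset)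
  then have dR: "dim ?R = CARD('n)" by simp
  let ?P = "{y \<in> UNIV. \<forall>x\<in>?R. orthogonal x y}"
  have "subspace ?R" using lin by (intro linear_subspace_image) auto
  then have "dim ?P + dim ?R = dim (UNIV :: (real^'k) set)"
    by (intro dim_subspace_orthogonal_to_vectors) auto
  then have dP: "dim ?P = 1" using dR card by simp
  define w' where "w' = w - (w \<bullet> N) *\<^sub>R N"
  have "w' \<bullet> (J *v v) = 0" for v using N w by (simp add: w'_def inner_diff_left)
  then have P: "N \<in> ?P" "w' \<in> ?P" using N(2) by (auto simp: orthogonal_def inner_commute)
  have NN: "N \<bullet> N = 1" using N(1) by (simp add: norm_eq_1)
  have o: "w' \<bullet> N = 0" by (simp add: w'_def inner_diff_left NN)
  have "w' = 0"
  proof (rule ccontr)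
    assume nz: "w' \<noteq> 0"
    have ne: "w' \<noteq> N" using o NN by auto
    have "pairwise orthogonal {w', N}" using o by (auto simp: pairwise_def orthogonal_def inner_commute)
    moreover have "0 \<notin> {w', N}" using nz N(1) by auto
    ultimately have "independent {w', N}" by (rule pairwise_orthogonal_independent)
    then have "card {w', N} \<le> dim ?P" using P by (intro independent_card_le_dim) auto
    then show False using dP ne by simp
  qed
  then show ?thesis by (simp add: w'_def)
qed

text \<open>Jacobi's formula. The product rule gives determinants in which row \<open>k\<close> of
  \<open>G t\<close> is replaced by row \<open>k\<close> of \<open>M\<close>. Writing
  \<open>M\<close> as \<open>(M ** matrix_inv (G t)) ** G t\<close> makes this row a combination of
  the rows of \<open>G t\<close>, of which only the \<open>k\<close>-th contributes.\<close>

lemma has_real_derivative_det: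
  fixes G :: "real \<Rightarrow> real^'n^'n"
  assumes "\<And>i j. ((\<lambda>s. G s $ i $ j) has_real_derivative M $ i $ j) (at t within S)" and "det (G t) \<noteq> 0"
  shows "((\<lambda>s. det (G s)) has_real_derivative (\<Sum>k\<in>UNIV. (M ** matrix_inv (G t)) $ k $ k) * det (G t)) (at t within S)"
proof -
  let ?P = "{p. p permutes (UNIV :: 'n set)}"
  let ?R = "\<lambda>k. \<chi> i. if i = k then row k M else row i (G t)"
  have pr: "((\<lambda>s. \<Prod>i\<in>UNIV. G s $ i $ p i) has_real_derivative
      (\<Sum>k\<in>UNIV. M $ k $ p k * (\<Prod>j\<in>UNIV - {k}. G t $ j $ p j))) (at t within S)" for p
  proof -
    have "((\<lambda>s. \<Prod>i\<in>UNIV. G s $ i $ p i) has_derivative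
      (\<lambda>y. \<Sum>k\<in>UNIV. (M $ k $ p k * y) * (\<Prod>j\<in>UNIV - {k}. G t $ j $ p j))) (at t within S)"
      using assms(1) unfolding has_field_derivative_def by (intro has_derivative_prod) blast
    then show ?thesis unfolding has_field_derivative_def
      by (rule has_derivative_eq_rhs) (simp add: fun_eq_iff sum_distrib_left mult_ac)
  qed
  have dR: "det (?R k) = (\<Sum>p\<in>?P. of_int (sign p) * (M $ k $ p k * (\<Prod>j\<in>UNIV - {k}. G t $ j $ p j)))" for k
    unfolding det_def
  proof (intro sum.cong refl arg_cong2[where f="(*)"])
    fix p
    show "(\<Prod>i\<in>UNIV. ?R k $ i $ p i) = M $ k $ p k * (\<Prod>j\<in>UNIV - {k}. G t $ j $ p j)"
      by (subst prod.remove[of UNIV k]) (auto simp: row_def intro!: prod.cong)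
  qed
  have "((\<lambda>s. det (G s)) has_real_derivative
      (\<Sum>p\<in>?P. of_int (sign p) * (\<Sum>k\<in>UNIV. M $ k $ p k * (\<Prod>j\<in>UNIV - {k}. G t $ j $ p j)))) (at t within S)"
    unfolding det_def by (intro DERIV_sum DERIV_cmult pr)
  also have "(\<Sum>p\<in>?P. of_int (sign p) * (\<Sum>k\<in>UNIV. M $ k $ p k * (\<Prod>j\<in>UNIV - {k}. G t $ j $ p j))) = (\<Sum>k\<in>UNIV. det (?R k))"
    unfolding dR by (subst sum.swap) (simp add: sum_distrib_left)
  finally have "((\<lambda>s. det (G s)) has_real_derivative (\<Sum>k\<in>UNIV. det (?R k))) (at t within S)" .
  moreover have "det (?R k) = (M ** matrix_inv (G t)) $ k $ k * det (G t)" for k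
  proof -
    have M: "M = (M ** matrix_inv (G t)) ** G t"
      using matrix_inv_props(2)[OF assms(2)] by (simp add: matrix_mul_assoc[symmetric])
    have "row k (X ** Y) = (\<Sum>i\<in>UNIV. X $ k $ i *s row i Y)" for X Y :: "real^'n^'n"
      by (simp add: vec_eq_iff row_def matrix_matrix_mult_def)
    from this[of "M ** matrix_inv (G t)" "G t", folded M]
    have rk: "row k M = (\<Sum>i\<in>UNIV. (M ** matrix_inv (G t)) $ k $ i *s row i (G t))" .
    show ?thesis unfolding rk by (rule cramer_lemma_transpose)
  qed
  ultimately show ?thesis by (simp add: sum_distrib_right)
qed

context immersed_manifold
begin

text \<open>This replaces the diagonalisation of \<open>h\<close>. The vectors \<open>B k\<close>
  are the tangential parts of the ambient basis vectors, read in the chart, and they recombine to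
  \<open>v\<close> with the coefficients \<open>w $ k\<close>. Subtracting from each
  \<open>B k\<close> its component along \<open>v\<close> and summing the values of
  \<open>h\<close>, all nonnegative, leaves the trace minus \<open>q / m\<close>.\<close>

lemma trace_bound:
  assumes "c \<in> A" "x \<in> chart_range c" and psd: "\<And>v. v \<bullet> (h *v v) \<ge> 0"
  shows "v \<bullet> (h *v v) \<le> (\<Sum>i\<in>UNIV. \<Sum>j\<in>UNIV. matrix_inv (g c x) $ i $ j * h $ i $ j) * (v \<bullet> (g c x *v v))"
proof (cases "v = 0")
  case False
  define B where "B k = (jac c x ** matrix_inv (g c x)) $ k" for k
  define w where "w = jac c x *v v"
  define m where "m = v \<bullet> (g c x *v v)"
  have m: "m > 0" "m = w \<bullet> w" using g_pos[OF assms(1,2) False] by (auto simp: m_def w_def inner_g)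
  have sumB: "(\<Sum>k\<in>UNIV. w $ k *\<^sub>R B k) = v"
  proof -
    have "(\<Sum>k\<in>UNIV. w $ k *\<^sub>R B k) \<bullet> y = v \<bullet> y" for y
    proof -
      have "(\<Sum>k\<in>UNIV. w $ k *\<^sub>R B k) \<bullet> y = (\<Sum>k\<in>UNIV. w $ k * (B k \<bullet> y))"
        by (simp add: inner_sum_left)
      also have "\<dots> = w \<bullet> (jac c x *v (matrix_inv (g c x) *v y))"
        by (simp add: inner_vec_def[of w] matrix_vector_mul_assoc B_def matrix_vector_mult_def[of "jac c x ** _"] inner_vec_def)
      also have "\<dots> = v \<bullet> y"
        unfolding w_def inner_g[symmetric] g_inv(1)[OF assms(1,2)] ..
      finally show ?thesis .
    qed
    then show ?thesis using vector_eq_rdot by blast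
  qed
  have tr: "(\<Sum>i\<in>UNIV. \<Sum>j\<in>UNIV. matrix_inv (g c x) $ i $ j * h $ i $ j) = (\<Sum>k\<in>UNIV. B k \<bullet> (h *v B k))"
  proof -
    have "(\<Sum>i\<in>UNIV. \<Sum>j\<in>UNIV. matrix_inv (g c x) $ i $ j * h $ i $ j) =
        (\<Sum>i\<in>UNIV. \<Sum>j\<in>UNIV. \<Sum>k\<in>UNIV. h $ i $ j * (B k $ i * B k $ j))"
      unfolding inv_g_gram[OF assms(1,2)] B_def by (simp add: sum_distrib_left mult_ac)
    also have "\<dots> = (\<Sum>i\<in>UNIV. \<Sum>k\<in>UNIV. \<Sum>j\<in>UNIV. h $ i $ j * (B k $ i * B k $ j))"
      by (intro sum.cong refl sum.swap)
    also have "\<dots> = (\<Sum>k\<in>UNIV. \<Sum>i\<in>UNIV. \<Sum>j\<in>UNIV. h $ i $ j * (B k $ i * B k $ j))"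
      by (rule sum.swap)
    finally show ?thesis by (simp add: inner_matrix_vector)
  qed
  define q where "q = v \<bullet> (h *v v)"
  have "(\<Sum>k\<in>UNIV. w $ k * (B k \<bullet> y)) = (\<Sum>k\<in>UNIV. w $ k *\<^sub>R B k) \<bullet> y" for y
    by (simp add: inner_sum_left)
  then have s1: "(\<Sum>k\<in>UNIV. w $ k * (B k \<bullet> (h *v v))) = q" by (simp add: sumB q_def)
  have "(\<Sum>k\<in>UNIV. w $ k * (v \<bullet> (h *v B k))) = v \<bullet> (h *v (\<Sum>k\<in>UNIV. w $ k *\<^sub>R B k))"
    by (simp add: linear_sum[OF matrix_vector_mul_linear] matrix_vector_mult_scaleR inner_sum_right)
  then have s2: "(\<Sum>k\<in>UNIV. w $ k * (v \<bullet> (h *v B k))) = q" by (simp add: sumB q_def)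
  have s3: "(\<Sum>k\<in>UNIV. w $ k * w $ k) = m" using m(2) by (simp add: inner_vec_def)
  have "0 \<le> (\<Sum>k\<in>UNIV. (B k - (w $ k / m) *\<^sub>R v) \<bullet> (h *v (B k - (w $ k / m) *\<^sub>R v)))"
    by (intro sum_nonneg psd)
  also have "\<dots> = (\<Sum>k\<in>UNIV. B k \<bullet> (h *v B k) - (w $ k * (B k \<bullet> (h *v v))) / m - (w $ k * (v \<bullet> (h *v B k))) / m
      + (w $ k * w $ k) * (q / (m * m)))"
    by (intro sum.cong refl)
      (simp add: matrix_vector_mult_diff_distrib matrix_vector_mult_scaleR inner_diff_left inner_diff_right q_def
        algebra_simps diff_divide_distrib)
  also have "\<dots> = (\<Sum>k\<in>UNIV. B k \<bullet> (h *v B k)) - q / m - q / m + m * (q / (m * m))"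
    unfolding sum.distrib sum_subtractf sum_divide_distrib[symmetric] sum_distrib_right[symmetric] s1 s2 s3 ..
  also have "\<dots> = (\<Sum>k\<in>UNIV. B k \<bullet> (h *v B k)) - q / m" using m(1) by simp
  finally have "q / m \<le> (\<Sum>k\<in>UNIV. B k \<bullet> (h *v B k))" by simp
  then show ?thesis unfolding tr q_def[symmetric] m_def[symmetric] using m(1) by (simp add: pos_divide_le_eq)
qed simp

lemma inv_g_trace_pos:
  assumes "c \<in> A" "x \<in> chart_range c" and pd: "\<And>v. v \<noteq> 0 \<Longrightarrow> v \<bullet> (h *v v) > 0"
  shows "(\<Sum>i\<in>UNIV. \<Sum>j\<in>UNIV. matrix_inv (g c x) $ i $ j * h $ i $ j) > 0"
proof -
  \<comment> \<open>Any nonzero vector serves as a witness; \<open>undefined\<close> is just some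
    index.\<close>
  let ?v = "axis undefined 1 :: real^'n"
  have nz: "?v \<noteq> 0" by (simp add: axis_eq_0_iff)
  have "v \<bullet> (h *v v) \<ge> 0" for v using pd[of v] by (cases "v = 0") auto
  from trace_bound[OF assms(1,2) this, of ?v] pd[OF nz] g_pos[OF assms(1,2) nz] show ?thesis
    by (smt (verit) mult_nonpos_nonneg)
qed

lemma normal_part_orthogonal:
  assumes "c \<in> A" "x \<in> chart_range c"
  shows "normal_part c f x v \<bullet> partial_deriv l (local_rep c f) x = 0"
proof -
  let ?d = "\<lambda>i. partial_deriv i (local_rep c f) x" and ?a = "matrix_inv (g c x)"
  have "det (g c x) \<noteq> 0" using det_g_pos[OF assms] by simp
  from matrix_inv_props(2)[OF this] have ag: "(\<Sum>m\<in>UNIV. ?a $ k $ m * g c x $ m $ l) = (if k = l then 1 else 0)" for k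
    by (simp add: vec_eq_iff matrix_matrix_mult_def mat_def)
  have "(\<Sum>k\<in>UNIV. \<Sum>m\<in>UNIV. (?a $ k $ m * (v \<bullet> ?d k)) *\<^sub>R ?d m) \<bullet> ?d l =
      (\<Sum>k\<in>UNIV. (v \<bullet> ?d k) * (\<Sum>m\<in>UNIV. ?a $ k $ m * g c x $ m $ l))"
    by (simp add: inner_sum_left sum_distrib_left induced_metric_def mult_ac)
  also have "\<dots> = v \<bullet> ?d l" unfolding ag by (simp add: if_distrib[of "(*) _"] cong: if_cong)
  finally show ?thesis by (simp add: normal_part_def inner_diff_left)
qed

lemma jac_orthogonal:
  assumes "\<And>i. w \<bullet> partial_deriv i (local_rep c f) x = 0"
  shows "w \<bullet> (jac c x *v v) = 0"
proof -
  have "jac c x *v v = (\<Sum>i\<in>UNIV. v $ i *\<^sub>R partial_deriv i (local_rep c f) x)"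
    by (simp add: jac_def matrix_vector_mult_def vec_eq_iff mult.commute)
  then show ?thesis by (simp add: inner_sum_right assms)
qed

text \<open>In codimension one the second fundamental form is \<open>h\<close> times the normal, so
  the mean curvature vector is \<open>H\<close> times the normal and the speed is minus the normal
  divided by \<open>H\<close>. With \<open>k = h / H\<close> the size of the curvature disappears:
  \<open>k\<close> has trace 1, and this is the source of the universal growth rates.\<close>

lemma imcf_speed:
  assumes card: "CARD('k) = CARD('n) + 1" and conv: "strictly_convex A f" and c: "c \<in> A" "x \<in> chart_range c"
  defines "W \<equiv> - (mean_curvature_vector c f x /\<^sub>R (norm (mean_curvature_vector c f x))\<^sup>2)"
  obtains k :: "real^'n^'n" where
    "\<And>i. W \<bullet> partial_deriv i (local_rep c f) x = 0"
    "\<And>i j. W \<bullet> partial_deriv i (partial_deriv j (local_rep c f)) x = - k $ i $ j"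
    "\<And>v. v \<bullet> (k *v v) \<ge> 0"
    "(\<Sum>i\<in>UNIV. \<Sum>j\<in>UNIV. matrix_inv (g c x) $ i $ j * k $ i $ j) = 1"
proof -
  obtain \<nu> where \<nu>: "unit_normal_field A f \<nu>"
    and pd: "\<And>c x v. c \<in> A \<Longrightarrow> x \<in> chart_range c \<Longrightarrow> v \<noteq> 0 \<Longrightarrow> v \<bullet> (scalar_second_fundamental_form c f \<nu> x *v v) > 0"
    using conv unfolding strictly_convex_def by blast
  let ?d = "\<lambda>i. partial_deriv i (local_rep c f) x" and ?a = "matrix_inv (g c x)"
  define N where "N = local_rep c \<nu> x"
  define h where "h = scalar_second_fundamental_form c f \<nu> x"
  let ?II = "second_fundamental_form c f x"
  obtain p where p: "p \<in> fst c" "x = snd c p" using c by blast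
  have N: "norm N = 1" "N \<bullet> ?d i = 0" for i
    using \<nu> c(1) p by (auto simp: unit_normal_field_def N_def chart_local_rep[OF chart[OF c(1)]])
  have hd: "h $ i $ j = ?II i j \<bullet> N" for i j by (simp add: h_def scalar_second_fundamental_form_def N_def)
  have II: "?II i j = h $ i $ j *\<^sub>R N" for i j
    unfolding hd
    by (rule codimension_one[OF card jac_inj[OF c] N(1) jac_orthogonal[OF N(2)] jac_orthogonal])
      (auto simp: second_fundamental_form_def normal_part_orthogonal[OF c])
  define H where "H = (\<Sum>i\<in>UNIV. \<Sum>j\<in>UNIV. ?a $ i $ j * h $ i $ j)"
  have Hpos: "H > 0" unfolding H_def by (rule inv_g_trace_pos[OF c]) (use pd[OF c] h_def in blast)
  have mc: "mean_curvature_vector c f x = H *\<^sub>R N"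
    by (simp add: mean_curvature_vector_def II H_def scaleR_sum_left)
  have W: "W = - (1 / H) *\<^sub>R N"
    unfolding W_def mc using Hpos N(1) by (simp add: power2_eq_square field_simps)
  have NII: "N \<bullet> partial_deriv i (partial_deriv j (local_rep c f)) x = h $ i $ j" for i j
    unfolding hd second_fundamental_form_def normal_part_def
    by (simp add: inner_diff_left inner_sum_left inner_commute[of _ N] inner_diff_right inner_sum_right N(2))
  show thesis
  proof (rule that[of "(1 / H) *\<^sub>R h"])
    show "W \<bullet> ?d i = 0" for i by (simp add: W N(2))
    show "W \<bullet> partial_deriv i (partial_deriv j (local_rep c f)) x = - ((1 / H) *\<^sub>R h) $ i $ j" for i j
      by (simp add: W NII)
    show "v \<bullet> ((1 / H) *\<^sub>R h *v v) \<ge> 0" for v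
      using pd[OF c, of v] Hpos unfolding h_def[symmetric]
      by (cases "v = 0") (auto simp: scaleR_matrix_vector_assoc[symmetric])
    have "(\<Sum>i\<in>UNIV. \<Sum>j\<in>UNIV. ?a $ i $ j * ((1 / H) *\<^sub>R h) $ i $ j) = H / H"
      by (simp add: H_def[symmetric] sum_divide_distrib[symmetric])
    then show "(\<Sum>i\<in>UNIV. \<Sum>j\<in>UNIV. ?a $ i $ j * ((1 / H) *\<^sub>R h) $ i $ j) = 1" using Hpos by simp
  qed
qed

end

section \<open>Evolution of the metric\<close>

text \<open>The time derivative of a space derivative is found by differentiating
  \<open>F(x, t) = F(x, s) + \<integral> \<partial>\<^sub>tF(x, \<tau>) d\<tau>\<close> under the integral sign: at the initial time only one-sided
  derivatives are available.\<close>

lemma smooth_on_mixed_derivative: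
  fixes F :: "'a::euclidean_space \<times> real \<Rightarrow> 'b::euclidean_space"
  assumes F: "smooth_on (V \<times> I) F" and V: "open V" and I: "{s..t} \<subseteq> I" "s < t"
    and W: "\<And>x \<tau>. x \<in> V \<Longrightarrow> \<tau> \<in> {s..t} \<Longrightarrow> ((\<lambda>\<sigma>. F (x, \<sigma>)) has_vector_derivative W \<tau> x) (at \<tau> within {s..t})"
  obtains \<Theta> where
    "\<And>x \<tau>. x \<in> V \<Longrightarrow> \<tau> \<in> {s..t} \<Longrightarrow> ((W \<tau>) has_derivative (\<lambda>v. \<Theta> v x \<tau>)) (at x)"
    "\<And>x \<tau> v. x \<in> V \<Longrightarrow> \<tau> \<in> {s..t} \<Longrightarrow>
      ((\<lambda>\<sigma>. frechet_derivative (\<lambda>y. F (y, \<sigma>)) (at x) v) has_vector_derivative \<Theta> v x \<tau>) (at \<tau> within {s..t})"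
proof -
  \<comment> \<open>In the product space \<open>(0, 1)\<close> is the time direction and
    \<open>(v, 0)\<close> a space direction. Both derivatives are continuous up to the initial time
    because they are taken within \<open>V \<times> I\<close>.\<close>
  define \<Psi> where "\<Psi> z = frechet_derivative F (at z within V \<times> I) (0, 1)" for z
  define \<Theta> where "\<Theta> v x \<tau> = frechet_derivative \<Psi> (at (x, \<tau>) within V \<times> I) (v, 0)" for v x \<tau>
  have C2: "C_k_on (Suc (Suc 0)) (V \<times> I) F" using F by (simp only: smooth_on_def)
  have dF: "(F has_derivative frechet_derivative F (at z within V \<times> I)) (at z within V \<times> I)" if "z \<in> V \<times> I" for z
    using C2 that unfolding C_k_on.simps(2) frechet_derivative_works by blast
  have C1: "C_k_on (Suc 0) (V \<times> I) \<Psi>" using C2 unfolding \<Psi>_def[abs_def] by (subst (asm) C_k_on.simps(2)) blast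
  have d\<Psi>: "(\<Psi> has_derivative frechet_derivative \<Psi> (at z within V \<times> I)) (at z within V \<times> I)" if "z \<in> V \<times> I" for z
    using C1 that unfolding C_k_on.simps frechet_derivative_works by blast
  have c\<Psi>: "continuous_on (V \<times> I) (\<lambda>z. frechet_derivative \<Psi> (at z within V \<times> I) v)" for v
    using C1 unfolding C_k_on.simps by blast
  have c\<Psi>0: "continuous_on (V \<times> I) \<Psi>" using C1 by (rule C_k_on_Suc_continuous)
  have c\<Theta>: "continuous_on (V \<times> I) (\<lambda>(x, \<tau>). \<Theta> v x \<tau>)" for v
    using c\<Psi>[of "(v, 0)"] by (simp add: \<Theta>_def case_prod_unfold)
  have W\<Psi>: "W \<tau> x = \<Psi> (x, \<tau>)" if x: "x \<in> V" and \<tau>: "\<tau> \<in> {s..t}" for x \<tau>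
  proof -
    have z: "(x, \<tau>) \<in> V \<times> I" using x \<tau> I by auto
    have "((\<lambda>\<sigma>. (x, \<sigma>)) has_derivative (\<lambda>r. (0, r))) (at \<tau> within {s..t})"
      by (auto intro!: derivative_eq_intros)
    moreover have "(F has_derivative frechet_derivative F (at (x, \<tau>) within V \<times> I)) (at (x, \<tau>) within (\<lambda>\<sigma>. (x, \<sigma>)) ` {s..t})"
      by (rule has_derivative_subset[OF dF[OF z]]) (use x I in auto)
    ultimately have "(F \<circ> (\<lambda>\<sigma>. (x, \<sigma>)) has_derivative frechet_derivative F (at (x, \<tau>) within V \<times> I) \<circ> (\<lambda>r. (0, r))) (at \<tau> within {s..t})"
      by (rule diff_chain_within)
    moreover have "frechet_derivative F (at (x, \<tau>) within V \<times> I) (0, r) = r *\<^sub>R \<Psi> (x, \<tau>)" for r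
      using linear_scale[OF has_derivative_linear[OF dF[OF z]], of r "(0, 1)"] by (simp add: \<Psi>_def)
    ultimately have "((\<lambda>\<sigma>. F (x, \<sigma>)) has_vector_derivative \<Psi> (x, \<tau>)) (at \<tau> within {s..t})"
      by (simp add: has_vector_derivative_def o_def)
    then show ?thesis
      using vector_derivative_unique_within_closed_interval[OF I(2), of \<tau>] W[OF x \<tau>] \<tau> by auto
  qed
  have slice: "((\<lambda>y. G (y, \<tau>)) has_derivative (\<lambda>v. D (v, 0))) (at x)"
    if "(G has_derivative D) (at (x, \<tau>) within V \<times> I)" and x: "x \<in> V" and \<tau>: "\<tau> \<in> {s..t}" for G :: "'a \<times> real \<Rightarrow> 'b" and D x \<tau>
  proof -
    have "((\<lambda>y. (y, \<tau>)) has_derivative (\<lambda>v. (v, 0))) (at x within V)"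
      by (auto intro!: derivative_eq_intros)
    moreover have "(G has_derivative D) (at (x, \<tau>) within (\<lambda>y. (y, \<tau>)) ` V)"
      by (rule has_derivative_subset[OF that(1)]) (use \<tau> I in auto)
    ultimately have "(G \<circ> (\<lambda>y. (y, \<tau>)) has_derivative D \<circ> (\<lambda>v. (v, 0))) (at x within V)"
      by (rule diff_chain_within)
    then show ?thesis using at_within_open[OF x V] by (simp add: o_def)
  qed
  have d\<Psi>x: "((\<lambda>y. \<Psi> (y, \<tau>)) has_derivative (\<lambda>v. \<Theta> v x \<tau>)) (at x)" if x: "x \<in> V" and \<tau>: "\<tau> \<in> {s..t}" for x \<tau>
    unfolding \<Theta>_def by (rule slice[OF d\<Psi> x \<tau>]) (use x \<tau> I in auto)
  show thesis
  proof (rule that[of \<Theta>])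
    show "((W \<tau>) has_derivative (\<lambda>v. \<Theta> v x \<tau>)) (at x)" if "x \<in> V" "\<tau> \<in> {s..t}" for x \<tau>
      by (rule has_derivative_transform_within_open[OF d\<Psi>x[OF that] V that(1)]) (rule W\<Psi>[OF _ that(2), symmetric])
    fix x v :: 'a and \<tau> assume x: "x \<in> V" and \<tau>: "\<tau> \<in> {s..t}"
    obtain e where e: "e > 0" "ball x e \<subseteq> V" using V x openE by blast
    \<comment> \<open>Adding 1 covers \<open>v = 0\<close>; with \<open>d = e / (2 * a)\<close> the
      whole segment \<open>l\<close> stays in the ball.\<close>
    define a where "a = norm v + 1"
    have a: "a > 0" by (simp add: a_def add_nonneg_pos)
    define d where "d = e / (2 * a)"
    have d: "d > 0" using e(1) a by (simp add: d_def)
    define l where "l r = x + r *\<^sub>R v" for r :: real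
    have lV: "l r \<in> V" if "r \<in> {-d..d}" for r
    proof -
      have "norm (r *\<^sub>R v) \<le> d * norm v" using that by (auto intro!: mult_right_mono)
      also have "\<dots> \<le> d * a" using d by (simp add: a_def)
      also have "\<dots> = e / 2" using a by (simp add: d_def)
      also have "\<dots> < e" using e(1) by simp
      finally show ?thesis using e(2) by (auto simp: l_def dist_norm)
    qed
    have l0: "l 0 = x" by (simp add: l_def)
    have ld: "(l has_derivative (\<lambda>r. r *\<^sub>R v)) (at r within S)" for r S
      unfolding l_def[abs_def] by (auto intro!: derivative_eq_intros)
    have lc: "continuous_on S l" for S unfolding l_def[abs_def] by (intro continuous_intros)
    have F1: "F (y, \<sigma>) = F (y, s) + integral (cbox s \<sigma>) (\<lambda>\<tau>. \<Psi> (y, \<tau>))" if y: "y \<in> V" and \<sigma>: "\<sigma> \<in> {s..t}" for y \<sigma>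
    proof -
      have "((\<lambda>\<tau>. \<Psi> (y, \<tau>)) has_integral (F (y, \<sigma>) - F (y, s))) {s..\<sigma>}"
      proof (rule fundamental_theorem_of_calculus)
        fix \<tau> assume "\<tau> \<in> {s..\<sigma>}"
        then have "\<tau> \<in> {s..t}" using \<sigma> by auto
        from W[OF y this] W\<Psi>[OF y this]
        show "((\<lambda>\<sigma>. F (y, \<sigma>)) has_vector_derivative \<Psi> (y, \<tau>)) (at \<tau> within {s..\<sigma>})"
          using has_vector_derivative_within_subset[of _ _ _ "{s..t}" "{s..\<sigma>}"] \<sigma> by auto
      qed (use \<sigma> in auto)
      then show ?thesis by (simp add: integral_unique)
    qed
    have drl: "((\<lambda>r. F (l r, \<sigma>)) has_vector_derivative frechet_derivative (\<lambda>y. F (y, \<sigma>)) (at x) v) (at 0 within {-d..d})"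
      if \<sigma>: "\<sigma> \<in> {s..t}" for \<sigma>
    proof -
      have "((\<lambda>y. F (y, \<sigma>)) has_derivative (\<lambda>v. frechet_derivative F (at (x, \<sigma>) within V \<times> I) (v, 0))) (at x)"
        by (rule slice[OF dF x \<sigma>]) (use x \<sigma> I in auto)
      then have D: "((\<lambda>y. F (y, \<sigma>)) has_derivative frechet_derivative (\<lambda>y. F (y, \<sigma>)) (at x)) (at x)"
        using differentiableI frechet_derivative_works by blast
      have "((\<lambda>y. F (y, \<sigma>)) \<circ> l has_derivative frechet_derivative (\<lambda>y. F (y, \<sigma>)) (at x) \<circ> (\<lambda>r. r *\<^sub>R v)) (at 0 within {-d..d})"
        by (rule diff_chain_within[OF ld]) (use D l0 has_derivative_at_withinI in auto)
      then show ?thesis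
        unfolding has_vector_derivative_def o_def
        using linear_scale[OF has_derivative_linear[OF D]] by simp
    qed
    \<comment> \<open>Both sides are the derivative of \<open>F (l r, \<sigma>)\<close> at
      \<open>r = 0\<close>, once taken directly and once by differentiating \<open>F1\<close> under
      the integral sign along the segment.\<close>
    have E: "frechet_derivative (\<lambda>y. F (y, \<sigma>)) (at x) v =
        frechet_derivative (\<lambda>y. F (y, s)) (at x) v + integral {s..\<sigma>} (\<lambda>\<tau>. \<Theta> v x \<tau>)" if \<sigma>: "\<sigma> \<in> {s..t}" for \<sigma>
    proof -
      have sI: "cbox s \<sigma> \<subseteq> I" using \<sigma> I(1) by auto
      have "((\<lambda>r. integral (cbox s \<sigma>) (\<lambda>\<tau>. \<Psi> (l r, \<tau>))) has_vector_derivative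
          integral (cbox s \<sigma>) (\<lambda>\<tau>. \<Theta> v (l 0) \<tau>)) (at 0 within {-d..d})"
      proof (rule leibniz_rule_vector_derivative)
        fix r \<tau> assume r: "r \<in> {-d..d}" and \<tau>: "\<tau> \<in> cbox s \<sigma>"
        then have \<tau>': "\<tau> \<in> {s..t}" using \<sigma> by auto
        have D: "((\<lambda>y. \<Psi> (y, \<tau>)) has_derivative (\<lambda>v. \<Theta> v (l r) \<tau>)) (at (l r))"
          by (rule d\<Psi>x[OF lV[OF r] \<tau>'])
        have "((\<lambda>y. \<Psi> (y, \<tau>)) \<circ> l has_derivative (\<lambda>v. \<Theta> v (l r) \<tau>) \<circ> (\<lambda>r. r *\<^sub>R v)) (at r within {-d..d})"
          by (rule diff_chain_within[OF ld has_derivative_at_withinI[OF D]])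
        then show "((\<lambda>r. \<Psi> (l r, \<tau>)) has_vector_derivative \<Theta> v (l r) \<tau>) (at r within {-d..d})"
          unfolding has_vector_derivative_def o_def
          using linear_scale[OF has_derivative_linear[OF D]] by simp
      next
        fix r assume r: "r \<in> {-d..d}"
        have "continuous_on (cbox s \<sigma>) (\<lambda>\<tau>. \<Psi> (l r, \<tau>))"
          by (rule continuous_on_compose2[OF c\<Psi>0]) (use lV[OF r] sI in \<open>auto intro!: continuous_intros\<close>)
        then show "(\<lambda>\<tau>. \<Psi> (l r, \<tau>)) integrable_on cbox s \<sigma>" by (rule integrable_continuous)
      next
        have "continuous_on ({-d..d} \<times> cbox s \<sigma>) (\<lambda>z. (\<lambda>(x, \<tau>). \<Theta> v x \<tau>) (l (fst z), snd z))"
          by (rule continuous_on_compose2[OF c\<Theta>[of v]])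
            (use lV sI in \<open>auto intro!: continuous_intros continuous_on_compose2[OF lc]\<close>)
        then show "continuous_on ({-d..d} \<times> cbox s \<sigma>) (\<lambda>(r, \<tau>). \<Theta> v (l r) \<tau>)"
          by (simp add: case_prod_unfold)
      qed (use d in auto)
      then have "((\<lambda>r. F (l r, s) + integral (cbox s \<sigma>) (\<lambda>\<tau>. \<Psi> (l r, \<tau>))) has_vector_derivative
          frechet_derivative (\<lambda>y. F (y, s)) (at x) v + integral (cbox s \<sigma>) (\<lambda>\<tau>. \<Theta> v (l 0) \<tau>)) (at 0 within {-d..d})"
        by (intro has_vector_derivative_add drl) (use I(2) in auto)
      then have "((\<lambda>r. F (l r, \<sigma>)) has_vector_derivative
          frechet_derivative (\<lambda>y. F (y, s)) (at x) v + integral (cbox s \<sigma>) (\<lambda>\<tau>. \<Theta> v (l 0) \<tau>)) (at 0 within {-d..d})"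
        by (rule has_vector_derivative_transform[rotated 2]) (use d F1[OF lV \<sigma>] in auto)
      then show ?thesis
        using vector_derivative_unique_within_closed_interval[of "-d" d 0] drl[OF \<sigma>] d l0 by auto
    qed
    have "continuous_on {s..t} (\<lambda>\<tau>. (\<lambda>(x, \<tau>). \<Theta> v x \<tau>) (x, \<tau>))"
      by (rule continuous_on_compose2[OF c\<Theta>[of v]]) (use x I in \<open>auto intro!: continuous_intros\<close>)
    then have d: "((\<lambda>\<sigma>. frechet_derivative (\<lambda>y. F (y, s)) (at x) v + integral {s..\<sigma>} (\<lambda>\<tau>. \<Theta> v x \<tau>))
        has_vector_derivative 0 + \<Theta> v x \<tau>) (at \<tau> within {s..t})"
      using \<tau> by (intro has_vector_derivative_add has_vector_derivative_const integral_has_vector_derivative) auto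
    show "((\<lambda>\<sigma>. frechet_derivative (\<lambda>y. F (y, \<sigma>)) (at x) v) has_vector_derivative \<Theta> v x \<tau>) (at \<tau> within {s..t})"
    proof (rule has_vector_derivative_transform[OF \<tau>])
      show "frechet_derivative (\<lambda>y. F (y, \<sigma>)) (at x) v =
          frechet_derivative (\<lambda>y. F (y, s)) (at x) v + integral {s..\<sigma>} (\<lambda>\<tau>. \<Theta> v x \<tau>)"
        if "\<sigma> \<in> {s..t}" for \<sigma> by (rule E[OF that])
    qed (use d in simp)
  qed
qed

section \<open>Differential inequalities on an interval\<close>

lemma nondecreasing_within:
  fixes f :: "real \<Rightarrow> real"
  assumes "s \<le> t" "\<And>\<tau>. \<tau> \<in> {s..t} \<Longrightarrow> (f has_real_derivative f' \<tau>) (at \<tau> within {s..t})"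
    "\<And>\<tau>. \<tau> \<in> {s..t} \<Longrightarrow> f' \<tau> \<ge> 0"
  shows "f s \<le> f t"
proof (cases "s = t")
  case False
  then have "s < t" using assms(1) by simp
  from mvt_simple[OF this, of f "\<lambda>\<tau>. (*) (f' \<tau>)"] assms(2)
  obtain z where "z \<in> {s<..<t}" "f t - f s = f' z * (t - s)"
    by (auto simp: has_field_derivative_def)
  then show ?thesis using assms(3)[of z] \<open>s < t\<close> by (smt (verit) atLeastAtMost_iff greaterThanLessThan_iff mult_nonneg_nonneg)
qed simp

text \<open>The integrating factor \<open>exp (- a * \<tau>)\<close> makes the product with
  \<open>f\<close> nonincreasing, whatever the sign of \<open>f\<close>.\<close>

lemma exp_growth_le:
  fixes f :: "real \<Rightarrow> real"
  assumes st: "s \<le> t" and d: "\<And>\<tau>. \<tau> \<in> {s..t} \<Longrightarrow> (f has_real_derivative f' \<tau>) (at \<tau> within {s..t})"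
    and le: "\<And>\<tau>. \<tau> \<in> {s..t} \<Longrightarrow> f' \<tau> \<le> a * f \<tau>"
  shows "f t \<le> exp (a * (t - s)) * f s"
proof -
  have "- (exp (- a * s) * f s) \<le> - (exp (- a * t) * f t)"
  proof (rule nondecreasing_within[OF st])
    fix \<tau> assume \<tau>: "\<tau> \<in> {s..t}"
    show "((\<lambda>\<tau>. - (exp (- a * \<tau>) * f \<tau>)) has_real_derivative exp (- a * \<tau>) * (a * f \<tau> - f' \<tau>)) (at \<tau> within {s..t})"
      by (rule derivative_eq_intros d[OF \<tau>] refl)+ (simp add: algebra_simps)
    show "exp (- a * \<tau>) * (a * f \<tau> - f' \<tau>) \<ge> 0" using le[OF \<tau>] by simp
  qed
  then have le': "exp (a * t) * (exp (- a * t) * f t) \<le> exp (a * t) * (exp (- a * s) * f s)"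
    by (intro mult_left_mono) auto
  have e1: "exp (a * t) * (exp (- a * t) * f t) = f t"
    by (simp add: exp_minus)
  have e2: "exp (a * t) * (exp (- a * s) * f s) = exp (a * (t - s)) * f s"
    by (simp add: exp_minus exp_diff right_diff_distrib divide_inverse)
  show ?thesis using le' unfolding e1 e2 .
qed

lemma has_real_derivative_inner:
  fixes f g :: "real \<Rightarrow> 'a::real_inner"
  assumes "(f has_vector_derivative f') (at t within S)" "(g has_vector_derivative g') (at t within S)"
  shows "((\<lambda>t. f t \<bullet> g t) has_real_derivative f t \<bullet> g' + f' \<bullet> g t) (at t within S)"
  using bounded_bilinear.has_vector_derivative[OF bounded_bilinear_inner assms]
  by (simp add: has_real_derivative_iff_has_vector_derivative)

section \<open>Metric, volume and rigidity along a strictly convex flow\<close>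

locale convex_imcf =
  fixes A :: "('m::{t2_space, second_countable_topology}, 'n::finite) chart set"
    and T :: ereal and \<phi> :: "real \<Rightarrow> 'm \<Rightarrow> real^'k::finite"
  assumes card: "CARD('k) = CARD('n) + 1" and atlas: "smooth_atlas A"
    and flow: "inverse_mean_curvature_flow A (time_interval T) \<phi>"
    and convex: "\<And>t. t \<in> time_interval T \<Longrightarrow> strictly_convex A (\<phi> t)"
begin

lemma immersed: "t \<in> time_interval T \<Longrightarrow> immersed_manifold A (\<phi> t)"
  using atlas flow by (simp add: immersed_manifold_def inverse_mean_curvature_flow_def)

lemma interval_subset: "s \<in> time_interval T \<Longrightarrow> t \<in> time_interval T \<Longrightarrow> {s..t} \<subseteq> time_interval T"
  by (auto simp: time_interval_def) (metis ereal_less_eq(3) order_le_less_trans)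

text \<open>The time derivative of the metric consists of the pairing of the space derivative of the
  speed in direction \<open>i\<close> with the tangent vector \<open>j\<close>, and the same with
  \<open>i\<close> and \<open>j\<close> exchanged. As the speed is normal, differentiating its
  vanishing product with the tangent vector \<open>j\<close> moves the derivative off the speed:
  what remains is minus the speed paired with a second derivative of the immersion, which is
  \<open>k $ i $ j\<close>.\<close>

lemma metric_derivative:
  assumes s: "s \<in> time_interval T" and t: "t \<in> time_interval T" and st: "s < t"
    and c: "c \<in> A" "x \<in> chart_range c" and \<tau>: "\<tau> \<in> {s..t}"
  shows "\<exists>M :: real^'n^'n.
    (\<forall>i j. ((\<lambda>\<sigma>. induced_metric (\<phi> \<sigma>) c x $ i $ j) has_real_derivative M $ i $ j) (at \<tau> within {s..t})) \<and>
    (\<forall>v. 0 \<le> v \<bullet> (M *v v)) \<and> (\<forall>v. v \<bullet> (M *v v) \<le> 2 * (v \<bullet> (induced_metric (\<phi> \<tau>) c x *v v))) \<and>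
    (\<Sum>k\<in>UNIV. (M ** matrix_inv (induced_metric (\<phi> \<tau>) c x)) $ k $ k) = 2"
proof -
  have I: "{s..t} \<subseteq> time_interval T" by (rule interval_subset[OF s t])
  have \<tau>I: "\<tau> \<in> time_interval T" using I \<tau> by blast
  interpret immersed_manifold A "\<phi> \<tau>" by (rule immersed[OF \<tau>I])
  let ?F = "\<lambda>(x, t). local_rep c (\<phi> t) x"
  let ?W = "\<lambda>\<tau> x. - (mean_curvature_vector c (\<phi> \<tau>) x /\<^sub>R (norm (mean_curvature_vector c (\<phi> \<tau>) x))\<^sup>2)"
  let ?d = "\<lambda>i. partial_deriv i (local_rep c (\<phi> \<tau>))"
  have V: "open (chart_range c)" by (rule chart_range_open[OF chart[OF c(1)]])
  have sm: "smooth_on (chart_range c \<times> time_interval T) ?F"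
    using flow c(1) by (simp add: inverse_mean_curvature_flow_def)
  have Wd: "((\<lambda>\<sigma>. ?F (y, \<sigma>)) has_vector_derivative ?W \<sigma> y) (at \<sigma> within {s..t})"
    if y: "y \<in> chart_range c" and \<sigma>: "\<sigma> \<in> {s..t}" for y \<sigma>
  proof -
    obtain p where p: "p \<in> fst c" "y = snd c p" using y by blast
    have "((\<lambda>\<sigma>. \<phi> \<sigma> p) has_vector_derivative ?W \<sigma> (snd c p)) (at \<sigma> within time_interval T)"
      using flow c(1) p(1) I \<sigma> unfolding inverse_mean_curvature_flow_def by blast
    from has_vector_derivative_within_subset[OF this I]
    show ?thesis by (simp add: p(2) chart_local_rep[OF chart[OF c(1)] p(1)])
  qed
  obtain \<Theta> where \<Theta>: "\<And>y \<sigma>. y \<in> chart_range c \<Longrightarrow> \<sigma> \<in> {s..t} \<Longrightarrow> ((?W \<sigma>) has_derivative (\<lambda>v. \<Theta> v y \<sigma>)) (at y)"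
    "\<And>y \<sigma> v. y \<in> chart_range c \<Longrightarrow> \<sigma> \<in> {s..t} \<Longrightarrow>
      ((\<lambda>\<sigma>. frechet_derivative (\<lambda>y. ?F (y, \<sigma>)) (at y) v) has_vector_derivative \<Theta> v y \<sigma>) (at \<sigma> within {s..t})"
    using smooth_on_mixed_derivative[OF sm V I st, of ?W] Wd by blast
  obtain k :: "real^'n^'n" where k: "\<And>i j. ?W \<tau> x \<bullet> partial_deriv i (?d j) x = - k $ i $ j"
    "\<And>v. v \<bullet> (k *v v) \<ge> 0" "(\<Sum>i\<in>UNIV. \<Sum>j\<in>UNIV. matrix_inv (g c x) $ i $ j * k $ i $ j) = 1"
    by (rule imcf_speed[OF card convex[OF \<tau>I] c], rule that)
  have normal: "?W \<tau> y \<bullet> ?d i y = 0" if "y \<in> chart_range c" for y i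
    by (rule imcf_speed[OF card convex[OF \<tau>I] c(1) that])
  have dt: "((\<lambda>\<sigma>. partial_deriv i (local_rep c (\<phi> \<sigma>)) x) has_vector_derivative \<Theta> (axis i 1) x \<tau>) (at \<tau> within {s..t})" for i
    using \<Theta>(2)[OF c(2) \<tau>, of "axis i 1"] by (simp add: partial_deriv_def)
  have tn: "\<Theta> (axis i 1) x \<tau> \<bullet> ?d j x = k $ i $ j" for i j
  proof -
    have dd: "?d j differentiable (at x)" by (rule C1_on_differentiable[OF f_partial_C1[OF c(1)] c(2)])
    have "((\<lambda>y. ?W \<tau> y \<bullet> ?d j y) has_derivative
        (\<lambda>v. ?W \<tau> x \<bullet> frechet_derivative (?d j) (at x) v + \<Theta> v x \<tau> \<bullet> ?d j x)) (at x)"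
      using dd by (intro has_derivative_inner \<Theta>(1) c \<tau>) (simp add: frechet_derivative_works[symmetric])
    moreover have "((\<lambda>y. ?W \<tau> y \<bullet> ?d j y) has_derivative (\<lambda>v. 0)) (at x)"
      by (rule has_derivative_transform_within_open[OF has_derivative_const V c(2)]) (rule normal[symmetric])
    ultimately have "(\<lambda>v. ?W \<tau> x \<bullet> frechet_derivative (?d j) (at x) v + \<Theta> v x \<tau> \<bullet> ?d j x) = (\<lambda>v. 0)"
      by (rule has_derivative_unique)
    from fun_cong[OF this, of "axis i 1"] show ?thesis
      using k(1)[of i j] by (simp add: partial_deriv_def)
  qed
  \<comment> \<open>The two product-rule terms are \<open>k\<close> and its transpose. In the
    quadratic form, and in the trace against the symmetric inverse metric, they count as twice
    \<open>k\<close>; hence the constants 2.\<close>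
  define M where "M = k + transpose k"
  have qf: "v \<bullet> (M *v v) = 2 * (v \<bullet> (k *v v))" for v
    using inner_transpose[of k v v] by (simp only: M_def matrix_vector_mult_add_rdistrib inner_add_right inner_commute)
  show ?thesis
  proof (intro exI[of _ M] conjI allI)
    show "((\<lambda>\<sigma>. induced_metric (\<phi> \<sigma>) c x $ i $ j) has_real_derivative M $ i $ j) (at \<tau> within {s..t})" for i j
      using has_real_derivative_inner[OF dt[of i] dt[of j]] tn[of i j] tn[of j i]
      by (simp add: induced_metric_def M_def transpose_def inner_commute add.commute)
    show "0 \<le> v \<bullet> (M *v v)" for v unfolding qf using k(2) by simp
    show "v \<bullet> (M *v v) \<le> 2 * (v \<bullet> (g c x *v v))" for v
      unfolding qf using trace_bound[OF c k(2), of v] k(3) by simp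
    have sym: "matrix_inv (g c x) $ i $ j = matrix_inv (g c x) $ j $ i" for i j
      unfolding inv_g_gram[OF c] by (simp add: mult.commute)
    have "(\<Sum>i\<in>UNIV. \<Sum>j\<in>UNIV. k $ j $ i * matrix_inv (g c x) $ j $ i) = 1"
      using k(3) by (subst sum.swap) (simp add: mult.commute)
    then show "(\<Sum>i\<in>UNIV. (M ** matrix_inv (g c x)) $ i $ i) = 2"
      using k(3) by (simp add: M_def matrix_matrix_mult_def transpose_def sum.distrib distrib_right distrib_left sym[of _ i for i] mult.commute)
  qed
qed

text \<open>The rate 2 enters twice: as the bound of the derivative by twice the metric, and as its
  trace, which by Jacobi's formula makes the derivative of the determinant twice the determinant.
  The growth bound applied to the determinant and to its negative gives equality.\<close>

lemma metric_growth:
  assumes s: "s \<in> time_interval T" and t: "t \<in> time_interval T" and st: "s \<le> t"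
    and c: "c \<in> A" "x \<in> chart_range c"
  shows "v \<bullet> (induced_metric (\<phi> s) c x *v v) \<le> v \<bullet> (induced_metric (\<phi> t) c x *v v)"
    and "v \<bullet> (induced_metric (\<phi> t) c x *v v) \<le> exp (2 * (t - s)) * (v \<bullet> (induced_metric (\<phi> s) c x *v v))"
    and "det (induced_metric (\<phi> t) c x) = exp (2 * (t - s)) * det (induced_metric (\<phi> s) c x)"
proof -
  let ?G = "\<lambda>\<sigma>. induced_metric (\<phi> \<sigma>) c x"
  have "v \<bullet> (?G s *v v) \<le> v \<bullet> (?G t *v v) \<and> v \<bullet> (?G t *v v) \<le> exp (2 * (t - s)) * (v \<bullet> (?G s *v v)) \<and>
    det (?G t) = exp (2 * (t - s)) * det (?G s)"
  proof (cases "s = t")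
    case False
    then have st': "s < t" using st by simp
    have "\<forall>\<tau>\<in>{s..t}. \<exists>M. (\<forall>i j. ((\<lambda>\<sigma>. ?G \<sigma> $ i $ j) has_real_derivative M $ i $ j) (at \<tau> within {s..t})) \<and>
      (\<forall>v. 0 \<le> v \<bullet> (M *v v)) \<and> (\<forall>v. v \<bullet> (M *v v) \<le> 2 * (v \<bullet> (?G \<tau> *v v))) \<and>
      (\<Sum>k\<in>UNIV. (M ** matrix_inv (?G \<tau>)) $ k $ k) = 2"
      using metric_derivative[OF s t st' c] by (rule ballI)
    from bchoice[OF this] obtain M where
      M: "\<And>\<tau> i j. \<tau> \<in> {s..t} \<Longrightarrow> ((\<lambda>\<sigma>. ?G \<sigma> $ i $ j) has_real_derivative M \<tau> $ i $ j) (at \<tau> within {s..t})"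
        "\<And>\<tau> v. \<tau> \<in> {s..t} \<Longrightarrow> 0 \<le> v \<bullet> (M \<tau> *v v)"
        "\<And>\<tau> v. \<tau> \<in> {s..t} \<Longrightarrow> v \<bullet> (M \<tau> *v v) \<le> 2 * (v \<bullet> (?G \<tau> *v v))"
        "\<And>\<tau>. \<tau> \<in> {s..t} \<Longrightarrow> (\<Sum>k\<in>UNIV. (M \<tau> ** matrix_inv (?G \<tau>)) $ k $ k) = 2"
      by blast
    have qd: "((\<lambda>\<sigma>. v \<bullet> (?G \<sigma> *v v)) has_real_derivative v \<bullet> (M \<tau> *v v)) (at \<tau> within {s..t})" if "\<tau> \<in> {s..t}" for \<tau>
      unfolding inner_matrix_vector by (intro DERIV_sum DERIV_cmult_right M(1) that)
    have dd: "((\<lambda>\<sigma>. det (?G \<sigma>)) has_real_derivative 2 * det (?G \<tau>)) (at \<tau> within {s..t})" if "\<tau> \<in> {s..t}" for \<tau>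
    proof -
      have "\<tau> \<in> time_interval T" using interval_subset[OF s t] that by blast
      then have "det (?G \<tau>) \<noteq> 0" using immersed_manifold.det_g_pos[OF immersed c] by fastforce
      from has_real_derivative_det[OF M(1)[OF that] this] M(4)[OF that] show ?thesis by simp
    qed
    have "v \<bullet> (?G s *v v) \<le> v \<bullet> (?G t *v v)"
      by (rule nondecreasing_within[OF st qd M(2)])
    moreover have "v \<bullet> (?G t *v v) \<le> exp (2 * (t - s)) * (v \<bullet> (?G s *v v))"
      by (rule exp_growth_le[OF st qd M(3)])
    moreover have "det (?G t) \<le> exp (2 * (t - s)) * det (?G s)"
      by (rule exp_growth_le[OF st dd]) auto
    moreover have "- det (?G t) \<le> exp (2 * (t - s)) * (- det (?G s))"
      by (rule exp_growth_le[OF st DERIV_minus[OF dd]]) auto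
    ultimately show ?thesis by auto
  qed simp
  then show "v \<bullet> (?G s *v v) \<le> v \<bullet> (?G t *v v)" "v \<bullet> (?G t *v v) \<le> exp (2 * (t - s)) * (v \<bullet> (?G s *v v))"
    "det (?G t) = exp (2 * (t - s)) * det (?G s)" by auto
qed

lemma volume_growth:
  assumes s: "s \<in> time_interval T" and t: "t \<in> time_interval T" and st: "s \<le> t"
  shows "riemannian_volume A (induced_metric (\<phi> t)) =
    density (riemannian_volume A (induced_metric (\<phi> s))) (\<lambda>_. ennreal (exp (t - s)))"
proof (rule volume_scale[OF immersed[OF s] immersed[OF t]])
  fix c :: "('m, 'n) chart" and x assume c: "c \<in> A" "x \<in> chart_range c"
  have "sqrt (exp (2 * (t - s))) = exp (t - s)"
    by (rule real_sqrt_unique) (auto simp: power2_eq_square exp_add[symmetric])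
  then show "sqrt (det (induced_metric (\<phi> t) c x)) = exp (t - s) * sqrt (det (induced_metric (\<phi> s) c x))"
    unfolding metric_growth(3)[OF s t st c] real_sqrt_mult by simp
qed simp

lemma torsional_rigidity_growth:
  assumes s: "s \<in> time_interval T" and t: "t \<in> time_interval T" and st: "s \<le> t"
    and \<Omega>: "open \<Omega>" "compact (closure \<Omega>)"
    and E: "torsion_function A (induced_metric (\<phi> s)) \<Omega> u" "torsion_function A (induced_metric (\<phi> t)) \<Omega> w"
  defines "\<mu> \<equiv> riemannian_volume A (induced_metric (\<phi> s))" and "\<mu>' \<equiv> riemannian_volume A (induced_metric (\<phi> t))"
  shows "measure \<mu>' \<Omega> = exp (t - s) * measure \<mu> \<Omega>"
    and "exp (t - s) * (LINT p:\<Omega>|\<mu>. u p) \<le> (LINT p:\<Omega>|\<mu>'. w p)"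
    and "(LINT p:\<Omega>|\<mu>'. w p) \<le> exp (3 * (t - s)) * (LINT p:\<Omega>|\<mu>. u p)"
proof -
  interpret S: immersed_manifold A "\<phi> s" by (rule immersed[OF s])
  interpret T: immersed_manifold A "\<phi> t" by (rule immersed[OF t])
  define e where "e = exp (t - s)"
  have e: "e > 0" by (simp add: e_def)
  have vol: "\<mu>' = density \<mu> (\<lambda>_. ennreal e)"
    unfolding \<mu>_def \<mu>'_def e_def by (rule volume_growth[OF s t st])
  have "density \<mu>' (\<lambda>_. ennreal (1 / e)) = density \<mu> (\<lambda>_. ennreal e * ennreal (1 / e))"
    unfolding vol by (rule density_density_eq) auto
  also have "ennreal e * ennreal (1 / e) = 1" using e by (simp add: ennreal_mult[symmetric])
  finally have vol': "\<mu> = density \<mu>' (\<lambda>_. ennreal (1 / e))" by (simp add: density_1)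
  have \<Omega>b: "\<Omega> \<in> sets borel" using \<Omega>(1) by auto
  show "measure \<mu>' \<Omega> = exp (t - s) * measure \<mu> \<Omega>"
    using \<Omega>b e unfolding vol e_def[symmetric]
    by (simp add: measure_def emeasure_density_const \<mu>_def enn2real_mult)
  have int: "(LINT p:\<Omega>|\<mu>'. F p) = e * (LINT p:\<Omega>|\<mu>. F p)" if "set_integrable \<mu> \<Omega> F" for F :: "'m \<Rightarrow> real"
    unfolding vol set_lebesgue_integral_def
    by (subst integral_density) (use that e in \<open>auto simp: set_integrable_def\<close>)
  have iu: "set_integrable \<mu> \<Omega> u" unfolding \<mu>_def by (rule S.integrable_torsion[OF \<Omega> E(1)])
  have iw: "set_integrable \<mu> \<Omega> w"
  proof (rule set_integrable_subset)
    show "set_integrable \<mu> (closure \<Omega>) w"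
      unfolding \<mu>_def using E(2) by (intro S.integrable_vol_compact \<Omega>) (simp add: torsion_function_def)
  qed (use \<Omega>b closure_subset in \<open>auto simp: \<mu>_def\<close>)
  \<comment> \<open>Both integrals are taken against \<open>\<mu>\<close>; passing to
    \<open>\<mu>'\<close> on the left contributes one more factor \<open>e\<close>, which makes the
    exponent 3.\<close>
  have "(LINT p:\<Omega>|\<mu>. w p) \<le> exp (2 * (t - s)) * (LINT p:\<Omega>|\<mu>. u p)"
    unfolding \<mu>_def
    by (rule torsion_comparison[OF immersed[OF s] immersed[OF t] \<Omega> E e vol[unfolded \<mu>_def \<mu>'_def]])
      (use metric_growth(2)[OF s t st] in auto)
  then have "e * (LINT p:\<Omega>|\<mu>. w p) \<le> e * (exp (2 * (t - s)) * (LINT p:\<Omega>|\<mu>. u p))"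
    using e by simp
  also have "\<dots> = exp (3 * (t - s)) * (LINT p:\<Omega>|\<mu>. u p)"
    by (simp add: e_def mult.assoc[symmetric] exp_add[symmetric])
  finally show "(LINT p:\<Omega>|\<mu>'. w p) \<le> exp (3 * (t - s)) * (LINT p:\<Omega>|\<mu>. u p)" by (simp add: int[OF iw])
  \<comment> \<open>With the times exchanged, the monotone growth of the metric allows the constant
    1, and the volumes are related by \<open>1 / e\<close>.\<close>
  have "(LINT p:\<Omega>|\<mu>'. u p) \<le> 1 * (LINT p:\<Omega>|\<mu>'. w p)"
    unfolding \<mu>'_def
    by (rule torsion_comparison[OF immersed[OF t] immersed[OF s] \<Omega> E(2,1) _ vol'[unfolded \<mu>_def \<mu>'_def]])
      (use metric_growth(1)[OF s t st] e in auto)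
  then show "exp (t - s) * (LINT p:\<Omega>|\<mu>. u p) \<le> (LINT p:\<Omega>|\<mu>'. w p)"
    by (simp add: int[OF iu] e_def)
qed

end

theorem theorem2:
  fixes A :: "('m::{t2_space, second_countable_topology}, 'n::finite) chart set"
    and \<Omega> :: "'m set"
    and T :: ereal
    and \<phi> :: "real \<Rightarrow> 'm \<Rightarrow> real^'k"
    and E :: "real \<Rightarrow> 'm \<Rightarrow> real"
  assumes "CARD('k) = CARD('n) + 1"
    and "smooth_atlas A"
    and "open \<Omega>" and "connected \<Omega>" and "compact (closure \<Omega>)"
    and "smooth_boundary A \<Omega>" and "frontier \<Omega> \<noteq> {}"
    and "0 < T"
    and "inverse_mean_curvature_flow A (time_interval T) \<phi>"
    and "\<And>t. t \<in> time_interval T \<Longrightarrow> strictly_convex A (\<phi> t)"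
    and "\<And>t. t \<in> time_interval T \<Longrightarrow> torsion_function A (induced_metric (\<phi> t)) \<Omega> (E t)"
  defines "vol \<equiv> \<lambda>t. riemannian_volume A (induced_metric (\<phi> t))"
  defines "V \<equiv> \<lambda>t. measure (vol t) \<Omega>"
    and "TR \<equiv> \<lambda>t. (LINT p:\<Omega>|vol t. E t p)"
  shows "antimono_on (time_interval T) (\<lambda>t. V t powi (-3) * TR t) \<and>
    mono_on (time_interval T) (\<lambda>t. V t powi (-1) * TR t)"
proof -
  interpret convex_imcf A T \<phi> using assms by unfold_locales auto
  have growth: "V t = exp (t - s) * V s" "exp (t - s) * TR s \<le> TR t" "TR t \<le> exp (3 * (t - s)) * TR s"
    if "s \<in> time_interval T" "t \<in> time_interval T" "s \<le> t" for s t
    using torsional_rigidity_growth[OF that assms(3,5) assms(11)[OF that(1)] assms(11)[OF that(2)]]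
    by (simp_all add: V_def TR_def vol_def)
  have Vnn: "V t \<ge> 0" for t by (simp add: V_def)
  have "V t powi (-3) * TR t \<le> V s powi (-3) * TR s \<and> V s powi (-1) * TR s \<le> V t powi (-1) * TR t"
    if st: "s \<in> time_interval T" "t \<in> time_interval T" "s \<le> t" for s t
  proof
    define e where "e = exp (t - s)"
    have e: "e > 0" "exp (3 * (t - s)) = e ^ 3"
      by (simp_all add: e_def exp_of_nat_mult[symmetric] mult.commute)
    \<comment> \<open>The two powers of the volume lose exactly \<open>e ^ 3\<close>, the largest
      factor by which \<open>TR\<close> can grow, and \<open>e\<close>, the smallest one.\<close>
    have pw: "V t powi (-3) = V s powi (-3) / e ^ 3" "V t powi (-1) = V s powi (-1) / e"
      unfolding growth(1)[OF st] e_def[symmetric]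
      by (simp_all add: power_int_minus power_mult_distrib field_simps)
    have "V t powi (-3) * TR t \<le> V t powi (-3) * (e ^ 3 * TR s)"
      using growth(3)[OF st] Vnn e(2) by (intro mult_left_mono) auto
    then show "V t powi (-3) * TR t \<le> V s powi (-3) * TR s" using e(1) unfolding pw by simp
    have "V t powi (-1) * (e * TR s) \<le> V t powi (-1) * TR t"
      using growth(2)[OF st] Vnn unfolding e_def by (intro mult_left_mono) auto
    then show "V s powi (-1) * TR s \<le> V t powi (-1) * TR t" using e(1) unfolding pw by simp
  qed
  then show ?thesis by (auto intro!: monotone_onI)
qed

end
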